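(* There exists a constant $c>0$ not depending on $n_P$ or $n_Q$ such that $$\inf_{\hat f}\ \sup_{(P,Q)\in\Pi}\mathbb{E}\,\mathcal{E}_Q(\hat f)\ \ge\ c\left(n_P^{\frac{2\beta+d}{2\gamma\beta+d}}+n_Q\right)^{-\frac{\beta(1+\alpha)}{2\beta+d}},$$ where the infimum is over all classifiers $\hat f$ constructed from the observed data.
   Context: **Data.** $d\ge 1$; $P$ and $Q$ are probability distributions of a pair $(X,Y)$ on $[0,1]^d\times\{0,1\}$, with $X$-marginals $P_X,Q_X$. One observes $n_P$ i.i.d. pairs $(X_i^P,Y_i^P)\sim P$ and $n_Q$ i.i.d. pairs $(X_i^Q,Y_i^Q)\sim Q$, all mutually independent ($n_P,n_Q\ge 0$ integers, not both zero). $\mathbb{E}$ is expectation over all observed data. A classifier $\hat f$ is a (measurable) function of the observed data and of a point $x$, with values in $\{0,1\}$. **Regression functions and risk.** $\eta_P(x)=P(Y=1|X=x)$ for $x\in\mathrm{supp}(P_X)$ and $\eta_P(x)=\tfrac12$ for all other $x\in\mathbb{R}^d$; $\eta_Q(x)=Q(Y=1|X=x)$ for $x\in\mathrm{supp}(Q_X)$ and $\eta_Q(x)=\tfrac12$ for all other $x\in\mathbb{R}^d$. The Bayes classifier under $Q$ is $f_Q^*(x)=0$ if $\eta_Q(x)\le \frac12$ and $1$ otherwise. $R_Q(\hat f)=\mathbb{P}_{(X,Y)\sim Q}(Y\ne\hat f(X))$ and the excess risk is $\mathcal{E}_Q(\hat f)=R_Q(\hat f)-R_Q(f_Q^* )$.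 **Parameter space.** Fix $\alpha\ge 0$, $C_\alpha>0$, $0<\beta\le 1$, $C_\beta>0$, $\gamma>0$, $C_\gamma>0$, $\mu=(\mu_-,\mu_+)$ with $0<\mu_-<\mu_+$, $c_\mu>0$, $r_\mu>0$, with $\alpha\beta\le d$. $\Pi$ is the set of pairs $(P,Q)$ such that: (i) (relative signal exponent) for all $x\in \mathrm{supp}(P_X)\cup\mathrm{supp}(Q_X)$: $(\eta_P(x)-\frac12)(\eta_Q(x)-\frac12)\ge0$ and $|\eta_P(x)-\frac12|\ge C_\gamma|\eta_Q(x)-\frac12|^\gamma$; (ii) (margin) $Q_X(0<|\eta_Q(X)-\frac12|<t)\le C_\alpha t^\alpha$ for all $t>0$; (iii) (smoothness) $|\eta_Q(x_1)-\eta_Q(x_2)|\le C_\beta\|x_1-x_2\|^\beta$ for all $x_1,x_2\in\mathbb{R}^d$ (Euclidean norm); (iv) (common support and strong density) $P_X,Q_X$ are absolutely continuous with respect to Lebesgue measure $\lambda$ on $\mathbb{R}^d$, $\Omega:=\mathrm{supp}(P_X)=\mathrm{supp}(Q_X)$, $\lambda[\Omega\cap B(x,r)]\ge c_\mu\lambda[B(x,r)]$ for all $0<r\le r_\mu$ and all $x\in\Omega$ (where $B(x,r)$ is the Euclidean ball of center $x$ and radius $r$), and $\mu_-<\frac{dP_X}{d\lambda}(x)<\mu_+$, $\mu_-<\frac{dQ_X}{d\lambda}(x)<\mu_+$ for all $x\in\Omega$.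
   Formalization: It is additionally assumed that some (P,Q) in Π has Q_X(η_Q(X)≠1/2)>0; otherwise (e.g. Π empty when μ_+≤1, or η_Q≡1/2 forced when αβ>1) the minimax excess risk is at most 0 and the claimed bound fails. *)

theory Defs
  imports "HOL-Probability.Probability"
begin

text \<open>
  Points of \<open>\<real>\<^sup>d\<close> are of type \<^typ>\<open>real^'d\<close> with \<open>d = CARD('d)\<close>; the label \<open>Y \<in> {0,1}\<close>
  is a \<^typ>\<open>bool\<close>, with \<^const>\<open>True\<close> for 1.
\<close>

type_synonym 'd observation = "(real^'d) \<times> bool"
type_synonym 'd law = "'d observation measure"
type_synonym 'd data = "(nat \<Rightarrow> 'd observation) \<times> (nat \<Rightarrow> 'd observation)"

abbreviation obs_space :: "('d::finite) law" where
  "obs_space \<equiv> borel \<Otimes>\<^sub>M count_space UNIV"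

definition law_on_cube :: "('d::finite) law \<Rightarrow> bool" where
  "law_on_cube Q \<longleftrightarrow> prob_space Q \<and> sets Q = sets obs_space \<and>
     (AE z in Q. \<forall>i. 0 \<le> fst z $ i \<and> fst z $ i \<le> 1)"

definition marginal :: "('d::finite) law \<Rightarrow> (real^'d) measure" where
  "marginal Q = distr Q borel fst"

definition measure_support :: "'a::topological_space measure \<Rightarrow> 'a set" where
  "measure_support M = {x. \<forall>U. open U \<longrightarrow> x \<in> U \<longrightarrow> emeasure M U > 0}"

text \<open>
  \<open>\<eta>\<close> is a version of \<open>x \<mapsto> Q(Y = 1 | X = x)\<close>, extended by \<open>1/2\<close> off the support of \<open>Q\<^sub>X\<close>.
  Versions differ on \<open>Q\<^sub>X\<close>-null subsets of the support.
\<close>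

definition is_regression_fun :: "('d::finite) law \<Rightarrow> (real^'d \<Rightarrow> real) \<Rightarrow> bool" where
  "is_regression_fun Q \<eta> \<longleftrightarrow>
     \<eta> \<in> borel_measurable borel \<and> (\<forall>x. 0 \<le> \<eta> x \<and> \<eta> x \<le> 1) \<and>
     (\<forall>A\<in>sets borel. measure Q (A \<times> {True}) = (LINT x:A|marginal Q. \<eta> x)) \<and>
     (\<forall>x. x \<notin> measure_support (marginal Q) \<longrightarrow> \<eta> x = 1/2)"

definition regression_fun :: "('d::finite) law \<Rightarrow> real^'d \<Rightarrow> real" where
  "regression_fun Q = (SOME \<eta>. is_regression_fun Q \<eta>)"

definition bayes_classifier :: "('d::finite) law \<Rightarrow> real^'d \<Rightarrow> bool" where
  "bayes_classifier Q x \<longleftrightarrow> \<not> regression_fun Q x \<le> 1/2"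

definition risk :: "('d::finite) law \<Rightarrow> (real^'d \<Rightarrow> bool) \<Rightarrow> real" where
  "risk Q f = \<P>(z in Q. snd z \<noteq> f (fst z))"

text \<open>The risk of the Bayes classifier does not depend on the version selected by
  \<^const>\<open>regression_fun\<close>.\<close>

definition excess_risk :: "('d::finite) law \<Rightarrow> (real^'d \<Rightarrow> bool) \<Rightarrow> real" where
  "excess_risk Q f = risk Q f - risk Q (bayes_classifier Q)"

definition data_space :: "nat \<Rightarrow> nat \<Rightarrow> ('d::finite) data measure" where
  "data_space n\<^sub>P n\<^sub>Q =
     PiM {..<n\<^sub>P} (\<lambda>_. obs_space) \<Otimes>\<^sub>M PiM {..<n\<^sub>Q} (\<lambda>_. obs_space)"

definition data_law :: "nat \<Rightarrow> nat \<Rightarrow> ('d::finite) law \<Rightarrow> 'd law \<Rightarrow> 'd data measure" where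
  "data_law n\<^sub>P n\<^sub>Q P Q = PiM {..<n\<^sub>P} (\<lambda>_. P) \<Otimes>\<^sub>M PiM {..<n\<^sub>Q} (\<lambda>_. Q)"

definition classifiers :: "nat \<Rightarrow> nat \<Rightarrow> (('d::finite) data \<Rightarrow> real^'d \<Rightarrow> bool) set" where
  "classifiers n\<^sub>P n\<^sub>Q =
     {f. (\<lambda>(D, x). f D x) \<in> data_space n\<^sub>P n\<^sub>Q \<Otimes>\<^sub>M borel \<rightarrow>\<^sub>M count_space UNIV}"

definition expected_excess_risk ::
  "nat \<Rightarrow> nat \<Rightarrow> ('d::finite) law \<Rightarrow> 'd law \<Rightarrow> ('d data \<Rightarrow> real^'d \<Rightarrow> bool) \<Rightarrow> real" where
  "expected_excess_risk n\<^sub>P n\<^sub>Q P Q f = (\<integral>D. excess_risk Q (f D) \<partial>data_law n\<^sub>P n\<^sub>Q P Q)"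

definition relative_signal ::
  "real \<Rightarrow> real \<Rightarrow> (real^'d) set \<Rightarrow> (real^'d \<Rightarrow> real) \<Rightarrow> (real^'d \<Rightarrow> real) \<Rightarrow> bool" where
  "relative_signal \<gamma> C\<^sub>\<gamma> S \<eta>P \<eta>Q \<longleftrightarrow>
     (\<forall>x\<in>S. (\<eta>P x - 1/2) * (\<eta>Q x - 1/2) \<ge> 0 \<and>
            \<bar>\<eta>P x - 1/2\<bar> \<ge> C\<^sub>\<gamma> * \<bar>\<eta>Q x - 1/2\<bar> powr \<gamma>)"

definition margin ::
  "real \<Rightarrow> real \<Rightarrow> (real^('d::finite)) measure \<Rightarrow> (real^'d \<Rightarrow> real) \<Rightarrow> bool" where
  "margin \<alpha> C\<^sub>\<alpha> QX \<eta> \<longleftrightarrow>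
     (\<forall>t>0. measure QX {x. 0 < \<bar>\<eta> x - 1/2\<bar> \<and> \<bar>\<eta> x - 1/2\<bar> < t} \<le> C\<^sub>\<alpha> * t powr \<alpha>)"

definition hoelder_smooth :: "real \<Rightarrow> real \<Rightarrow> (real^('d::finite) \<Rightarrow> real) \<Rightarrow> bool" where
  "hoelder_smooth \<beta> C\<^sub>\<beta> \<eta> \<longleftrightarrow> (\<forall>x y. \<bar>\<eta> x - \<eta> y\<bar> \<le> C\<^sub>\<beta> * norm (x - y) powr \<beta>)"

definition regular_set :: "real \<Rightarrow> real \<Rightarrow> (real^('d::finite)) set \<Rightarrow> bool" where
  "regular_set c r\<^sub>0 \<Omega> \<longleftrightarrow>
     (\<forall>x\<in>\<Omega>. \<forall>r. 0 < r \<and> r \<le> r\<^sub>0 \<longrightarrow>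
        measure lborel (\<Omega> \<inter> ball x r) \<ge> c * measure lborel (ball x r))"

text \<open>
  Absolute continuity with a density strictly between \<open>m\<close> and \<open>M\<close> everywhere on \<open>\<Omega>\<close>; as
  densities are only determined up to null sets, this asks for one version with these bounds.
\<close>

definition density_between ::
  "real \<Rightarrow> real \<Rightarrow> (real^('d::finite)) set \<Rightarrow> (real^'d) measure \<Rightarrow> bool" where
  "density_between m M \<Omega> \<nu> \<longleftrightarrow>
     (\<exists>p. p \<in> borel_measurable borel \<and> (\<forall>x. 0 \<le> p x) \<and>
          \<nu> = density lborel (\<lambda>x. ennreal (p x)) \<and> (\<forall>x\<in>\<Omega>. m < p x \<and> p x < M))"

text \<open>
  The parameter space of pairs \<open>(P, Q)\<close>. Membership asks for versions \<open>\<eta>P\<close>, \<open>\<eta>Q\<close> of the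
  regression functions that satisfy the pointwise conditions.
\<close>

definition transfer_class ::
  "real \<Rightarrow> real \<Rightarrow> real \<Rightarrow> real \<Rightarrow> real \<Rightarrow> real \<Rightarrow> real \<Rightarrow> real \<Rightarrow> real \<Rightarrow> real \<Rightarrow>
   (('d::finite) law \<times> 'd law) set" where
  "transfer_class \<alpha> C\<^sub>\<alpha> \<beta> C\<^sub>\<beta> \<gamma> C\<^sub>\<gamma> \<mu>\<^sub>m \<mu>\<^sub>M c\<^sub>\<mu> r\<^sub>\<mu> = {(P, Q).
     law_on_cube P \<and> law_on_cube Q \<and>
     (\<exists>\<eta>P \<eta>Q. is_regression_fun P \<eta>P \<and> is_regression_fun Q \<eta>Q \<and>
        relative_signal \<gamma> C\<^sub>\<gamma>
          (measure_support (marginal P) \<union> measure_support (marginal Q)) \<eta>P \<eta>Q \<and>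
        margin \<alpha> C\<^sub>\<alpha> (marginal Q) \<eta>Q \<and>
        hoelder_smooth \<beta> C\<^sub>\<beta> \<eta>Q) \<and>
     measure_support (marginal P) = measure_support (marginal Q) \<and>
     regular_set c\<^sub>\<mu> r\<^sub>\<mu> (measure_support (marginal Q)) \<and>
     density_between \<mu>\<^sub>m \<mu>\<^sub>M (measure_support (marginal P)) (marginal P) \<and>
     density_between \<mu>\<^sub>m \<mu>\<^sub>M (measure_support (marginal Q)) (marginal Q)}"

text \<open>
  Some parameter values leave no \<open>(P, Q)\<close> with an informative label under \<open>Q\<close>. The class is empty
  if \<open>\<mu>\<^sub>M \<le> 1\<close>; and since \<open>\<eta>Q\<close> is Hoelder on all of \<open>\<real>\<^sup>d\<close> and \<open>1/2\<close> off the support, the level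
  sets near the boundary of \<open>{\<eta>Q \<noteq> 1/2}\<close> violate the margin condition if \<open>\<alpha> * \<beta> > 1\<close>, unless
  \<open>\<eta>Q\<close> is constantly \<open>1/2\<close>. A lower bound on the minimax excess risk needs the following condition,
  as the lemma after it shows.
\<close>

definition informative :: "(('d::finite) law \<times> 'd law) set \<Rightarrow> bool" where
  "informative \<C> \<longleftrightarrow>
     (\<exists>(P, Q)\<in>\<C>. measure (marginal Q) {x. regression_fun Q x \<noteq> 1/2} > 0)"

lemma not_informative_minimax_le_0:
  fixes \<C> :: "(('d::finite) law \<times> 'd law) set"
  assumes "\<C> \<subseteq> transfer_class \<alpha> C\<^sub>\<alpha> \<beta> C\<^sub>\<beta> \<gamma> C\<^sub>\<gamma> \<mu>\<^sub>m \<mu>\<^sub>M c\<^sub>\<mu> r\<^sub>\<mu>" and "\<not> informative \<C>"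
  shows "(INF f\<in>classifiers n\<^sub>P n\<^sub>Q. SUP (P, Q)\<in>\<C>.
            ereal (expected_excess_risk n\<^sub>P n\<^sub>Q P Q f)) \<le> 0"
proof (rule INF_lower2)
  show "(\<lambda>_ _. False) \<in> classifiers n\<^sub>P n\<^sub>Q"
    by (auto simp: classifiers_def)
  have "expected_excess_risk n\<^sub>P n\<^sub>Q P Q (\<lambda>_ _. False) = 0" if PQ: "(P, Q) \<in> \<C>" for P Q
  proof -
    have Q: "prob_space Q" "sets Q = sets obs_space" and ex: "\<exists>\<eta>. is_regression_fun Q \<eta>"
      using PQ assms(1) by (auto simp: transfer_class_def law_on_cube_def)
    interpret prob_space Q by fact
    have fst [measurable]: "fst \<in> Q \<rightarrow>\<^sub>M borel" and snd [measurable]: "snd \<in> Q \<rightarrow>\<^sub>M count_space UNIV"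
      using Q(2) by (simp_all cong: measurable_cong_sets)
    have "is_regression_fun Q (regression_fun Q)"
      unfolding regression_fun_def by (rule someI_ex[OF ex])
    then have [measurable]: "regression_fun Q \<in> borel_measurable borel"
      by (simp add: is_regression_fun_def)
    interpret M: prob_space "marginal Q"
      unfolding marginal_def by (rule prob_space_distr) measurable
    have sets_M [measurable_cong]: "sets (marginal Q) = sets borel"
      by (simp add: marginal_def)
    then have space_M: "space (marginal Q) = UNIV"
      by (simp add: sets_eq_imp_space_eq)
    have "measure (marginal Q) {x. regression_fun Q x \<noteq> 1/2} = 0"
      using assms(2) PQ measure_nonneg[of "marginal Q"] unfolding informative_def
      by (fastforce simp: not_less intro: antisym)
    moreover have "{x \<in> space (marginal Q). regression_fun Q x \<noteq> 1/2} \<in> sets (marginal Q)"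
      by measurable
    ultimately have "AE x in marginal Q. regression_fun Q x = 1/2"
      by (intro AE_I[where N = "{x \<in> space (marginal Q). regression_fun Q x \<noteq> 1/2}"])
         (auto simp: space_M M.emeasure_eq_measure)
    then have AE: "AE z in Q. regression_fun Q (fst z) = 1/2"
      unfolding marginal_def by (subst (asm) AE_distr_iff) auto
    have "risk Q (bayes_classifier Q) = risk Q (\<lambda>_. False)"
      unfolding risk_def
    proof (rule prob_eq_AE)
      show "AE z in Q. (snd z \<noteq> bayes_classifier Q (fst z)) \<longleftrightarrow> (snd z \<noteq> False)"
        using AE by eventually_elim (simp add: bayes_classifier_def)
    qed (unfold bayes_classifier_def, measurable)
    then show ?thesis
      by (simp add: expected_excess_risk_def excess_risk_def)
  qed
  then show "(SUP (P, Q)\<in>\<C>. ereal (expected_excess_risk n\<^sub>P n\<^sub>Q P Q (\<lambda>_ _. False))) \<le> 0"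
    by (auto intro!: SUP_least)
qed

end

theory Submission
  imports Defs
begin

text \<open>
Every classifier has to guess many signs about which the data say next to nothing. The family of
pairs behind the bound changes \<open>\<eta>\<^sub>Q\<close> from \<open>1/2\<close> to \<open>1/2 \<plusminus> u\<close> on \<open>m\<close> disjoint balls of radius \<open>r\<close>, with
arbitrary signs. Both laws share the marginal and the signs, and \<open>\<eta>\<^sub>P = 1/2 \<plusminus> C\<^sub>\<gamma> u^\<gamma>\<close> carries the
weakest signal that the relative signal exponent permits. Here \<open>u\<close> is the steepest Hoelder profile,
\<open>C\<^sub>\<beta>\<close> times the \<open>\<beta>\<close>-th power of the distance to the complement of the ball (\<open>bump\<close>).

Flipping one sign changes the law of an observation by a squared Hellinger distance
of order \<open>r^(2\<beta>+d)\<close> under \<open>Q\<close> and \<open>r^(2\<gamma>\<beta>+d)\<close> under \<open>P\<close>. Affinities multiply over independent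
observations, so if \<open>n\<^sub>Q r^(2\<beta>+d)\<close> and \<open>n\<^sub>P r^(2\<gamma>\<beta>+d)\<close> are small, every test of that sign has total error at
least \<open>1/8\<close> (\<open>product_two_point_error_ge\<close>). Averaging over all sign patterns, as in Assouad's lemma,
for some pattern a classifier loses in total a constant fraction of \<open>m\<close> times the integral of one bump,
which is of order \<open>r^(\<beta>+d)\<close> (\<open>assouad_excess_risk\<close>).

The margin condition bounds \<open>m\<close>. The points with \<open>0 < u < t\<close> form a shell of width
\<open>s = (t/C\<^sub>\<beta>)^(1/\<beta>)\<close> and volume of order \<open>r^(d-1) s\<close>. If \<open>\<alpha>\<beta> \<le> 1\<close>, the condition for all \<open>t\<close> follows from
the one for \<open>s = r\<close>, and \<open>m\<close> of order \<open>r^(\<alpha>\<beta>-d)\<close> is allowed (\<open>margin_signed_bumps\<close>). The loss is then of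
order \<open>m r^(\<beta>+d) = r^(\<beta>(1+\<alpha>))\<close>, and the largest admissible \<open>r\<close> is a multiple of \<open>T\<close> to the power
\<open>-1/(2\<beta>+d)\<close>, where \<open>T\<close> is the effective sample size in the statement (\<open>critical_scale\<close>).

What remains is to fit this family into the class for arbitrary constants, and only the existence of
an informative pair makes this possible (\<open>informative_class_geometry\<close>). Its support \<open>\<Omega>\<close> serves as the support of
the new marginals: it is regular, it contains a ball because the open set \<open>{\<eta>\<^sub>Q \<noteq> 1/2}\<close> lies
in it, and the strict density bounds give \<open>\<mu>\<^sub>m \<lambda>(\<Omega>) < 1 < \<mu>\<^sub>M \<lambda>(\<Omega>)\<close>, so there is a probability density on
\<open>\<Omega>\<close> between the bounds that is constant on a small ball, where all bumps are placed. The pair also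
forces \<open>\<alpha>\<beta> \<le> 1\<close>: near the boundary of \<open>{\<eta>\<^sub>Q \<noteq> 1/2}\<close> Hoelder continuity keeps \<open>\<eta>\<^sub>Q\<close> close to \<open>1/2\<close> on a
set of volume at least of order \<open>s\<close>. If \<open>\<alpha>\<beta> = d\<close>, then \<open>d = 1\<close> and \<open>m\<close> is bounded, so even one bump has to
meet the margin condition with its exact constant. It does so if the density at the bump is at most
\<open>C\<^sub>\<alpha> C\<^sub>\<beta>^\<alpha> / 2\<close>, and the informative pair shows that this exceeds the lower density bound \<open>\<mu>\<^sub>m\<close>.
\<close>

section \<open>Testing two product laws\<close>

text \<open>
Measures on a finite product are determined by boxes, and on a box both sides factor into integrals
over single coordinates.
\<close>

lemma PiM_density:
  assumes "finite I" and [measurable]: "f \<in> borel_measurable M"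
    and M: "sigma_finite_measure M" and D: "sigma_finite_measure (density M f)"
  shows "PiM I (\<lambda>_. density M f) = density (PiM I (\<lambda>_. M)) (\<lambda>x. \<Prod>i\<in>I. f (x i))"
proof -
  interpret M: product_sigma_finite "\<lambda>_. M"
    using M by (simp add: product_sigma_finite_def)
  interpret D: product_sigma_finite "\<lambda>_. density M f"
    using D by (simp add: product_sigma_finite_def)
  show ?thesis
  proof (rule D.PiM_eqI[symmetric, OF \<open>finite I\<close>])
    show "sets (density (PiM I (\<lambda>_. M)) (\<lambda>x. \<Prod>i\<in>I. f (x i))) = sets (PiM I (\<lambda>_. density M f))"
      by (simp cong: sets_PiM_cong)
    fix A assume "\<And>i. i \<in> I \<Longrightarrow> A i \<in> sets (density M f)"
    then have A [measurable]: "\<And>i. i \<in> I \<Longrightarrow> A i \<in> sets M"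
      by simp
    have [measurable]: "Pi\<^sub>E I A \<in> sets (PiM I (\<lambda>_. M))"
      using A \<open>finite I\<close> by (intro sets_PiM_I_finite) auto
    have "emeasure (density (PiM I (\<lambda>_. M)) (\<lambda>x. \<Prod>i\<in>I. f (x i))) (Pi\<^sub>E I A) =
        (\<integral>\<^sup>+x. (\<Prod>i\<in>I. f (x i)) * indicator (Pi\<^sub>E I A) x \<partial>PiM I (\<lambda>_. M))"
      by (rule emeasure_density) measurable
    also have "\<dots> = (\<integral>\<^sup>+x. (\<Prod>i\<in>I. f (x i) * indicator (A i) (x i)) \<partial>PiM I (\<lambda>_. M))"
    proof (rule nn_integral_cong)
      fix x assume "x \<in> space (PiM I (\<lambda>_. M))"
      then have "indicator (Pi\<^sub>E I A) x = (\<Prod>i\<in>I. indicator (A i) (x i) :: ennreal)"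
        using \<open>finite I\<close> by (auto simp: indicator_def PiE_iff space_PiM)
      then show "(\<Prod>i\<in>I. f (x i)) * indicator (Pi\<^sub>E I A) x = (\<Prod>i\<in>I. f (x i) * indicator (A i) (x i))"
        by (simp add: prod.distrib)
    qed
    also have "\<dots> = (\<Prod>i\<in>I. \<integral>\<^sup>+x. f x * indicator (A i) x \<partial>M)"
      by (rule M.product_nn_integral_prod[OF \<open>finite I\<close>]) measurable
    also have "\<dots> = (\<Prod>i\<in>I. emeasure (density M f) (A i))"
      by (intro prod.cong refl) (simp add: emeasure_density A)
    finally show "emeasure (density (PiM I (\<lambda>_. M)) (\<lambda>x. \<Prod>i\<in>I. f (x i))) (Pi\<^sub>E I A) =
        (\<Prod>i\<in>I. emeasure (density M f) (A i))" .
  qed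
qed

text \<open>
The inequality of arithmetic and geometric means with unequal weights. It replaces the Cauchy-Schwarz
inequality in the comparison of testing errors with affinities: the term \<open>2 * p\<close> is charged to the
test, and \<open>(p + q) / 8\<close> integrates to \<open>1/4\<close> for two probability densities.
\<close>

lemma sqrt_mult_le_weighted_sum:
  fixes p q :: real
  assumes "0 \<le> p" "0 \<le> q"
  shows "sqrt (p * q) \<le> 2 * p + (p + q) / 8"
proof -
  have "(2 * p + (p + q) / 8)\<^sup>2 - p * q = ((17 * p - q)\<^sup>2 + 4 * (p * q)) / 64"
    by (simp add: power2_eq_square field_simps)
  also have "\<dots> \<ge> 0"
    using assms by simp
  finally have "p * q \<le> (2 * p + (p + q) / 8)\<^sup>2"
    by simp
  then show ?thesis
    using assms by (intro real_le_lsqrt) auto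
qed

text \<open>
At each point the test errs under exactly one of the two laws, and the density of that law takes the
part of \<open>p\<close> in the preceding inequality.
\<close>

lemma two_point_error_ge_affinity:
  fixes p q :: "'a \<Rightarrow> real"
  assumes [measurable]: "p \<in> borel_measurable M" "q \<in> borel_measurable M"
    and nn: "\<And>x. 0 \<le> p x" "\<And>x. 0 \<le> q x"
    and one: "(\<integral>\<^sup>+x. p x \<partial>M) = 1" "(\<integral>\<^sup>+x. q x \<partial>M) = 1"
    and [measurable]: "A \<in> sets M"
  shows "(\<integral>\<^sup>+x. sqrt (p x * q x) \<partial>M) \<le>
    2 * (emeasure (density M p) A + emeasure (density M q) (space M - A)) + ennreal (1 / 4)"
proof -
  have "(\<integral>\<^sup>+x. sqrt (p x * q x) \<partial>M) \<le>
      (\<integral>\<^sup>+x. 2 * (ennreal (p x) * indicator A x + ennreal (q x) * indicator (space M - A) x)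
          + ennreal (1/8) * (ennreal (p x) + ennreal (q x)) \<partial>M)"
  proof (rule nn_integral_mono)
    fix x assume "x \<in> space M"
    define r where "r = (if x \<in> A then p x else q x)"
    have r: "0 \<le> r"
      using nn by (simp add: r_def)
    have "sqrt (p x * q x) \<le> 2 * r + 1/8 * (p x + q x)"
      using sqrt_mult_le_weighted_sum[of "p x" "q x"] sqrt_mult_le_weighted_sum[of "q x" "p x"] nn[of x]
      by (auto simp: r_def mult.commute add.commute)
    then have "ennreal (sqrt (p x * q x)) \<le> ennreal (2 * r + 1/8 * (p x + q x))"
      by (rule ennreal_leI)
    also have "\<dots> = ennreal (2 * r) + ennreal (1/8 * (p x + q x))"
      using r nn by (intro ennreal_plus) auto
    also have "\<dots> = 2 * ennreal r + ennreal (1/8) * ennreal (p x + q x)"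
      using r nn by (subst (1 2) ennreal_mult) auto
    also have "ennreal (p x + q x) = ennreal (p x) + ennreal (q x)"
      using nn by (intro ennreal_plus)
    also have "ennreal r = ennreal (p x) * indicator A x + ennreal (q x) * indicator (space M - A) x"
      using \<open>x \<in> space M\<close> by (auto simp: r_def)
    finally show "ennreal (sqrt (p x * q x)) \<le>
      2 * (ennreal (p x) * indicator A x + ennreal (q x) * indicator (space M - A) x)
          + ennreal (1/8) * (ennreal (p x) + ennreal (q x))" .
  qed
  also have "\<dots> = 2 * (emeasure (density M p) A + emeasure (density M q) (space M - A)) + ennreal (1/8) * 2"
    by (simp add: nn_integral_add nn_integral_cmult emeasure_density one)
  also have "ennreal (1/8) * 2 = ennreal (1 / 4)"
    using ennreal_mult[of "1/8" 2] by simp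
  finally show ?thesis .
qed

text \<open>
Affinities multiply over independent observations by Fubini's theorem, so the samples have affinity at
least \<open>a ^ m * b ^ n\<close>. An affinity of at least \<open>1/2\<close> keeps the sum of the two error probabilities of
every test above \<open>(1/2 - 1/4) / 2\<close>.
\<close>

lemma product_two_point_error_ge:
  fixes p p' q q' :: "'a \<Rightarrow> real" and B :: "'a measure"
  assumes B: "sigma_finite_measure B"
    and [measurable]: "p \<in> borel_measurable B" "p' \<in> borel_measurable B"
      "q \<in> borel_measurable B" "q' \<in> borel_measurable B"
    and nn: "\<And>x. 0 \<le> p x" "\<And>x. 0 \<le> p' x" "\<And>x. 0 \<le> q x" "\<And>x. 0 \<le> q' x"
    and one: "(\<integral>\<^sup>+x. p x \<partial>B) = 1" "(\<integral>\<^sup>+x. p' x \<partial>B) = 1" "(\<integral>\<^sup>+x. q x \<partial>B) = 1" "(\<integral>\<^sup>+x. q' x \<partial>B) = 1"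
    and affP: "ennreal a \<le> (\<integral>\<^sup>+x. sqrt (p x * p' x) \<partial>B)"
    and affQ: "ennreal b \<le> (\<integral>\<^sup>+x. sqrt (q x * q' x) \<partial>B)"
    and ab: "0 \<le> a" "0 \<le> b" "1/2 \<le> a ^ m * b ^ n"
    and A: "A \<in> sets (PiM {..<m} (\<lambda>_. B) \<Otimes>\<^sub>M PiM {..<n} (\<lambda>_. B))"
  shows "ennreal (1/8) \<le>
     emeasure (PiM {..<m} (\<lambda>_. density B p) \<Otimes>\<^sub>M PiM {..<n} (\<lambda>_. density B q)) A +
     emeasure (PiM {..<m} (\<lambda>_. density B p') \<Otimes>\<^sub>M PiM {..<n} (\<lambda>_. density B q'))
       (space (PiM {..<m} (\<lambda>_. B) \<Otimes>\<^sub>M PiM {..<n} (\<lambda>_. B)) - A)"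
proof -
  interpret B: product_sigma_finite "\<lambda>_. B"
    using B by (simp add: product_sigma_finite_def)
  define M where "M = PiM {..<m} (\<lambda>_. B) \<Otimes>\<^sub>M PiM {..<n} (\<lambda>_. B)"
  have sf: "sigma_finite_measure (PiM {..<k} (\<lambda>_. B))" for k :: nat
    by (rule B.sigma_finite) simp
  have prob: "prob_space (density B f)" if "f \<in> borel_measurable B" "(\<integral>\<^sup>+x. f x \<partial>B) = 1"
    for f :: "'a \<Rightarrow> ennreal"
    using that by (intro prob_spaceI) (simp add: emeasure_density cong: nn_integral_cong)
  have dens: "PiM {..<m} (\<lambda>_. density B f) \<Otimes>\<^sub>M PiM {..<n} (\<lambda>_. density B g) =
      density M (\<lambda>z. ennreal ((\<Prod>i<m. f (fst z i)) * (\<Prod>i<n. g (snd z i))))"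
    if [measurable]: "f \<in> borel_measurable B" "g \<in> borel_measurable B"
      and "(\<integral>\<^sup>+x. f x \<partial>B) = 1" "(\<integral>\<^sup>+x. g x \<partial>B) = 1" "\<And>x. 0 \<le> f x" "\<And>x. 0 \<le> g x"
    for f g :: "'a \<Rightarrow> real"
  proof -
    interpret f: prob_space "density B f" using that by (intro prob) auto
    interpret g: prob_space "density B g" using that by (intro prob) auto
    have eq: "PiM {..<k} (\<lambda>_. density B h) = density (PiM {..<k} (\<lambda>_. B)) (\<lambda>x. ennreal (\<Prod>i<k. h (x i)))"
      if [measurable]: "h \<in> borel_measurable B" and "(\<integral>\<^sup>+x. h x \<partial>B) = 1" "\<And>x. 0 \<le> h x" for k :: nat and h :: "'a \<Rightarrow> real"
    proof -
      interpret h: prob_space "density B h" using that by (intro prob) auto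
      show ?thesis
        by (subst PiM_density) (use that B h.sigma_finite_measure_axioms in \<open>simp_all add: prod_ennreal\<close>)
    qed
    have "prob_space (PiM {..<n} (\<lambda>_. density B g))"
      by (rule prob_space_PiM) (rule g.prob_space_axioms)
    then have "sigma_finite_measure (density (PiM {..<n} (\<lambda>_. B)) (\<lambda>x. ennreal (\<Prod>i<n. g (x i))))"
      by (subst eq[symmetric]) (use that in \<open>auto intro: prob_space_imp_sigma_finite\<close>)
    then show ?thesis
      unfolding M_def using that
      by (simp add: eq, subst pair_measure_density)
         (auto simp: sf case_prod_unfold ennreal_mult prod_nonneg)
  qed
  let ?p = "\<lambda>z. (\<Prod>i<m. p (fst z i)) * (\<Prod>i<n. q (snd z i))"
  let ?q = "\<lambda>z. (\<Prod>i<m. p' (fst z i)) * (\<Prod>i<n. q' (snd z i))"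
  interpret N: sigma_finite_measure "PiM {..<n} (\<lambda>_. B)" by (rule sf)
  have int: "(\<integral>\<^sup>+z. ennreal ((\<Prod>i<m. f (fst z i)) * (\<Prod>i<n. g (snd z i))) \<partial>M) =
     (\<integral>\<^sup>+x. f x \<partial>B) ^ m * (\<integral>\<^sup>+x. g x \<partial>B) ^ n"
    if [measurable]: "f \<in> borel_measurable B" "g \<in> borel_measurable B"
      and "\<And>x. 0 \<le> f x" "\<And>x. 0 \<le> g x" for f g :: "'a \<Rightarrow> real"
  proof -
    have "(\<integral>\<^sup>+z. ennreal ((\<Prod>i<m. f (fst z i)) * (\<Prod>i<n. g (snd z i))) \<partial>M) =
      (\<integral>\<^sup>+x. \<integral>\<^sup>+y. (\<Prod>i<m. ennreal (f (x i))) * (\<Prod>i<n. ennreal (g (y i))) \<partial>PiM {..<n} (\<lambda>_. B) \<partial>PiM {..<m} (\<lambda>_. B))"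
      unfolding M_def
      by (subst N.nn_integral_fst[symmetric]) (use that in \<open>simp_all add: prod_ennreal ennreal_mult prod_nonneg\<close>)
    also have "\<dots> = (\<integral>\<^sup>+x. f x \<partial>B) ^ m * (\<integral>\<^sup>+x. g x \<partial>B) ^ n"
      by (simp add: nn_integral_cmult nn_integral_multc
          B.product_nn_integral_prod[of "{..<m}" "\<lambda>_ x. ennreal (f x)"]
          B.product_nn_integral_prod[of "{..<n}" "\<lambda>_ x. ennreal (g x)"])
    finally show ?thesis .
  qed
  have sqrt_prod: "sqrt (\<Prod>i<k. f i) = (\<Prod>i<k. sqrt (f i))" for k :: nat and f
    by (induction k) (auto simp: real_sqrt_mult)
  have "ennreal (1/2) \<le> ennreal (a ^ m * b ^ n)"
    by (intro ennreal_leI ab)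
  also have "\<dots> = ennreal a ^ m * ennreal b ^ n"
    using ab by (simp add: ennreal_mult ennreal_power)
  also have "\<dots> \<le> (\<integral>\<^sup>+x. sqrt (p x * p' x) \<partial>B) ^ m * (\<integral>\<^sup>+x. sqrt (q x * q' x) \<partial>B) ^ n"
    by (intro mult_mono power_mono affP affQ) auto
  also have "\<dots> = (\<integral>\<^sup>+z. sqrt (?p z * ?q z) \<partial>M)"
    using nn by (subst int[symmetric]) (auto simp: real_sqrt_mult prod.distrib sqrt_prod intro!: nn_integral_cong
       arg_cong[where f = ennreal])
  also have "\<dots> \<le> 2 * (emeasure (density M ?p) A + emeasure (density M ?q) (space M - A)) + ennreal (1 / 4)"
  proof (rule two_point_error_ge_affinity)
    show "A \<in> sets M" using A by (simp add: M_def)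
  qed (use nn in \<open>auto simp: M_def[symmetric] int one intro!: prod_nonneg mult_nonneg_nonneg\<close>,
       unfold M_def, measurable)
  finally have half: "ennreal (1/2) \<le> 2 * (emeasure (density M ?p) A + emeasure (density M ?q) (space M - A)) + ennreal (1 / 4)" .
  then have "ennreal (1/8) \<le> emeasure (density M ?p) A + emeasure (density M ?q) (space M - A)"
  proof (cases "emeasure (density M ?p) A + emeasure (density M ?q) (space M - A)" rule: ennreal_cases)
    case (real r)
    then have "ennreal (1/2) \<le> ennreal (2 * r + 1/4)"
      using half by (simp add: ennreal_mult)
    then show ?thesis
      using real by (subst (asm) ennreal_le_iff) (auto intro!: ennreal_leI)
  next
    case top
    then show ?thesis
      by (simp only: top_greatest)
  qed
  then show ?thesis
    using nn one by (simp add: dens M_def[symmetric])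
qed

section \<open>Laws with a given marginal and regression function\<close>

text \<open>
The law of a pair \<open>(X, Y)\<close> with \<open>X\<close> distributed as \<open>\<nu>\<close> and \<open>Y = 1\<close> with conditional probability \<open>\<eta> X\<close>. As
a density with respect to \<open>\<nu>\<close> times counting measure, all laws with the same marginal have a common
dominating measure, as testing requires.
\<close>

definition labelled_law :: "'a measure \<Rightarrow> ('a \<Rightarrow> real) \<Rightarrow> ('a \<times> bool) measure" where
  "labelled_law \<nu> \<eta> = density (\<nu> \<Otimes>\<^sub>M count_space UNIV)
     (\<lambda>z. ennreal (if snd z then \<eta> (fst z) else 1 - \<eta> (fst z)))"

lemma sigma_finite_count_space_bool: "sigma_finite_measure (count_space (UNIV :: bool set))"
  by (rule sigma_finite_measure_count_space_finite) simp

lemma nn_integral_pair_bool: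
  assumes [measurable]: "f \<in> borel_measurable (\<nu> \<Otimes>\<^sub>M count_space (UNIV :: bool set))"
  shows "(\<integral>\<^sup>+z. f z \<partial>(\<nu> \<Otimes>\<^sub>M count_space UNIV)) = (\<integral>\<^sup>+x. f (x, True) + f (x, False) \<partial>\<nu>)"
proof -
  interpret sigma_finite_measure "count_space (UNIV :: bool set)"
    by (rule sigma_finite_count_space_bool)
  show ?thesis
    by (subst nn_integral_fst[symmetric])
       (simp_all add: nn_integral_count_space_finite sum.cong[OF UNIV_bool refl] add.commute)
qed

lemma sets_labelled_law [measurable_cong]:
  "sets (labelled_law \<nu> \<eta>) = sets (\<nu> \<Otimes>\<^sub>M count_space UNIV)"
  by (simp add: labelled_law_def)

lemma nn_integral_labelled_law:
  assumes [measurable]: "\<eta> \<in> borel_measurable \<nu>" "f \<in> borel_measurable (\<nu> \<Otimes>\<^sub>M count_space UNIV)"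
  shows "(\<integral>\<^sup>+z. f z \<partial>labelled_law \<nu> \<eta>) =
    (\<integral>\<^sup>+x. ennreal (\<eta> x) * f (x, True) + ennreal (1 - \<eta> x) * f (x, False) \<partial>\<nu>)"
  unfolding labelled_law_def
  by (subst nn_integral_density, measurable, subst nn_integral_pair_bool) auto

lemma ennreal_convex_weights: "0 \<le> a \<Longrightarrow> a \<le> 1 \<Longrightarrow> ennreal a + ennreal (1 - a) = 1"
  by (subst ennreal_plus[symmetric]) auto

lemma prob_space_labelled_law:
  assumes "prob_space \<nu>" and [measurable]: "\<eta> \<in> borel_measurable \<nu>"
    and "\<And>x. 0 \<le> \<eta> x" "\<And>x. \<eta> x \<le> 1"
  shows "prob_space (labelled_law \<nu> \<eta>)"
proof (rule prob_spaceI)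
  interpret prob_space \<nu> by fact
  have "emeasure (labelled_law \<nu> \<eta>) (space (labelled_law \<nu> \<eta>)) = (\<integral>\<^sup>+z. 1 \<partial>labelled_law \<nu> \<eta>)"
    by simp
  also have "\<dots> = 1"
    by (subst nn_integral_labelled_law) (auto simp: ennreal_convex_weights assms emeasure_space_1)
  finally show "emeasure (labelled_law \<nu> \<eta>) (space (labelled_law \<nu> \<eta>)) = 1" .
qed

lemma marginal_labelled_law:
  fixes \<nu> :: "(real^'d::finite) measure"
  assumes [measurable_cong]: "sets \<nu> = sets borel" and [measurable]: "\<eta> \<in> borel_measurable borel"
    and \<eta>: "\<And>x. 0 \<le> \<eta> x" "\<And>x. \<eta> x \<le> 1"
  shows "marginal (labelled_law \<nu> \<eta>) = \<nu>"
proof (rule measure_eqI)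
  show "sets (marginal (labelled_law \<nu> \<eta>)) = sets \<nu>"
    by (simp add: marginal_def assms)
  fix A assume "A \<in> sets (marginal (labelled_law \<nu> \<eta>))"
  then have [measurable]: "A \<in> sets borel"
    by (simp add: marginal_def)
  then have [measurable]: "A \<in> sets \<nu>"
    by (simp add: assms)
  have "emeasure (marginal (labelled_law \<nu> \<eta>)) A = (\<integral>\<^sup>+x. indicator A x \<partial>marginal (labelled_law \<nu> \<eta>))"
    by (subst nn_integral_indicator) (auto simp: marginal_def)
  also have "\<dots> = (\<integral>\<^sup>+z. indicator A (fst z) \<partial>labelled_law \<nu> \<eta>)"
    unfolding marginal_def by (rule nn_integral_distr) measurable
  also have "\<dots> = (\<integral>\<^sup>+x. indicator A x \<partial>\<nu>)"
    by (subst nn_integral_labelled_law) (auto simp: distrib_right[symmetric] ennreal_convex_weights \<eta>)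
  finally show "emeasure (marginal (labelled_law \<nu> \<eta>)) A = emeasure \<nu> A"
    by simp
qed

lemma is_regression_fun_labelled_law:
  fixes \<nu> :: "(real^'d::finite) measure"
  assumes "prob_space \<nu>" and sets_\<nu> [measurable_cong]: "sets \<nu> = sets borel"
    and [measurable]: "\<eta> \<in> borel_measurable borel"
    and \<eta>: "\<And>x. 0 \<le> \<eta> x" "\<And>x. \<eta> x \<le> 1"
    and off: "\<And>x. x \<notin> measure_support \<nu> \<Longrightarrow> \<eta> x = 1/2"
  shows "is_regression_fun (labelled_law \<nu> \<eta>) \<eta>"
  unfolding is_regression_fun_def marginal_labelled_law[OF sets_\<nu> \<open>\<eta> \<in> _\<close> \<eta>]
proof (intro conjI allI ballI impI)
  interpret prob_space \<nu> by fact
  fix A :: "(real^'d) set" assume [measurable]: "A \<in> sets borel"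
  then have [measurable]: "A \<in> sets \<nu>"
    by (simp add: assms)
  have [measurable]: "A \<times> {True} \<in> sets (\<nu> \<Otimes>\<^sub>M count_space UNIV)"
    by measurable
  have "emeasure (labelled_law \<nu> \<eta>) (A \<times> {True}) = (\<integral>\<^sup>+z. indicator (A \<times> {True}) z \<partial>labelled_law \<nu> \<eta>)"
    by (subst nn_integral_indicator) (auto simp: sets_labelled_law)
  also have "\<dots> = (\<integral>\<^sup>+x. ennreal (indicator A x * \<eta> x) \<partial>\<nu>)"
    by (subst nn_integral_labelled_law) (auto simp: \<eta> ennreal_mult mult.commute indicator_def intro!: nn_integral_cong)
  finally show "measure (labelled_law \<nu> \<eta>) (A \<times> {True}) = (LINT x:A|\<nu>. \<eta> x)"
    by (simp add: measure_def set_lebesgue_integral_def integral_eq_nn_integral \<eta>)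
qed (use assms in auto)

lemma law_on_cube_labelled_law:
  fixes \<nu> :: "(real^'d::finite) measure"
  assumes \<nu>: "prob_space \<nu>" and sets_\<nu> [measurable_cong]: "sets \<nu> = sets borel"
    and cube: "AE x in \<nu>. \<forall>i. 0 \<le> x $ i \<and> x $ i \<le> 1"
    and \<eta>_meas [measurable]: "\<eta> \<in> borel_measurable borel" and \<eta>: "\<And>x. 0 \<le> \<eta> x" "\<And>x. \<eta> x \<le> 1"
  shows "law_on_cube (labelled_law \<nu> \<eta>)"
  unfolding law_on_cube_def
proof (intro conjI)
  show "prob_space (labelled_law \<nu> \<eta>)"
    by (rule prob_space_labelled_law) (use \<nu> \<eta> in auto)
  show sets: "sets (labelled_law \<nu> \<eta>) = sets obs_space"
    by (simp add: sets_labelled_law cong: sets_pair_measure_cong[OF sets_\<nu> refl])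
  have fst [measurable]: "fst \<in> labelled_law \<nu> \<eta> \<rightarrow>\<^sub>M borel"
    by (simp cong: measurable_cong_sets[OF sets])
  have "AE x in distr (labelled_law \<nu> \<eta>) borel fst. \<forall>i. 0 \<le> x $ i \<and> x $ i \<le> 1"
    using cube unfolding marginal_def[symmetric] marginal_labelled_law[OF sets_\<nu> \<eta>_meas \<eta>] .
  then show "AE z in labelled_law \<nu> \<eta>. \<forall>i. 0 \<le> fst z $ i \<and> fst z $ i \<le> 1"
    by (subst (asm) AE_distr_iff[OF fst]) auto
qed

text \<open>
The Bayes classifier and \<^const>\<open>informative\<close> refer to an unspecified version of the regression
function. Almost everywhere it can be replaced by any concrete version.
\<close>

lemma regression_fun_unique_AE:
  assumes "law_on_cube Q" and 1: "is_regression_fun Q \<eta>\<^sub>1" and 2: "is_regression_fun Q \<eta>\<^sub>2"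
  shows "AE x in marginal Q. \<eta>\<^sub>1 x = \<eta>\<^sub>2 x"
proof (rule density_unique_real)
  interpret Q: prob_space Q using assms by (simp add: law_on_cube_def)
  have sets_Q [measurable_cong]: "sets Q = sets obs_space"
    using assms by (simp add: law_on_cube_def)
  interpret M: prob_space "marginal Q"
    unfolding marginal_def by (rule Q.prob_space_distr) measurable
  have b: "sets (marginal Q) = sets borel"
    by (simp add: marginal_def)
  show "integrable (marginal Q) \<eta>\<^sub>1" "integrable (marginal Q) \<eta>\<^sub>2"
    using 1 2 by (auto intro!: M.integrable_const_bound[where B = 1] simp: is_regression_fun_def cong: measurable_cong_sets[OF b])
  show "(LINT x:A|marginal Q. \<eta>\<^sub>1 x) = (LINT x:A|marginal Q. \<eta>\<^sub>2 x)" if "A \<in> sets (marginal Q)" for A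
    using 1 2 that by (simp add: is_regression_fun_def b)
qed

lemma is_regression_fun_regression_fun:
  "is_regression_fun Q \<eta> \<Longrightarrow> is_regression_fun Q (regression_fun Q)"
  unfolding regression_fun_def by (rule someI[of "is_regression_fun Q"])

lemma risk_labelled_law:
  fixes \<nu> :: "(real^'d::finite) measure"
  assumes "prob_space \<nu>" and sets_\<nu> [measurable_cong]: "sets \<nu> = sets borel"
    and [measurable]: "\<eta> \<in> borel_measurable borel"
    and \<eta>: "\<And>x. 0 \<le> \<eta> x" "\<And>x. \<eta> x \<le> 1"
    and [measurable]: "f \<in> borel \<rightarrow>\<^sub>M count_space UNIV"
  shows "risk (labelled_law \<nu> \<eta>) f = (\<integral>x. (if f x then 1 - \<eta> x else \<eta> x) \<partial>\<nu>)"
proof -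
  have sp: "space (labelled_law \<nu> \<eta>) = UNIV"
    using sets_eq_imp_space_eq[OF sets_labelled_law, of \<nu> \<eta>] sets_eq_imp_space_eq[OF sets_\<nu>]
    by (simp add: space_pair_measure)
  have "{z. snd z \<noteq> f (fst z)} = {z \<in> space (\<nu> \<Otimes>\<^sub>M count_space UNIV). snd z \<noteq> f (fst z)}"
    using sets_eq_imp_space_eq[OF sets_\<nu>] by (auto simp: space_pair_measure)
  also have "\<dots> \<in> sets (\<nu> \<Otimes>\<^sub>M count_space UNIV)"
    by measurable
  finally have wrong: "{z. snd z \<noteq> f (fst z)} \<in> sets (\<nu> \<Otimes>\<^sub>M count_space UNIV)" .
  have "emeasure (labelled_law \<nu> \<eta>) {z. snd z \<noteq> f (fst z)} =
      (\<integral>\<^sup>+z. indicator {z. snd z \<noteq> f (fst z)} z \<partial>labelled_law \<nu> \<eta>)"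
    using wrong by (simp only: nn_integral_indicator sets_labelled_law)
  also have "\<dots> = (\<integral>\<^sup>+x. ennreal (if f x then 1 - \<eta> x else \<eta> x) \<partial>\<nu>)"
    using wrong by (subst nn_integral_labelled_law) (simp_all only: borel_measurable_indicator, auto simp: indicator_def intro!: nn_integral_cong)
  finally show ?thesis
    unfolding risk_def sp by (simp add: measure_def integral_eq_nn_integral \<eta>)
qed

text \<open>
At a point \<open>x\<close> the two labels have conditional probabilities that differ by \<open>\<bar>2 * \<eta> x - 1\<bar>\<close>, which is lost
exactly where the classifier disagrees with the Bayes rule.
\<close>

lemma excess_risk_labelled_law:
  fixes \<nu> :: "(real^'d::finite) measure"
  assumes "prob_space \<nu>" and sets_\<nu> [measurable_cong]: "sets \<nu> = sets borel"
    and law: "law_on_cube (labelled_law \<nu> \<eta>)"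
    and \<eta>_meas [measurable]: "\<eta> \<in> borel_measurable borel"
    and \<eta>: "\<And>x. 0 \<le> \<eta> x" "\<And>x. \<eta> x \<le> 1"
    and off: "\<And>x. x \<notin> measure_support \<nu> \<Longrightarrow> \<eta> x = 1/2"
    and f_meas [measurable]: "f \<in> borel \<rightarrow>\<^sub>M count_space UNIV"
  shows "excess_risk (labelled_law \<nu> \<eta>) f =
    (\<integral>x. \<bar>2 * \<eta> x - 1\<bar> * indicator {x. f x \<noteq> (1/2 < \<eta> x)} x \<partial>\<nu>)"
proof -
  interpret prob_space \<nu> by fact
  let ?Q = "labelled_law \<nu> \<eta>"
  have reg: "is_regression_fun ?Q \<eta>"
    by (rule is_regression_fun_labelled_law) fact+
  have reg': "is_regression_fun ?Q (regression_fun ?Q)"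
    using reg by (rule is_regression_fun_regression_fun)
  have [measurable]: "regression_fun ?Q \<in> borel_measurable borel"
    using reg' by (simp add: is_regression_fun_def)
  have [measurable]: "bayes_classifier ?Q \<in> borel \<rightarrow>\<^sub>M count_space UNIV"
    unfolding bayes_classifier_def[abs_def] by measurable
  have AE: "AE x in \<nu>. regression_fun ?Q x = \<eta> x"
    using regression_fun_unique_AE[OF law reg' reg]
    unfolding marginal_labelled_law[OF sets_\<nu> \<eta>_meas \<eta>] .
  have int: "integrable \<nu> (\<lambda>x. if g x then 1 - \<eta> x else \<eta> x)" if [measurable]: "g \<in> borel \<rightarrow>\<^sub>M count_space UNIV" for g
    using \<eta> by (intro integrable_const_bound[where B = 1]) auto
  have "excess_risk ?Q f =
      (\<integral>x. (if f x then 1 - \<eta> x else \<eta> x) - (if bayes_classifier ?Q x then 1 - \<eta> x else \<eta> x) \<partial>\<nu>)"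
    unfolding excess_risk_def
    by (simp add: risk_labelled_law[OF assms(1) sets_\<nu> \<eta>_meas \<eta>] int)
  also have "\<dots> = (\<integral>x. \<bar>2 * \<eta> x - 1\<bar> * indicator {x. f x \<noteq> (1/2 < \<eta> x)} x \<partial>\<nu>)"
  proof (rule integral_cong_AE)
    show "AE x in \<nu>. (if f x then 1 - \<eta> x else \<eta> x) - (if bayes_classifier ?Q x then 1 - \<eta> x else \<eta> x)
        = \<bar>2 * \<eta> x - 1\<bar> * indicator {x. f x \<noteq> (1/2 < \<eta> x)} x"
      using AE by eventually_elim (auto simp: bayes_classifier_def)
  qed measurable
  finally show ?thesis .
qed

lemma sets_data_law:
  assumes "sets P = sets (obs_space :: ('d::finite) law)" "sets Q = sets (obs_space :: 'd law)"
  shows "sets (data_law m n P Q) = sets (data_space m n)"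
  unfolding data_law_def data_space_def
  by (intro sets_pair_measure_cong sets_PiM_cong refl assms)

lemma prob_space_data_law:
  assumes "prob_space P" "prob_space Q"
  shows "prob_space (data_law m n P Q)"
proof -
  interpret P: prob_space "PiM {..<m} (\<lambda>_. P)" using assms by (intro prob_space_PiM)
  interpret Q: prob_space "PiM {..<n} (\<lambda>_. Q)" using assms by (intro prob_space_PiM)
  have "pair_prob_space (PiM {..<m} (\<lambda>_. P)) (PiM {..<n} (\<lambda>_. Q))" ..
  then show ?thesis
    unfolding data_law_def pair_prob_space_def by (intro prob_spaceI) (simp add: P.emeasure_space_1
      space_pair_measure Q.emeasure_pair_measure_Times Q.emeasure_space_1)
qed

text \<open>
The loss lies in \<open>[0, 1]\<close>, so its Bochner integral over the data is a nonnegative integral; in this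
form the order of integration over data and points can be exchanged freely.
\<close>

lemma expected_excess_risk_labelled_law:
  fixes \<nu> :: "(real^'d::finite) measure"
  assumes "prob_space \<nu>" and sets_\<nu> [measurable_cong]: "sets \<nu> = sets borel"
    and P: "law_on_cube P" and Q: "law_on_cube (labelled_law \<nu> \<eta>)"
    and \<eta>_meas [measurable]: "\<eta> \<in> borel_measurable borel"
    and \<eta>: "\<And>x. 0 \<le> \<eta> x" "\<And>x. \<eta> x \<le> 1"
    and off: "\<And>x. x \<notin> measure_support \<nu> \<Longrightarrow> \<eta> x = 1/2"
    and f: "f \<in> classifiers m n"
  shows "ennreal (expected_excess_risk m n P (labelled_law \<nu> \<eta>) f) =
    (\<integral>\<^sup>+D. \<integral>\<^sup>+x. ennreal \<bar>2 * \<eta> x - 1\<bar> * indicator {x. f D x \<noteq> (1/2 < \<eta> x)} x \<partial>\<nu>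
       \<partial>data_law m n P (labelled_law \<nu> \<eta>))"
proof -
  interpret prob_space \<nu> by fact
  let ?L = "data_law m n P (labelled_law \<nu> \<eta>)"
  interpret L: prob_space ?L
    using P Q by (intro prob_space_data_law) (auto simp: law_on_cube_def)
  have sets_L [measurable_cong]: "sets ?L = sets (data_space m n)"
    using P Q by (intro sets_data_law) (auto simp: law_on_cube_def)
  have f1 [measurable]: "(\<lambda>z. f (fst z) (snd z)) \<in> ?L \<Otimes>\<^sub>M \<nu> \<rightarrow>\<^sub>M count_space UNIV"
    using f by (simp add: classifiers_def case_prod_unfold cong: measurable_cong_sets sets_pair_measure_cong[OF sets_L sets_\<nu>])
  have fD [measurable]: "f D \<in> borel \<rightarrow>\<^sub>M count_space UNIV" if "D \<in> space ?L" for D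
    using measurable_compose[OF measurable_Pair1'[OF that] f1] by (simp cong: measurable_cong_sets[OF sets_\<nu>])
  define e where "e D = (\<integral>\<^sup>+x. ennreal \<bar>2 * \<eta> x - 1\<bar> * indicator {x. f D x \<noteq> (1/2 < \<eta> x)} x \<partial>\<nu>)" for D
  have ind: "indicator {x. f D x \<noteq> (1/2 < \<eta> x)} x = (if f D x \<noteq> (1/2 < \<eta> x) then 1 else 0 :: ennreal)" for D x
    by (simp add: indicator_def)
  have [measurable]: "e \<in> borel_measurable ?L"
    unfolding e_def ind by (rule borel_measurable_nn_integral) measurable
  have e1: "e D \<le> 1" for D
  proof -
    have "e D \<le> (\<integral>\<^sup>+x. 1 \<partial>\<nu>)"
      unfolding e_def using \<eta> by (intro nn_integral_mono) (auto simp: indicator_def abs_le_iff intro!: ennreal_le_1[THEN iffD2])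
    then show ?thesis by (simp add: emeasure_space_1)
  qed
  have "excess_risk (labelled_law \<nu> \<eta>) (f D) = enn2real (e D)" if "D \<in> space ?L" for D
  proof -
    note [measurable] = fD[OF that]
    have ind': "indicator {x. f D x \<noteq> (1/2 < \<eta> x)} x = (if f D x \<noteq> (1/2 < \<eta> x) then 1 else 0 :: real)" for x
      by (simp add: indicator_def)
    have "excess_risk (labelled_law \<nu> \<eta>) (f D) =
        enn2real (\<integral>\<^sup>+x. ennreal (\<bar>2 * \<eta> x - 1\<bar> * indicator {x. f D x \<noteq> (1/2 < \<eta> x)} x) \<partial>\<nu>)"
      by (subst excess_risk_labelled_law[OF assms(1) sets_\<nu> Q \<eta>_meas \<eta> off fD[OF that]])
         (assumption, simp only: ind', rule integral_eq_nn_integral, simp_all)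
    then show ?thesis
      by (simp add: e_def ennreal_mult ennreal_indicator)
  qed
  then have "expected_excess_risk m n P (labelled_law \<nu> \<eta>) f = (\<integral>D. enn2real (e D) \<partial>?L)"
    unfolding expected_excess_risk_def by (intro Bochner_Integration.integral_cong) auto
  also have "\<dots> = enn2real (\<integral>\<^sup>+D. e D \<partial>?L)"
  proof -
    have "e D \<noteq> \<top>" for D
      using e1[of D] by (auto simp: top_unique)
    then show ?thesis
      by (subst integral_eq_nn_integral) (auto simp: less_top intro!: arg_cong[where f = enn2real] nn_integral_cong)
  qed
  also have "(\<integral>\<^sup>+D. e D \<partial>?L) < \<top>"
  proof -
    have "(\<integral>\<^sup>+D. e D \<partial>?L) \<le> (\<integral>\<^sup>+D. 1 \<partial>?L)"
      using e1 by (intro nn_integral_mono) auto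
    then show ?thesis by (auto simp: L.emeasure_space_1 intro: le_less_trans)
  qed
  then have "ennreal (enn2real (\<integral>\<^sup>+D. e D \<partial>?L)) = (\<integral>\<^sup>+D. e D \<partial>?L)"
    by (simp add: less_top)
  finally show ?thesis unfolding e_def .
qed

section \<open>Averaging over sign patterns\<close>

text \<open>
The combinatorial half of Assouad's lemma. Pair each pattern without \<open>c\<close> with the pattern that has
\<open>c\<close> added: the average of \<open>T c \<sigma>\<close> over all \<open>\<sigma>\<close> is at least \<open>I c / 2\<close>, and a pattern with the largest
total is at least as good as the average pattern.
\<close>

lemma exists_sign_pattern_ge_average:
  fixes I :: "'c \<Rightarrow> ennreal" and T :: "'c \<Rightarrow> 'c set \<Rightarrow> ennreal"
  assumes "finite S"
    and pair: "\<And>c \<sigma>. c \<in> S \<Longrightarrow> \<sigma> \<subseteq> S - {c} \<Longrightarrow> I c \<le> T c \<sigma> + T c (insert c \<sigma>)"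
  shows "\<exists>\<sigma>\<subseteq>S. (\<Sum>c\<in>S. I c) \<le> 2 * (\<Sum>c\<in>S. T c \<sigma>)"
proof -
  let ?W = "\<lambda>\<sigma>. \<Sum>c\<in>S. T c \<sigma>"
  \<comment> \<open>Multiplied by the number of patterns, to avoid division in \<open>ennreal\<close>.\<close>
  have half: "2 ^ card S * I c \<le> 2 * (\<Sum>\<sigma>\<in>Pow S. T c \<sigma>)" if "c \<in> S" for c
  proof -
    have S: "Pow S = Pow (S - {c}) \<union> insert c ` Pow (S - {c})"
      using that Pow_insert[of c "S - {c}"] by (simp add: insert_absorb)
    have card: "2 ^ card S = 2 * (2 ^ card (S - {c}) :: ennreal)"
      using \<open>finite S\<close> that by (subst card.remove[of S c]) auto
    have "2 ^ card S * I c = 2 * (\<Sum>\<sigma>\<in>Pow (S - {c}). I c)"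
      using \<open>finite S\<close> by (simp add: card card_Pow mult.assoc of_nat_power)
    also have "\<dots> \<le> 2 * (\<Sum>\<sigma>\<in>Pow (S - {c}). T c \<sigma> + T c (insert c \<sigma>))"
      using pair[OF that] by (intro mult_left_mono sum_mono) auto
    also have "(\<Sum>\<sigma>\<in>Pow (S - {c}). T c \<sigma> + T c (insert c \<sigma>)) =
        (\<Sum>\<sigma>\<in>Pow (S - {c}). T c \<sigma>) + (\<Sum>\<sigma>\<in>insert c ` Pow (S - {c}). T c \<sigma>)"
    proof -
      have "inj_on (insert c) (Pow (S - {c}))"
        by (rule inj_onI) (auto dest!: insert_ident[THEN iffD1, rotated -1])
      then show ?thesis
        by (simp add: sum.distrib sum.reindex)
    qed
    also have "\<dots> = (\<Sum>\<sigma>\<in>Pow S. T c \<sigma>)"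
      unfolding S using \<open>finite S\<close> by (intro sum.union_disjoint[symmetric]) auto
    finally show ?thesis .
  qed
  obtain \<sigma> where \<sigma>: "\<sigma> \<in> Pow S" and max: "\<And>\<tau>. \<tau> \<in> Pow S \<Longrightarrow> ?W \<tau> \<le> ?W \<sigma>"
  proof -
    have fin: "finite (?W ` Pow S)" "?W ` Pow S \<noteq> {}"
      using \<open>finite S\<close> by auto
    then obtain \<sigma> where "\<sigma> \<in> Pow S" "?W \<sigma> = Max (?W ` Pow S)"
      using Max_in[OF fin] by (metis (no_types, lifting) imageE)
    then show ?thesis
      using that[of \<sigma>] fin by (metis (no_types, lifting) Max_ge imageI)
  qed
  have "2 ^ card S * (\<Sum>c\<in>S. I c) \<le> (\<Sum>c\<in>S. 2 * (\<Sum>\<tau>\<in>Pow S. T c \<tau>))"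
    by (subst sum_distrib_left) (intro sum_mono half)
  also have "\<dots> = 2 * (\<Sum>\<tau>\<in>Pow S. ?W \<tau>)"
    by (subst sum.swap) (simp add: sum_distrib_left)
  also have "\<dots> \<le> 2 * (\<Sum>\<tau>\<in>Pow S. ?W \<sigma>)"
    by (intro mult_left_mono sum_mono max) auto
  also have "\<dots> = 2 ^ card S * (2 * ?W \<sigma>)"
    using \<open>finite S\<close> by (simp add: card_Pow of_nat_power mult.left_commute)
  finally have "(\<Sum>c\<in>S. I c) \<le> 2 * ?W \<sigma>"
    by (subst (asm) ennreal_mult_le_mult_iff) (auto simp: ennreal_power[of 2, symmetric] power_eq_top_ennreal)
  then show ?thesis
    using \<sigma> by blast
qed

text \<open>
The level \<open>1/2\<close> perturbed by a copy of \<open>\<phi>\<close> at each centre, upwards at the centres in \<open>\<sigma>\<close> and downwards at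
the others. A set of centres as sign vector turns the flip of one sign into an insertion.
\<close>

definition signed_bumps :: "'a::real_normed_vector set \<Rightarrow> ('a \<Rightarrow> real) \<Rightarrow> 'a set \<Rightarrow> 'a \<Rightarrow> real" where
  "signed_bumps S \<phi> \<sigma> x = 1/2 + (\<Sum>c\<in>S. if c \<in> \<sigma> then \<phi> (x - c) else - \<phi> (x - c))"

lemma signed_bumps_in_ball:
  assumes "finite S" and "pairwise (\<lambda>c c'. 2 * r \<le> dist c c') S"
    and "\<And>x. r \<le> norm x \<Longrightarrow> \<phi> x = 0"
    and "c \<in> S" and "x \<in> ball c r"
  shows "signed_bumps S \<phi> \<sigma> x = (if c \<in> \<sigma> then 1/2 + \<phi> (x - c) else 1/2 - \<phi> (x - c))"
    and "c' \<in> S \<Longrightarrow> c' \<noteq> c \<Longrightarrow> \<phi> (x - c') = 0"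
proof -
  show *: "\<phi> (x - c') = 0" if "c' \<in> S" "c' \<noteq> c" for c'
  proof (rule assms(3))
    have "2 * r \<le> dist c c'"
      using assms(2,4) that by (auto simp: pairwise_def)
    also have "\<dots> \<le> dist c x + dist x c'"
      by (rule dist_triangle)
    finally show "r \<le> norm (x - c')"
      using assms(5) by (simp add: dist_norm)
  qed
  have "(\<Sum>c'\<in>S. if c' \<in> \<sigma> then \<phi> (x - c') else - \<phi> (x - c')) =
      (\<Sum>c'\<in>{c}. if c' \<in> \<sigma> then \<phi> (x - c') else - \<phi> (x - c'))"
    using assms(1,4) * by (intro sum.mono_neutral_right) auto
  then show "signed_bumps S \<phi> \<sigma> x = (if c \<in> \<sigma> then 1/2 + \<phi> (x - c) else 1/2 - \<phi> (x - c))"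
    by (simp add: signed_bumps_def)
qed

lemma signed_bumps_outside:
  assumes "\<And>x. r \<le> norm x \<Longrightarrow> \<phi> x = 0" and "\<And>c. c \<in> S \<Longrightarrow> x \<notin> ball c r"
  shows "signed_bumps S \<phi> \<sigma> x = 1/2"
proof -
  have "\<phi> (x - c) = 0" if "c \<in> S" for c
    using assms(1)[of "x - c"] assms(2)[OF that] by (simp add: dist_norm norm_minus_commute)
  then show ?thesis
    by (auto simp: signed_bumps_def intro!: sum.neutral)
qed

lemma signed_bumps_bounds:
  assumes "finite S" and "pairwise (\<lambda>c c'. 2 * r \<le> dist c c') S"
    and "\<And>x. r \<le> norm x \<Longrightarrow> \<phi> x = 0" and "\<And>x. 0 \<le> \<phi> x" "\<And>x. \<phi> x \<le> 1/2"
  shows "0 \<le> signed_bumps S \<phi> \<sigma> x" "signed_bumps S \<phi> \<sigma> x \<le> 1"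
proof -
  have "0 \<le> signed_bumps S \<phi> \<sigma> x \<and> signed_bumps S \<phi> \<sigma> x \<le> 1"
  proof (cases "\<exists>c\<in>S. x \<in> ball c r")
    case True
    then obtain c where c: "c \<in> S" "x \<in> ball c r" by blast
    show ?thesis
      using assms(4,5)[of "x - c"] by (simp add: signed_bumps_in_ball(1)[OF assms(1-3) c])
  next
    case False
    then show ?thesis
      by (subst (1 2) signed_bumps_outside[OF assms(3)]) auto
  qed
  then show "0 \<le> signed_bumps S \<phi> \<sigma> x" "signed_bumps S \<phi> \<sigma> x \<le> 1"
    by auto
qed

lemma borel_measurable_signed_bumps [measurable]:
  fixes \<phi> :: "'a::euclidean_space \<Rightarrow> real"
  assumes [measurable]: "\<phi> \<in> borel_measurable borel"
  shows "signed_bumps S \<phi> \<sigma> \<in> borel_measurable borel"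
proof -
  have [measurable]: "(\<lambda>x. if c \<in> \<sigma> then \<phi> (x - c) else - \<phi> (x - c)) \<in> borel_measurable borel" for c
    by (cases "c \<in> \<sigma>") simp_all
  show ?thesis
    unfolding signed_bumps_def[abs_def] by measurable
qed

text \<open>
The two laws differ only over the ball around \<open>c\<close>. There the affinity of the two label distributions
with success probabilities \<open>1/2 \<plusminus> \<phi>\<close> is \<open>sqrt (1 - 4 * \<phi>\<^sup>2)\<close>, which is at least \<open>1 - 4 * h\<^sup>2\<close>.
\<close>

lemma affinity_flip_one_bump:
  fixes \<nu> :: "'a::euclidean_space measure"
  assumes "prob_space \<nu>" and sets_\<nu> [measurable_cong]: "sets \<nu> = sets borel"
    and S: "finite S" "pairwise (\<lambda>c c'. 2 * r \<le> dist c c') S"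
    and \<phi>_meas [measurable]: "\<phi> \<in> borel_measurable borel"
    and zero: "\<And>x. r \<le> norm x \<Longrightarrow> \<phi> x = 0" and \<phi>: "\<And>x. 0 \<le> \<phi> x" "\<And>x. \<phi> x \<le> h" and h: "0 \<le> h" "h \<le> 1/2"
    and c: "c \<in> S" "c \<notin> \<sigma>" and V: "measure \<nu> (ball c r) \<le> V"
  defines "k \<equiv> \<lambda>\<sigma> z. if snd z then signed_bumps S \<phi> \<sigma> (fst z) else 1 - signed_bumps S \<phi> \<sigma> (fst z)"
  shows "ennreal (1 - 4 * h\<^sup>2 * V) \<le> (\<integral>\<^sup>+z. sqrt (k \<sigma> z * k (insert c \<sigma>) z) \<partial>(\<nu> \<Otimes>\<^sub>M count_space UNIV))"
proof -
  interpret prob_space \<nu> by fact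
  have [measurable]: "ball c r \<in> sets \<nu>"
    by (simp add: sets_\<nu>)
  have h2: "4 * h\<^sup>2 \<le> 1"
    using power_mono[OF h(2) h(1), of 2] by (simp add: power2_eq_square)
  have point: "1 - 4 * h\<^sup>2 * indicator (ball c r) x \<le>
      sqrt (k \<sigma> (x, True) * k (insert c \<sigma>) (x, True)) + sqrt (k \<sigma> (x, False) * k (insert c \<sigma>) (x, False))" for x
  proof (cases "x \<in> ball c r")
    case True
    note b = signed_bumps_in_ball(1)[OF S zero c(1) True]
    let ?f = "\<phi> (x - c)"
    have f: "?f\<^sup>2 \<le> h\<^sup>2"
      using \<phi> by (intro power_mono) auto
    have "1 - 4 * h\<^sup>2 \<le> 1 - 4 * ?f\<^sup>2"
      using f by simp
    also have "\<dots> \<le> sqrt (1 - 4 * ?f\<^sup>2)"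
    proof (rule real_le_rsqrt)
      have "0 \<le> 1 - 4 * ?f\<^sup>2" "1 - 4 * ?f\<^sup>2 \<le> 1"
        using f h2 by auto
      then show "(1 - 4 * ?f\<^sup>2)\<^sup>2 \<le> 1 - 4 * ?f\<^sup>2"
        by (simp add: power2_eq_square[of "1 - _"] mult_left_le)
    qed
    also have "\<dots> = 2 * sqrt ((1/2 - ?f) * (1/2 + ?f))"
    proof -
      have "1 - 4 * ?f\<^sup>2 = 4 * ((1/2 - ?f) * (1/2 + ?f))"
        by (simp add: power2_eq_square algebra_simps)
      then show ?thesis
        by (simp add: real_sqrt_mult)
    qed
    finally show ?thesis
      using True c(2) by (simp add: k_def b mult.commute)
  next
    case False
    have "signed_bumps S \<phi> (insert c \<sigma>) x = signed_bumps S \<phi> \<sigma> x"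
      using False zero[of "x - c"]
      by (auto simp: signed_bumps_def dist_norm norm_minus_commute intro!: sum.cong)
    moreover have "0 \<le> signed_bumps S \<phi> \<sigma> x" "signed_bumps S \<phi> \<sigma> x \<le> 1"
      using signed_bumps_bounds[OF S zero \<phi>(1)] \<phi>(2) h(2) by (meson order_trans)+
    ultimately show ?thesis
      using False by (simp add: k_def)
  qed
  have [measurable]: "k \<tau> \<in> borel_measurable (\<nu> \<Otimes>\<^sub>M count_space UNIV)" for \<tau>
    unfolding k_def by measurable
  have "1 - 4 * h\<^sup>2 * V \<le> 1 - 4 * h\<^sup>2 * measure \<nu> (ball c r)"
    using V by (simp add: mult_left_mono)
  also have "\<dots> = (\<integral>x. 1 - 4 * h\<^sup>2 * indicator (ball c r) x \<partial>\<nu>)"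
    by (subst Bochner_Integration.integral_diff) (auto simp: prob_space less_top[symmetric])
  finally have "ennreal (1 - 4 * h\<^sup>2 * V) \<le> ennreal (\<integral>x. 1 - 4 * h\<^sup>2 * indicator (ball c r) x \<partial>\<nu>)"
    by (rule ennreal_leI)
  also have "\<dots> = (\<integral>\<^sup>+x. ennreal (1 - 4 * h\<^sup>2 * indicator (ball c r) x) \<partial>\<nu>)"
  proof (intro nn_integral_eq_integral[symmetric] Bochner_Integration.integrable_diff)
    show "AE x in \<nu>. 0 \<le> 1 - 4 * h\<^sup>2 * indicator (ball c r) x"
      using h2 by (auto simp: indicator_def)
  qed (auto simp: less_top[symmetric])
  also have "\<dots> \<le> (\<integral>\<^sup>+x. ennreal (sqrt (k \<sigma> (x, True) * k (insert c \<sigma>) (x, True))) +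
      ennreal (sqrt (k \<sigma> (x, False) * k (insert c \<sigma>) (x, False))) \<partial>\<nu>)"
  proof (intro nn_integral_mono)
    fix x
    have "\<phi> y \<le> 1/2" for y
      using \<phi>(2)[of y] h(2) by linarith
    then have "0 \<le> k \<tau> (x, b)" for \<tau> b
      using signed_bumps_bounds[where \<phi> = \<phi>, OF S zero \<phi>(1)] by (simp add: k_def)
    then show "ennreal (1 - 4 * h\<^sup>2 * indicator (ball c r) x) \<le> ennreal (sqrt (k \<sigma> (x, True) * k (insert c \<sigma>) (x, True))) +
      ennreal (sqrt (k \<sigma> (x, False) * k (insert c \<sigma>) (x, False)))"
      using ennreal_leI[OF point[of x]] by (subst ennreal_plus[symmetric]) simp_all
  qed
  also have "\<dots> = (\<integral>\<^sup>+z. sqrt (k \<sigma> z * k (insert c \<sigma>) z) \<partial>(\<nu> \<Otimes>\<^sub>M count_space UNIV))"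
    by (subst nn_integral_pair_bool) auto
  finally show ?thesis .
qed


text \<open>
The bumps have disjoint supports, so the expected excess risk is a sum over the bumps: at a point of a
ball, the classifier pays \<open>2 * \<phi>\<close> whenever it guesses the sign of that bump wrongly. For a fixed point
its guess is a test between two data laws that differ in one sign, with total error at least \<open>1/8\<close>. The
factor 8 collects this \<open>1/8\<close>, the \<open>2\<close> in the loss, and the \<open>1/2\<close> from averaging over signs.
\<close>

lemma assouad_excess_risk:
  fixes \<nu> :: "(real^'d::finite) measure"
  assumes \<nu>: "prob_space \<nu>" and sets_\<nu> [measurable_cong]: "sets \<nu> = sets borel"
    and cube: "AE x in \<nu>. \<forall>i. 0 \<le> x $ i \<and> x $ i \<le> 1"
    and S: "finite S" "pairwise (\<lambda>c c'. 2 * r \<le> dist c c') S"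
    and supp: "\<And>c. c \<in> S \<Longrightarrow> ball c r \<subseteq> measure_support \<nu>"
    and V: "\<And>c. c \<in> S \<Longrightarrow> measure \<nu> (ball c r) \<le> V"
    and \<phi>_meas [measurable]: "\<phi> \<in> borel_measurable borel" and \<phi>0: "\<And>x. r \<le> norm x \<Longrightarrow> \<phi> x = 0"
    and \<phi>: "\<And>x. 0 \<le> \<phi> x" "\<And>x. \<phi> x \<le> h" and h: "0 \<le> h" "h \<le> 1/2"
    and \<psi>_meas [measurable]: "\<psi> \<in> borel_measurable borel" and \<psi>0: "\<And>x. r \<le> norm x \<Longrightarrow> \<psi> x = 0"
    and \<psi>: "\<And>x. 0 \<le> \<psi> x" "\<And>x. \<psi> x \<le> g" and g: "0 \<le> g" "g \<le> 1/2"
    and affine: "4 * g\<^sup>2 * V \<le> 1" "4 * h\<^sup>2 * V \<le> 1"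
      "1/2 \<le> (1 - 4 * g\<^sup>2 * V) ^ m * (1 - 4 * h\<^sup>2 * V) ^ n"
    and f: "f \<in> classifiers m n"
  shows "\<exists>\<sigma>\<subseteq>S. (\<Sum>c\<in>S. \<integral>\<^sup>+x. ennreal (\<phi> (x - c)) \<partial>\<nu>) \<le>
     8 * ennreal (expected_excess_risk m n (labelled_law \<nu> (signed_bumps S \<psi> \<sigma>)) (labelled_law \<nu> (signed_bumps S \<phi> \<sigma>)) f)"
proof -
  interpret prob_space \<nu> by fact
  let ?P = "\<lambda>\<sigma>. labelled_law \<nu> (signed_bumps S \<psi> \<sigma>)"
  let ?Q = "\<lambda>\<sigma>. labelled_law \<nu> (signed_bumps S \<phi> \<sigma>)"
  let ?L = "\<lambda>\<sigma>. data_law m n (?P \<sigma>) (?Q \<sigma>)"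
  let ?k = "\<lambda>\<phi> \<sigma> z. if snd z then signed_bumps S \<phi> \<sigma> (fst z) else 1 - signed_bumps S \<phi> \<sigma> (fst z)"
  have \<phi>1: "\<phi> x \<le> 1/2" and \<psi>1: "\<psi> x \<le> 1/2" for x
    using \<phi>(2)[of x] \<psi>(2)[of x] h(2) g(2) by linarith+
  have bQ: "0 \<le> signed_bumps S \<phi> \<sigma> x" "signed_bumps S \<phi> \<sigma> x \<le> 1" for \<sigma> x
    using signed_bumps_bounds[where \<phi> = \<phi>, OF S \<phi>0 \<phi>(1) \<phi>1] by auto
  have bP: "0 \<le> signed_bumps S \<psi> \<sigma> x" "signed_bumps S \<psi> \<sigma> x \<le> 1" for \<sigma> x
    using signed_bumps_bounds[where \<phi> = \<psi>, OF S \<psi>0 \<psi>(1) \<psi>1] by auto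
  have lawQ: "law_on_cube (?Q \<sigma>)" and lawP: "law_on_cube (?P \<sigma>)" for \<sigma>
    using law_on_cube_labelled_law[OF \<nu> sets_\<nu> cube] bP bQ by auto
  have off: "signed_bumps S \<phi> \<sigma> x = 1/2" if "x \<notin> measure_support \<nu>" for \<sigma> x
    using that supp by (intro signed_bumps_outside[OF \<phi>0]) blast+
  have sets_L [measurable_cong]: "sets (?L \<sigma>) = sets (data_space m n)" for \<sigma>
    using lawP lawQ by (intro sets_data_law) (auto simp: law_on_cube_def)
  have space_L: "space (?L \<sigma>) = space (data_space m n)" for \<sigma>
    by (rule sets_eq_imp_space_eq) (rule sets_L)
  have L: "prob_space (?L \<sigma>)" for \<sigma>
    using lawP lawQ by (intro prob_space_data_law) (auto simp: law_on_cube_def)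
  have f1 [measurable]: "(\<lambda>z. f (fst z) (snd z)) \<in> data_space m n \<Otimes>\<^sub>M \<nu> \<rightarrow>\<^sub>M count_space UNIV"
    using f by (simp add: classifiers_def case_prod_unfold cong: measurable_cong_sets sets_pair_measure_cong[OF refl sets_\<nu>])
  have f2 [measurable]: "(\<lambda>z. f (snd z) (fst z)) \<in> \<nu> \<Otimes>\<^sub>M ?L \<tau> \<rightarrow>\<^sub>M count_space UNIV" for \<tau>
    using measurable_pair_swap[OF f1]
    by (simp add: case_prod_unfold cong: measurable_cong_sets sets_pair_measure_cong[OF refl sets_L])
  have fx [measurable]: "(\<lambda>D. f D x) \<in> data_space m n \<rightarrow>\<^sub>M count_space UNIV" for x
  proof -
    have "x \<in> space \<nu>"
      using sets_eq_imp_space_eq[OF sets_\<nu>] by simp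
    then show ?thesis
      using measurable_compose[OF measurable_Pair2' f1] by simp
  qed
  \<comment> \<open>The event that the sign of the bump at \<open>c\<close> is guessed wrongly at \<open>x\<close>.\<close>
  define E where "E c \<sigma> x = {D \<in> space (data_space m n). f D x \<noteq> (c \<in> \<sigma>)}" for c :: "real^'d" and \<sigma> x
  have [measurable]: "E c \<sigma> x \<in> sets (data_space m n)" for c \<sigma> x
    unfolding E_def by measurable
  have emeas: "(\<integral>\<^sup>+D. (if f D x \<noteq> (c \<in> \<sigma>) then 1 else 0) \<partial>?L \<tau>) = emeasure (?L \<tau>) (E c \<sigma> x)" for c \<sigma> \<tau> x
  proof -
    have "(\<integral>\<^sup>+D. (if f D x \<noteq> (c \<in> \<sigma>) then 1 else 0) \<partial>?L \<tau>) = (\<integral>\<^sup>+D. indicator (E c \<sigma> x) D \<partial>?L \<tau>)"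
      by (intro nn_integral_cong) (auto simp: E_def space_L)
    then show ?thesis by simp
  qed
  have [measurable]: "(\<lambda>x. emeasure (?L \<tau>) (E c \<sigma> x)) \<in> borel_measurable \<nu>" for c \<sigma> \<tau>
  proof -
    interpret L: prob_space "?L \<tau>" by (rule L)
    have "(\<lambda>x. \<integral>\<^sup>+D. (if f D x \<noteq> (c \<in> \<sigma>) then 1 else 0) \<partial>?L \<tau>) \<in> borel_measurable \<nu>"
      using f2 by (cases "c \<in> \<sigma>") (auto intro!: L.borel_measurable_nn_integral)
    then show ?thesis by (simp only: emeas)
  qed
  define T where "T c \<sigma> = (\<integral>\<^sup>+x. ennreal (2 * \<phi> (x - c)) * emeasure (?L \<sigma>) (E c \<sigma> x) \<partial>\<nu>)" for c \<sigma>
  have risk: "ennreal (expected_excess_risk m n (?P \<sigma>) (?Q \<sigma>) f) = (\<Sum>c\<in>S. T c \<sigma>)" for \<sigma>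
  proof -
    interpret L: prob_space "?L \<sigma>" by (rule L)
    interpret pair_sigma_finite "?L \<sigma>" \<nu> ..
    \<comment> \<open>At most one summand on the right is nonzero, since the balls are disjoint.\<close>
    have loss: "ennreal \<bar>2 * signed_bumps S \<phi> \<sigma> x - 1\<bar> * indicator {x. f D x \<noteq> (1/2 < signed_bumps S \<phi> \<sigma> x)} x =
        (\<Sum>c\<in>S. ennreal (2 * \<phi> (x - c)) * (if f D x \<noteq> (c \<in> \<sigma>) then 1 else 0))" (is "?l = ?r") for D x
    proof (cases "\<exists>c\<in>S. x \<in> ball c r")
      case True
      then obtain c where c: "c \<in> S" "x \<in> ball c r" by blast
      have "?r = (\<Sum>c\<in>{c}. ennreal (2 * \<phi> (x - c)) * (if f D x \<noteq> (c \<in> \<sigma>) then 1 else 0))"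
        using S(1) c signed_bumps_in_ball(2)[where \<phi> = \<phi>, OF S \<phi>0 c] by (intro sum.mono_neutral_right) auto
      also have "\<dots> = ?l"
        using \<phi>(1)[of "x - c"] by (cases "\<phi> (x - c) = 0") (auto simp: signed_bumps_in_ball(1)[OF S \<phi>0 c])
      finally show ?thesis ..
    next
      case False
      then have "\<phi> (x - c) = 0" if "c \<in> S" for c
        using that by (intro \<phi>0) (auto simp: dist_norm norm_minus_commute)
      then show ?thesis
        using False by (subst signed_bumps_outside[OF \<phi>0]) (auto intro!: sum.neutral[symmetric])
    qed
    have "ennreal (expected_excess_risk m n (?P \<sigma>) (?Q \<sigma>) f) =
        (\<integral>\<^sup>+D. \<integral>\<^sup>+x. (\<Sum>c\<in>S. ennreal (2 * \<phi> (x - c)) * (if f D x \<noteq> (c \<in> \<sigma>) then 1 else 0)) \<partial>\<nu> \<partial>?L \<sigma>)"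
      unfolding loss[symmetric]
      by (rule expected_excess_risk_labelled_law[OF \<nu> sets_\<nu> lawP lawQ borel_measurable_signed_bumps[OF \<phi>_meas] bQ _ f])
         (rule off)
    also have "\<dots> = (\<integral>\<^sup>+x. \<integral>\<^sup>+D. (\<Sum>c\<in>S. ennreal (2 * \<phi> (x - c)) * (if f D x \<noteq> (c \<in> \<sigma>) then 1 else 0)) \<partial>?L \<sigma> \<partial>\<nu>)"
      by (rule Fubini'[symmetric]) measurable
    also have "\<dots> = (\<integral>\<^sup>+x. (\<Sum>c\<in>S. ennreal (2 * \<phi> (x - c)) * emeasure (?L \<sigma>) (E c \<sigma> x)) \<partial>\<nu>)"
      by (subst nn_integral_sum, measurable, subst nn_integral_cmult, measurable) (simp only: emeas)
    also have "\<dots> = (\<Sum>c\<in>S. T c \<sigma>)"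
      unfolding T_def by (rule nn_integral_sum) measurable
    finally show ?thesis .
  qed
  have pair: "ennreal (1/4) * (\<integral>\<^sup>+x. ennreal (\<phi> (x - c)) \<partial>\<nu>) \<le> T c \<sigma> + T c (insert c \<sigma>)"
    if c: "c \<in> S" "c \<notin> \<sigma>" for c \<sigma>
  proof -
    have err: "ennreal (1/8) \<le> emeasure (?L \<sigma>) (E c \<sigma> x) + emeasure (?L (insert c \<sigma>)) (E c (insert c \<sigma>) x)" for x
    proof -
      let ?B = "\<nu> \<Otimes>\<^sub>M count_space (UNIV :: bool set)"
      have B: "sigma_finite_measure ?B"
      proof -
        interpret C: sigma_finite_measure "count_space (UNIV :: bool set)"
          by (rule sigma_finite_count_space_bool)
        interpret pair_sigma_finite \<nu> "count_space (UNIV :: bool set)" ..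
        show ?thesis by (rule P.sigma_finite_measure_axioms)
      qed
      have sets_B: "sets (PiM {..<m} (\<lambda>_. ?B) \<Otimes>\<^sub>M PiM {..<n} (\<lambda>_. ?B)) = sets (data_space m n)"
        unfolding data_space_def by (intro sets_pair_measure_cong sets_PiM_cong refl sets_\<nu>)
      have space_B: "space (PiM {..<m} (\<lambda>_. ?B) \<Otimes>\<^sub>M PiM {..<n} (\<lambda>_. ?B)) = space (data_space m n)"
        by (rule sets_eq_imp_space_eq) (rule sets_B)
      have one: "(\<integral>\<^sup>+z. ennreal (?k \<phi> \<tau> z) \<partial>?B) = 1" "(\<integral>\<^sup>+z. ennreal (?k \<psi> \<tau> z) \<partial>?B) = 1" for \<tau>
        by (simp_all add: nn_integral_pair_bool ennreal_convex_weights bP bQ emeasure_space_1)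
      \<comment> \<open>A wrong guess after the flip is a right guess before it, so the two errors belong to one test.\<close>
      have "E c (insert c \<sigma>) x = space (data_space m n) - E c \<sigma> x"
        using c by (auto simp: E_def)
      then have E: "E c (insert c \<sigma>) x = space (PiM {..<m} (\<lambda>_. ?B) \<Otimes>\<^sub>M PiM {..<n} (\<lambda>_. ?B)) - E c \<sigma> x"
        by (simp only: space_B)
      show ?thesis
        unfolding E data_law_def labelled_law_def
      proof (rule product_two_point_error_ge[OF B])
        show "E c \<sigma> x \<in> sets (PiM {..<m} (\<lambda>_. ?B) \<Otimes>\<^sub>M PiM {..<n} (\<lambda>_. ?B))"
          by (simp only: sets_B) measurable
        show "ennreal (1 - 4 * g\<^sup>2 * V) \<le> (\<integral>\<^sup>+z. sqrt (?k \<psi> \<sigma> z * ?k \<psi> (insert c \<sigma>) z) \<partial>?B)"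
          by (rule affinity_flip_one_bump[OF \<nu> sets_\<nu> S \<psi>_meas \<psi>0 \<psi> g c V[OF c(1)]])
        show "ennreal (1 - 4 * h\<^sup>2 * V) \<le> (\<integral>\<^sup>+z. sqrt (?k \<phi> \<sigma> z * ?k \<phi> (insert c \<sigma>) z) \<partial>?B)"
          by (rule affinity_flip_one_bump[OF \<nu> sets_\<nu> S \<phi>_meas \<phi>0 \<phi> h c V[OF c(1)]])
      qed (use one bP bQ affine in auto)
    qed
    have "ennreal (1/4) * (\<integral>\<^sup>+x. ennreal (\<phi> (x - c)) \<partial>\<nu>) = (\<integral>\<^sup>+x. ennreal (2 * \<phi> (x - c)) * ennreal (1/8) \<partial>\<nu>)"
      using \<phi>(1) by (subst nn_integral_cmult[symmetric]) (auto simp: ennreal_mult[symmetric] intro!: nn_integral_cong)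
    also have "\<dots> \<le> (\<integral>\<^sup>+x. ennreal (2 * \<phi> (x - c)) *
        (emeasure (?L \<sigma>) (E c \<sigma> x) + emeasure (?L (insert c \<sigma>)) (E c (insert c \<sigma>) x)) \<partial>\<nu>)"
      by (intro nn_integral_mono mult_left_mono err) auto
    also have "\<dots> = T c \<sigma> + T c (insert c \<sigma>)"
      unfolding T_def by (subst nn_integral_add[symmetric]) (auto simp: distrib_left)
    finally show ?thesis .
  qed
  obtain \<sigma> where "\<sigma> \<subseteq> S" and "(\<Sum>c\<in>S. ennreal (1/4) * (\<integral>\<^sup>+x. ennreal (\<phi> (x - c)) \<partial>\<nu>)) \<le> 2 * (\<Sum>c\<in>S. T c \<sigma>)"
    using exists_sign_pattern_ge_average[OF S(1), of "\<lambda>c. ennreal (1/4) * (\<integral>\<^sup>+x. ennreal (\<phi> (x - c)) \<partial>\<nu>)" T] pair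
    by blast
  then have "4 * (ennreal (1/4) * (\<Sum>c\<in>S. \<integral>\<^sup>+x. ennreal (\<phi> (x - c)) \<partial>\<nu>)) \<le> 4 * (2 * (\<Sum>c\<in>S. T c \<sigma>))"
    by (intro mult_left_mono) (simp_all add: sum_distrib_left)
  also have "4 * (ennreal (1/4) * (\<Sum>c\<in>S. \<integral>\<^sup>+x. ennreal (\<phi> (x - c)) \<partial>\<nu>)) = (\<Sum>c\<in>S. \<integral>\<^sup>+x. ennreal (\<phi> (x - c)) \<partial>\<nu>)"
    using ennreal_mult[of 4 "1/4"] by (simp add: mult.assoc[symmetric])
  finally show ?thesis
    using \<open>\<sigma> \<subseteq> S\<close> by (auto simp: risk mult.assoc[symmetric])
qed

section \<open>Bump functions\<close>

text \<open>
The steepest profile that is \<open>\<beta>\<close>-Hoelder with constant \<open>C\<close> and vanishes outside the ball of radius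
\<open>r\<close>. Steepness keeps the shell of points with small positive values thin, as the margin condition
demands.
\<close>

definition bump :: "real \<Rightarrow> real \<Rightarrow> real \<Rightarrow> 'a::real_normed_vector \<Rightarrow> real" where
  "bump C \<beta> r z = C * max 0 (r - norm z) powr \<beta>"

lemma borel_measurable_bump [measurable]: "bump C \<beta> r \<in> borel_measurable borel"
  unfolding bump_def[abs_def] by measurable

lemma bump_nonneg: "0 \<le> C \<Longrightarrow> 0 \<le> bump C \<beta> r z"
  by (simp add: bump_def)

lemma bump_outside: "r \<le> norm z \<Longrightarrow> bump C \<beta> r z = 0"
  by (simp add: bump_def max_absorb1)

lemma bump_le: "0 \<le> C \<Longrightarrow> 0 \<le> \<beta> \<Longrightarrow> 0 \<le> r \<Longrightarrow> bump C \<beta> r z \<le> C * r powr \<beta>"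
  unfolding bump_def by (intro mult_left_mono powr_mono2) auto

text \<open>
For a fraction \<open>u\<close> in \<open>[0, 1]\<close> one has \<open>u \<le> u powr \<beta>\<close>; apply this to \<open>x / (x + y)\<close> and \<open>y / (x + y)\<close>, whose sum
is 1.
\<close>

lemma powr_subadditive:
  fixes x y \<beta> :: real
  assumes "0 \<le> x" "0 \<le> y" "0 < \<beta>" "\<beta> \<le> 1"
  shows "(x + y) powr \<beta> \<le> x powr \<beta> + y powr \<beta>"
proof (cases "x + y = 0")
  case True
  then show ?thesis by simp
next
  case False
  then have "0 < x + y" using assms by simp
  have frac: "u \<le> u powr \<beta>" if "0 \<le> u" "u \<le> 1" for u :: real
    using powr_mono'[of \<beta> 1 u] that assms by simp
  have "1 = x / (x + y) + y / (x + y)"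
    using False by (simp add: add_divide_distrib[symmetric])
  also have "\<dots> \<le> (x / (x + y)) powr \<beta> + (y / (x + y)) powr \<beta>"
    using assms \<open>0 < x + y\<close> by (intro add_mono frac) auto
  also have "\<dots> = (x powr \<beta> + y powr \<beta>) / (x + y) powr \<beta>"
    using assms by (simp add: powr_divide add_divide_distrib)
  finally show ?thesis
    using \<open>0 < x + y\<close> by (simp add: pos_le_divide_eq)
qed

lemma abs_powr_diff_le:
  fixes x y \<beta> :: real
  assumes "0 \<le> x" "0 \<le> y" "0 < \<beta>" "\<beta> \<le> 1"
  shows "\<bar>x powr \<beta> - y powr \<beta>\<bar> \<le> \<bar>x - y\<bar> powr \<beta>"
proof -
  have *: "\<bar>u powr \<beta> - v powr \<beta>\<bar> \<le> \<bar>u - v\<bar> powr \<beta>" if "0 \<le> v" "v \<le> u" for u v :: real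
    using powr_subadditive[of v "u - v" \<beta>] powr_mono2[of \<beta> v u] that assms by auto
  show ?thesis
    using *[of x y] *[of y x] assms by (cases "x \<le> y") (auto simp: abs_minus_commute)
qed

lemma bump_hoelder:
  assumes "0 \<le> C" "0 < \<beta>" "\<beta> \<le> 1"
  shows "\<bar>bump C \<beta> r x - bump C \<beta> r y\<bar> \<le> C * norm (x - y) powr \<beta>"
proof -
  let ?f = "\<lambda>z. max 0 (r - norm z)"
  have "\<bar>bump C \<beta> r x - bump C \<beta> r y\<bar> = C * \<bar>?f x powr \<beta> - ?f y powr \<beta>\<bar>"
    using assms by (simp add: bump_def abs_mult right_diff_distrib[symmetric])
  also have "\<dots> \<le> C * \<bar>?f x - ?f y\<bar> powr \<beta>"
    using assms by (intro mult_left_mono abs_powr_diff_le) auto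
  also have "\<dots> \<le> C * norm (x - y) powr \<beta>"
  proof (intro mult_left_mono powr_mono2)
    have "\<bar>?f x - ?f y\<bar> \<le> \<bar>norm x - norm y\<bar>" by (auto simp: max_def)
    also have "\<dots> \<le> norm (x - y)" by (rule norm_triangle_ineq3)
    finally show "\<bar>?f x - ?f y\<bar> \<le> norm (x - y)" .
  qed (use assms in auto)
  finally show ?thesis .
qed

lemma separated_balls_disjoint:
  fixes S :: "'a::metric_space set"
  assumes r: "0 < r" and sep: "pairwise (\<lambda>c c'. (2 + 2 powr (1/\<beta>)) * r \<le> dist c c') S"
  shows "pairwise (\<lambda>c c'. 2 * r \<le> dist c c') S"
proof (rule pairwise_mono[OF sep])
  fix c c' :: 'a assume "(2 + 2 powr (1/\<beta>)) * r \<le> dist c c'"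
  moreover have "2 * r \<le> (2 + 2 powr (1/\<beta>)) * r"
    using r by (intro mult_right_mono) auto
  ultimately show "2 * r \<le> dist c c'" by linarith
qed simp

text \<open>
A pair of points that meets at most one ball sees the increments of a single bump. Points in
two different balls may have values \<open>2 * C * r powr \<beta>\<close> apart if the signs differ; the additional gap of
\<open>2 powr (1/\<beta>) * r\<close> between the balls accounts for this, so the family has the same Hoelder constant as
one bump.
\<close>

lemma hoelder_smooth_signed_bumps:
  fixes S :: "(real^'d::finite) set"
  assumes C: "0 \<le> C" and \<beta>: "0 < \<beta>" "\<beta> \<le> 1" and r: "0 < r" and S: "finite S"
    and sep: "pairwise (\<lambda>c c'. (2 + 2 powr (1/\<beta>)) * r \<le> dist c c') S"
  shows "hoelder_smooth \<beta> C (signed_bumps S (bump C \<beta> r) \<sigma>)"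
proof -
  let ?\<eta> = "signed_bumps S (bump C \<beta> r) \<sigma>"
  have sep2: "pairwise (\<lambda>c c'. 2 * r \<le> dist c c') S"
    using r sep by (rule separated_balls_disjoint)
  have inb: "?\<eta> x = (if c \<in> \<sigma> then 1/2 + bump C \<beta> r (x - c) else 1/2 - bump C \<beta> r (x - c))"
    if "c \<in> S" "x \<in> ball c r" for c x
    by (rule signed_bumps_in_ball(1)[OF S sep2 _ that]) (rule bump_outside)
  have outb: "?\<eta> x = 1/2" if "\<And>c. c \<in> S \<Longrightarrow> x \<notin> ball c r" for x
    by (rule signed_bumps_outside[of r]) (simp_all add: bump_outside that del: mem_ball)
  have one: "\<bar>?\<eta> x - ?\<eta> y\<bar> \<le> C * norm (x - y) powr \<beta>"
    if c: "c \<in> S" "x \<in> ball c r" and y: "\<And>c'. c' \<in> S \<Longrightarrow> c' \<noteq> c \<Longrightarrow> y \<notin> ball c' r" for c x y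
  proof -
    have "?\<eta> y = (if c \<in> \<sigma> then 1/2 + bump C \<beta> r (y - c) else 1/2 - bump C \<beta> r (y - c))"
    proof (cases "y \<in> ball c r")
      case True
      with c(1) show ?thesis by (rule inb)
    next
      case False
      then have "bump C \<beta> r (y - c) = 0"
        by (intro bump_outside) (simp add: dist_norm norm_minus_commute)
      moreover have "?\<eta> y = 1/2"
        using y False by (intro outb) auto
      ultimately show ?thesis by simp
    qed
    moreover have "?\<eta> x = (if c \<in> \<sigma> then 1/2 + bump C \<beta> r (x - c) else 1/2 - bump C \<beta> r (x - c))"
      using c by (rule inb)
    ultimately have "\<bar>?\<eta> x - ?\<eta> y\<bar> = \<bar>bump C \<beta> r (x - c) - bump C \<beta> r (y - c)\<bar>"
      by auto
    also have "\<dots> \<le> C * norm ((x - c) - (y - c)) powr \<beta>"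
      using C \<beta> by (rule bump_hoelder)
    finally show ?thesis by simp
  qed
  have "\<bar>?\<eta> x - ?\<eta> y\<bar> \<le> C * norm (x - y) powr \<beta>" for x y
  proof (cases "\<exists>c\<in>S. x \<in> ball c r")
    case True
    then obtain c where c: "c \<in> S" "x \<in> ball c r" by blast
    show ?thesis
    proof (cases "\<exists>c'\<in>S. c' \<noteq> c \<and> y \<in> ball c' r")
      case True
      then obtain c' where c': "c' \<in> S" "c' \<noteq> c" "y \<in> ball c' r" by blast
      have "(2 + 2 powr (1/\<beta>)) * r \<le> dist c c'"
        using sep c(1) c'(1,2) by (auto simp: pairwise_def)
      also have "\<dots> \<le> dist c x + dist x y + dist c' y"
        using dist_triangle[of c c' x] dist_triangle[of x c' y] by (simp add: dist_commute)
      finally have far: "2 powr (1/\<beta>) * r \<le> norm (x - y)"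
        using c(2) c'(3) by (simp add: dist_norm[of x y] algebra_simps)
      have half: "\<bar>?\<eta> z - 1/2\<bar> \<le> C * r powr \<beta>" if "c \<in> S" "z \<in> ball c r" for c z
        using inb[OF that] bump_le[of C \<beta> r "z - c"] bump_nonneg[of C \<beta> r "z - c"] C \<beta> r by auto
      have "\<bar>?\<eta> x - ?\<eta> y\<bar> \<le> C * (2 * r powr \<beta>)"
        using half[OF c] half[OF c'(1,3)] by linarith
      also have "2 * r powr \<beta> = (2 powr (1/\<beta>) * r) powr \<beta>"
        using r \<beta> by (simp add: powr_mult powr_powr)
      also have "C * \<dots> \<le> C * norm (x - y) powr \<beta>"
        using far r \<beta> C by (intro mult_left_mono powr_mono2) auto
      finally show ?thesis .
    next
      case False
      then show ?thesis by (intro one[OF c]) auto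
    qed
  next
    case False
    then have x: "?\<eta> x = 1/2" by (intro outb) auto
    show ?thesis
    proof (cases "\<exists>c\<in>S. y \<in> ball c r")
      case True
      then obtain c where c: "c \<in> S" "y \<in> ball c r" by blast
      then show ?thesis
        using one[OF c, of x] False by (auto simp: abs_minus_commute norm_minus_commute)
    next
      case False
      then have y: "?\<eta> y = 1/2" by (intro outb) auto
      show ?thesis
        unfolding x y using C by simp
    qed
  qed
  then show ?thesis
    by (simp add: hoelder_smooth_def)
qed

text \<open>
Bernoulli's inequality. In \<open>n\<close> dimensions this bounds the volume of a shell of width \<open>s\<close> in a ball of
radius \<open>r\<close>, relative to the unit ball.
\<close>

lemma power_diff_shell:
  fixes r s :: real
  assumes "0 < r" "0 \<le> s" "s \<le> r"
  shows "r ^ n - (r - s) ^ n \<le> real n * r ^ n * (s / r)"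
proof -
  have "1 + real n * (- (s / r)) \<le> (1 + - (s / r)) ^ n"
    using assms by (intro Bernoulli_inequality) (simp add: field_simps)
  then have "r ^ n * (1 + real n * (- (s / r))) \<le> r ^ n * (1 + - (s / r)) ^ n"
    using assms by (intro mult_left_mono) auto
  also have "\<dots> = (r - s) ^ n"
    using assms by (simp add: power_mult_distrib[symmetric] right_diff_distrib)
  finally show ?thesis
    by (simp add: algebra_simps)
qed

text \<open>
Values at distance less than \<open>t\<close> from \<open>1/2\<close>, other than \<open>1/2\<close>, occur only in the shells of width
\<open>s = (t / C) powr (1 / \<beta>)\<close> along the spheres. Their total mass is at most \<open>s / r\<close> times the left-hand side
of the assumption on \<open>card S\<close>. Since \<open>\<alpha> * \<beta> \<le> 1\<close>, the factor \<open>s / r \<le> 1\<close> is at most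
\<open>(s / r) powr (\<alpha> * \<beta>)\<close>, which is the dependence on \<open>t\<close> that the margin condition asks for.
\<close>

lemma margin_signed_bumps:
  fixes S :: "(real^'d::finite) set"
  assumes \<nu>: "prob_space \<nu>" and sets_\<nu>: "sets \<nu> = sets borel"
    and C: "0 < C" and \<alpha>: "0 \<le> \<alpha>" and \<beta>: "0 < \<beta>" and ab: "\<alpha> * \<beta> \<le> 1" and r: "0 < r" and S: "finite S"
    and sep: "pairwise (\<lambda>c c'. 2 * r \<le> dist c c') S"
    and dens: "\<And>c A. c \<in> S \<Longrightarrow> A \<subseteq> ball c r \<Longrightarrow> A \<in> sets borel \<Longrightarrow> measure \<nu> A = a * measure lborel A" and a: "0 \<le> a"
    and few: "real (card S) * (a * unit_ball_vol (real CARD('d)) * real CARD('d) * r ^ CARD('d)) \<le>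
      C\<^sub>\<alpha> * C powr \<alpha> * r powr (\<alpha> * \<beta>)"
    and C\<alpha>: "0 < C\<^sub>\<alpha>"
  shows "margin \<alpha> C\<^sub>\<alpha> \<nu> (signed_bumps S (bump C \<beta> r) \<sigma>)"
  unfolding margin_def
proof (intro allI impI)
  fix t :: real assume t: "0 < t"
  interpret prob_space \<nu> by fact
  let ?\<eta> = "signed_bumps S (bump C \<beta> r) \<sigma>" and ?v = "unit_ball_vol (real CARD('d))" and ?d = "CARD('d)"
  define s where "s = (t / C) powr (1 / \<beta>)"
  \<comment> \<open>For \<open>s > r\<close> the shell is the whole ball.\<close>
  define s' where "s' = min s r"
  have s: "0 < s" "C * s powr \<beta> = t"
    using t C \<beta> by (auto simp: s_def powr_powr)
  have s': "0 < s'" "s' \<le> r" "s' \<le> s"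
    using s r by (auto simp: s'_def)
  have sub: "{x. 0 < \<bar>?\<eta> x - 1/2\<bar> \<and> \<bar>?\<eta> x - 1/2\<bar> < t} \<subseteq> (\<Union>c\<in>S. ball c r - ball c (r - s'))"
  proof
    fix x assume x: "x \<in> {x. 0 < \<bar>?\<eta> x - 1/2\<bar> \<and> \<bar>?\<eta> x - 1/2\<bar> < t}"
    have "?\<eta> x = 1/2" if "\<And>c. c \<in> S \<Longrightarrow> x \<notin> ball c r"
      by (rule signed_bumps_outside[of r]) (simp_all add: bump_outside that del: mem_ball)
    then obtain c where c: "c \<in> S" "x \<in> ball c r"
      using x by fastforce
    have "?\<eta> x = (if c \<in> \<sigma> then 1/2 + bump C \<beta> r (x - c) else 1/2 - bump C \<beta> r (x - c))"
      by (rule signed_bumps_in_ball(1)[OF S sep _ c]) (rule bump_outside)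
    then have "\<bar>?\<eta> x - 1/2\<bar> = bump C \<beta> r (x - c)"
      using bump_nonneg[of C \<beta> r "x - c"] C by auto
    also have "\<dots> = C * (r - dist c x) powr \<beta>"
      using c(2) by (simp add: bump_def dist_norm norm_minus_commute)
    finally have "(r - dist c x) powr \<beta> < s powr \<beta>"
      using x C by (simp add: s(2)[symmetric])
    then have "r - dist c x < s"
      using powr_less_cancel2[of \<beta>] powr_mono2[of \<beta> s "r - dist c x"] \<beta> s by (meson less_le_not_le linorder_not_less order_less_imp_le)
    moreover have "r - dist c x \<le> r" by simp
    ultimately have "x \<notin> ball c (r - s')"
      by (auto simp: s'_def min_def)
    then show "x \<in> (\<Union>c\<in>S. ball c r - ball c (r - s'))"
      using c by auto
  qed
  have "measure \<nu> {x. 0 < \<bar>?\<eta> x - 1/2\<bar> \<and> \<bar>?\<eta> x - 1/2\<bar> < t} \<le> measure \<nu> (\<Union>c\<in>S. ball c r - ball c (r - s'))"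
    using sub by (rule finite_measure_mono) (auto simp: sets_\<nu> S intro!: sets.finite_UN)
  also have "\<dots> \<le> (\<Sum>c\<in>S. measure \<nu> (ball c r - ball c (r - s')))"
    using S by (intro finite_measure_subadditive_finite) (auto simp: sets_\<nu>)
  also have "\<dots> = (\<Sum>c\<in>S. a * (?v * (r ^ ?d - (r - s') ^ ?d)))"
  proof (rule sum.cong[OF refl])
    fix c assume c: "c \<in> S"
    have "measure lborel (ball c r - ball c (r - s')) = measure lborel (ball c r) - measure lborel (ball c (r - s'))"
      using s' by (intro measure_Diff) (use emeasure_bounded_finite[OF bounded_ball, of c r] in auto)
    also have "\<dots> = ?v * (r ^ ?d - (r - s') ^ ?d)"
      using r s' by (simp add: content_ball right_diff_distrib)
    finally show "measure \<nu> (ball c r - ball c (r - s')) = a * (?v * (r ^ ?d - (r - s') ^ ?d))"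
      using dens[OF c, of "ball c r - ball c (r - s')"] by simp
  qed
  also have "\<dots> \<le> (\<Sum>c\<in>S. a * (?v * (real ?d * r ^ ?d * (s' / r))))"
    using a s' r by (intro sum_mono mult_left_mono power_diff_shell) auto
  also have "\<dots> = real (card S) * (a * ?v * real ?d * r ^ ?d) * (s' / r)"
    by (simp add: algebra_simps)
  also have "\<dots> \<le> (C\<^sub>\<alpha> * C powr \<alpha> * r powr (\<alpha> * \<beta>)) * (s' / r)"
    using few s' r by (intro mult_right_mono) auto
  also have "\<dots> \<le> (C\<^sub>\<alpha> * C powr \<alpha> * r powr (\<alpha> * \<beta>)) * (s' / r) powr (\<alpha> * \<beta>)"
    using s' r ab C C\<alpha> powr_mono'[of "\<alpha> * \<beta>" 1 "s' / r"] by (intro mult_left_mono) auto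
  also have "\<dots> = C\<^sub>\<alpha> * (C powr \<alpha> * s' powr (\<alpha> * \<beta>))"
    using s' r by (simp add: powr_divide)
  also have "\<dots> \<le> C\<^sub>\<alpha> * (C powr \<alpha> * s powr (\<alpha> * \<beta>))"
    using s' \<alpha> \<beta> C\<alpha> by (intro mult_left_mono powr_mono2) auto
  also have "C powr \<alpha> * s powr (\<alpha> * \<beta>) = t powr \<alpha>"
    using s C by (simp add: s(2)[symmetric] powr_mult powr_powr mult.commute)
  finally show "measure \<nu> {x. 0 < \<bar>?\<eta> x - 1/2\<bar> \<and> \<bar>?\<eta> x - 1/2\<bar> < t} \<le> C\<^sub>\<alpha> * t powr \<alpha>" .
qed

section \<open>Supports and densities\<close>

lemma closed_measure_support: "closed (measure_support M)"
proof -
  have "- measure_support M = \<Union>{U. open U \<and> emeasure M U = 0}"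
    by (auto simp: measure_support_def zero_less_iff_neq_zero)
  moreover have "open (\<Union>{U. open U \<and> emeasure M U = 0})"
    by (rule open_Union) auto
  ultimately show ?thesis
    by (simp add: closed_def)
qed

text \<open>
By Lindelof's theorem countably many open null sets cover the complement of the support.
\<close>

lemma emeasure_outside_measure_support:
  fixes M :: "'a::second_countable_topology measure"
  assumes "sets M = sets borel"
  shows "emeasure M (- measure_support M) = 0"
proof -
  let ?F = "{U. open U \<and> emeasure M U = 0}"
  have eq: "- measure_support M = \<Union>?F"
    by (auto simp: measure_support_def zero_less_iff_neq_zero)
  obtain F' where F': "F' \<subseteq> ?F" "countable F'" "\<Union>F' = \<Union>?F"
    using Lindelof[of ?F] by (metis (no_types, lifting) mem_Collect_eq)
  have "(\<Union>U\<in>F'. U) \<in> null_sets M"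
    using F' by (intro null_sets_UN') (auto simp: null_sets_def assms)
  then have "emeasure M (\<Union>F') = 0"
    by (simp add: null_sets_def)
  then show ?thesis
    unfolding eq F'(3)[symmetric] .
qed

lemma AE_unit_cube_of_support:
  fixes \<nu> :: "(real^'d::finite) measure"
  assumes sets_\<nu>: "sets \<nu> = sets borel" and supp: "measure_support \<nu> \<subseteq> cbox 0 1"
  shows "AE x in \<nu>. \<forall>i. 0 \<le> x $ i \<and> x $ i \<le> 1"
proof (rule AE_I')
  show "- measure_support \<nu> \<in> null_sets \<nu>"
    using emeasure_outside_measure_support[OF sets_\<nu>] closed_measure_support[of \<nu>]
    by (simp add: null_sets_def sets_\<nu> borel_open open_Compl)
  show "{x \<in> space \<nu>. \<not> (\<forall>i. 0 \<le> x $ i \<and> x $ i \<le> 1)} \<subseteq> - measure_support \<nu>"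
    using supp by (force simp: mem_box_cart)
qed

lemma measure_support_subset_closed:
  assumes "closed C" and "sets M = sets borel" and "AE x in M. x \<in> C"
  shows "measure_support M \<subseteq> C"
proof
  fix x assume x: "x \<in> measure_support M"
  have sp: "space M = UNIV"
    using sets_eq_imp_space_eq[OF assms(2)] by simp
  have "- C \<in> sets M"
    using assms(1,2) by (simp add: borel_open open_Compl)
  then have "emeasure M (- C) = 0"
    using assms(3) by (subst (asm) AE_iff_measurable[of "- C"]) (auto simp: sp)
  then show "x \<in> C"
    using x assms(1) by (auto simp: measure_support_def open_Compl dest!: spec[of _ "- C"])
qed

lemma integrable_density_of_prob:
  fixes p :: "'a::euclidean_space \<Rightarrow> real"
  assumes "prob_space (density lborel (\<lambda>x. ennreal (p x)))" and [measurable]: "p \<in> borel_measurable borel"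
    and "\<And>x. 0 \<le> p x"
  shows "integrable lborel p"
proof -
  interpret prob_space "density lborel (\<lambda>x. ennreal (p x))" by fact
  have "(\<integral>\<^sup>+x. ennreal (p x) \<partial>lborel) = 1"
    using emeasure_space_1 by (simp add: emeasure_density cong: nn_integral_cong)
  then show ?thesis
    using assms(3) by (intro integrableI_nonneg) auto
qed

text \<open>
The strictness matters below: it leaves room to redistribute mass inside the density bounds, and it
gives the strict inequality between the constants in dimension one.
\<close>

lemma measure_density_bounds_strict:
  fixes p :: "'a::euclidean_space \<Rightarrow> real"
  defines "\<nu> \<equiv> density lborel (\<lambda>x. ennreal (p x))"
  assumes prob: "prob_space \<nu>" and [measurable]: "p \<in> borel_measurable borel" and p0: "\<And>x. 0 \<le> p x"
    and between: "\<And>x. x \<in> A \<Longrightarrow> m < p x \<and> p x < M"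
    and [measurable]: "A \<in> sets borel" and A: "emeasure lborel A \<noteq> 0" "emeasure lborel A \<noteq> \<infinity>"
  shows "m * measure lborel A < measure \<nu> A" and "measure \<nu> A < M * measure lborel A"
proof -
  have int: "integrable lborel p"
    using prob p0 unfolding \<nu>_def by (intro integrable_density_of_prob) auto
  then have intA: "integrable lborel (\<lambda>x. p x * indicator A x)"
    by (rule integrable_real_mult_indicator[rotated]) simp
  have intc: "integrable lborel (\<lambda>x. c * indicator A x)" for c :: real
    using A by (simp add: less_top)
  have eq: "measure \<nu> A = (\<integral>x. p x * indicator A x \<partial>lborel)"
  proof -
    have "emeasure \<nu> A = (\<integral>\<^sup>+x. ennreal (p x * indicator A x) \<partial>lborel)"
      unfolding \<nu>_def by (subst emeasure_density) (auto simp: p0 ennreal_mult ennreal_indicator)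
    then show ?thesis
      using p0 by (simp add: measure_def integral_eq_nn_integral)
  qed
  have eqc: "c * measure lborel A = (\<integral>x. c * indicator A x \<partial>lborel)" for c :: real
    by simp
  have strict: "integral\<^sup>L lborel f < integral\<^sup>L lborel g"
    if f: "integrable lborel f" and g: "integrable lborel g"
      and le: "\<And>x. f x \<le> g x" and less: "\<And>x. x \<in> A \<Longrightarrow> f x < g x" for f g :: "'a \<Rightarrow> real"
  proof -
    have "0 \<le> (\<integral>x. g x - f x \<partial>lborel)"
      using le by (intro integral_nonneg_AE) auto
    moreover have "(\<integral>x. g x - f x \<partial>lborel) \<noteq> 0"
    proof
      assume "(\<integral>x. g x - f x \<partial>lborel) = 0"
      then have "AE x in lborel. g x - f x = 0"
        using le f g by (subst (asm) integral_nonneg_eq_0_iff_AE) auto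
      then have "AE x in lborel. x \<notin> A"
        by eventually_elim (use less in force)
      then show False
        using A(1) by (subst (asm) AE_iff_measurable[of A]) auto
    qed
    ultimately show ?thesis
      using f g by simp
  qed
  show "m * measure lborel A < measure \<nu> A"
    unfolding eq eqc by (rule strict[OF intc intA]) (use between in \<open>auto simp: indicator_def less_imp_le\<close>)
  show "measure \<nu> A < M * measure lborel A"
    unfolding eq eqc by (rule strict[OF intA intc]) (use between in \<open>auto simp: indicator_def less_imp_le\<close>)
qed

section \<open>What an informative pair forces\<close>

lemma hoelder_smooth_imp_continuous:
  fixes \<eta> :: "real^('d::finite) \<Rightarrow> real"
  assumes "hoelder_smooth \<beta> C \<eta>" "0 < \<beta>" 
  shows "continuous_on UNIV \<eta>"
proof -
  have "(\<eta> \<longlongrightarrow> \<eta> x) (at x)" for x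
  proof (rule Lim_null_comparison[of "\<lambda>y. \<eta> y - \<eta> x", THEN LIM_zero_cancel])
    show "\<forall>\<^sub>F y in at x. norm (\<eta> y - \<eta> x) \<le> C * norm (y - x) powr \<beta>"
      using assms(1) by (auto simp: hoelder_smooth_def)
    have "((\<lambda>y. norm (y - x)) \<longlongrightarrow> 0) (at x)"
      by (intro tendsto_norm_zero LIM_zero tendsto_ident_at)
    then have "((\<lambda>y. C * norm (y - x) powr \<beta>) \<longlongrightarrow> C * 0 powr \<beta>) (at x)"
      using assms(2) by (intro tendsto_intros tendsto_powr') auto
    then show "((\<lambda>y. C * norm (y - x) powr \<beta>) \<longlongrightarrow> 0) (at x)"
      by simp
  qed
  then show ?thesis
    by (simp add: continuous_on_def)
qed

text \<open>
Translate \<open>G = {\<eta> \<noteq> 1/2}\<close> in steps of length \<open>s\<close> along a coordinate axis. After \<open>k = 2 / s\<close> steps backwards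
every point of \<open>G\<close> has left the cube, hence \<open>G\<close>, and at the last step inside \<open>G\<close> the value of \<open>\<eta>\<close> is
within \<open>C\<^sub>\<beta> * s powr \<beta>\<close> of \<open>1/2\<close>. So \<open>k\<close> translates of the set controlled by the margin condition, each
of volume \<open>O(s powr (\<alpha> * \<beta>))\<close>, cover \<open>G\<close>. If \<open>\<alpha> * \<beta> > 1\<close>, their total volume tends to 0 with \<open>s\<close>, although
\<open>G\<close> is open and nonempty.
\<close>

lemma margin_imp_alpha_beta_le_1:
  fixes \<eta> :: "real^('d::finite) \<Rightarrow> real"
  assumes \<eta>: "hoelder_smooth \<beta> C\<^sub>\<beta> \<eta>" and pos: "0 < \<beta>" "0 < C\<^sub>\<beta>" "0 < m" "0 \<le> \<alpha>"
    and cube: "\<And>x. \<eta> x \<noteq> 1/2 \<Longrightarrow> x \<in> cbox 0 1" and ne: "\<eta> x\<^sub>0 \<noteq> 1/2"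
    and margin: "\<And>t. 0 < t \<Longrightarrow> m * measure lborel {x. 0 < \<bar>\<eta> x - 1/2\<bar> \<and> \<bar>\<eta> x - 1/2\<bar> < t} < C\<^sub>\<alpha> * t powr \<alpha>"
  shows "\<alpha> * \<beta> \<le> 1"
proof (rule ccontr)
  assume "\<not> \<alpha> * \<beta> \<le> 1"
  then have gt: "1 < \<alpha> * \<beta>" by simp
  let ?A = "\<lambda>t. {x. 0 < \<bar>\<eta> x - 1/2\<bar> \<and> \<bar>\<eta> x - 1/2\<bar> < t}"
  define G where "G = {x. \<eta> x \<noteq> 1/2}"
  have cont: "continuous_on UNIV \<eta>"
    using \<eta> pos(1) by (rule hoelder_smooth_imp_continuous)
  have [measurable]: "\<eta> \<in> borel_measurable borel"
    using cont by (rule borel_measurable_continuous_onI)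
  have [measurable]: "?A t \<in> sets borel" for t
    by measurable
  have "open G"
    using open_Collect_neq[OF cont continuous_on_const, of "1/2"] by (simp only: G_def)
  then have G_borel: "G \<in> sets borel" by simp
  have A_fin: "emeasure lborel (?A t) < \<infinity>" for t
  proof -
    have "emeasure lborel (?A t) \<le> emeasure lborel (cbox 0 (1::real^'d))"
      using cube by (intro emeasure_mono) auto
    then show ?thesis
      using emeasure_bounded_finite[OF bounded_cbox] by (rule le_less_trans)
  qed
  have bound: "measure lborel G \<le> C\<^sub>\<alpha> / m * (C\<^sub>\<beta> powr \<alpha> * 4 powr (\<alpha> * \<beta>)) * real k powr (1 - \<alpha> * \<beta>)" if "0 < k" for k :: nat
  proof -
    define s where "s = 2 / real k"
    define t where "t = C\<^sub>\<beta> * (2 * s) powr \<beta>"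
    define e :: "real^'d" where "e = axis undefined 1"
    have "0 < s" using that by (simp add: s_def)
    then have "0 < t" using pos by (simp add: t_def)
    have sub: "G \<subseteq> (\<Union>j<k. (+) (- (real j * s) *\<^sub>R e) -` ?A t)"
    proof
      fix x assume x: "x \<in> G"
      let ?R = "\<lambda>j. x - (real j * s) *\<^sub>R e \<notin> G"
      have "?R k"
      proof
        assume "x - (real k * s) *\<^sub>R e \<in> G"
        then have "0 \<le> (x - (real k * s) *\<^sub>R e) $ undefined" "x $ undefined \<le> 1"
          using cube[of "x - (real k * s) *\<^sub>R e"] cube[of x] x by (auto simp only: G_def mem_box_cart zero_index one_index mem_Collect_eq)
        then show False
          using that by (simp add: s_def e_def)
      qed
      \<comment> \<open>The first step that leaves \<open>G\<close>.\<close>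
      define j where "j = (LEAST j. ?R j)"
      have j: "?R j" unfolding j_def by (rule LeastI[of ?R, OF \<open>?R k\<close>])
      have "j \<le> k" unfolding j_def by (rule Least_le[of ?R, OF \<open>?R k\<close>])
      have "j \<noteq> 0" using j x by (intro notI) simp
      then obtain i where i: "j = Suc i" by (cases j) auto
      have "\<not> ?R i"
        using not_less_Least[of i ?R] by (simp add: j_def[symmetric] i)
      let ?y = "x - (real i * s) *\<^sub>R e" and ?z = "x - (real j * s) *\<^sub>R e"
      have "norm (?y - ?z) = s"
        using \<open>0 < s\<close> by (simp add: i e_def algebra_simps norm_axis_1)
      then have "\<bar>\<eta> ?y - \<eta> ?z\<bar> \<le> C\<^sub>\<beta> * s powr \<beta>"
        using \<eta> unfolding hoelder_smooth_def by metis
      also have "\<dots> < t"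
        unfolding t_def using \<open>0 < s\<close> pos by (intro mult_strict_left_mono powr_less_mono2) auto
      finally have "?y \<in> ?A t"
        using j \<open>\<not> ?R i\<close> by (simp add: G_def)
      then show "x \<in> (\<Union>j<k. (+) (- (real j * s) *\<^sub>R e) -` ?A t)"
        using \<open>j \<le> k\<close> i by (auto intro!: bexI[of _ i])
    qed
    have shift: "emeasure lborel ((+) c -` ?A t) = emeasure lborel (?A t)" for c
      by (subst (2) lborel_distr_plus[of c, symmetric], subst emeasure_distr) (simp_all del: lborel_distr_plus)
    have "emeasure lborel G \<le> emeasure lborel (\<Union>j<k. (+) (- (real j * s) *\<^sub>R e) -` ?A t)"
      using sub by (rule emeasure_mono) (auto intro!: sets.finite_UN measurable_sets_borel[where f = "(+) _"])
    also have "\<dots> \<le> (\<Sum>j<k. emeasure lborel ((+) (- (real j * s) *\<^sub>R e) -` ?A t))"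
      by (rule emeasure_subadditive_finite) (auto intro!: measurable_sets_borel[where f = "(+) _"])
    also have "\<dots> = of_nat k * emeasure lborel (?A t)"
      by (simp only: shift) simp
    also have "\<dots> = ennreal (real k * measure lborel (?A t))"
      using A_fin[of t] by (simp add: emeasure_eq_ennreal_measure less_top ennreal_mult ennreal_of_nat_eq_real_of_nat)
    finally have "measure lborel G \<le> real k * measure lborel (?A t)"
      by (simp add: measure_def enn2real_leI)
    also have "measure lborel (?A t) \<le> C\<^sub>\<alpha> / m * t powr \<alpha>"
      using margin[OF \<open>0 < t\<close>] pos by (simp add: field_simps)
    also have "t powr \<alpha> = C\<^sub>\<beta> powr \<alpha> * 4 powr (\<alpha> * \<beta>) * real k powr (- (\<alpha> * \<beta>))"
      using that pos by (simp add: t_def s_def powr_mult powr_powr powr_divide powr_minus field_simps)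
    also have "real k * (C\<^sub>\<alpha> / m * (C\<^sub>\<beta> powr \<alpha> * 4 powr (\<alpha> * \<beta>) * real k powr (- (\<alpha> * \<beta>)))) =
        C\<^sub>\<alpha> / m * (C\<^sub>\<beta> powr \<alpha> * 4 powr (\<alpha> * \<beta>)) * real k powr (1 - \<alpha> * \<beta>)"
      using that by (simp add: powr_diff powr_minus field_simps)
    finally show ?thesis
      by (simp add: mult_left_mono)
  qed
  have "(\<lambda>k. real k powr (1 - \<alpha> * \<beta>)) \<longlonglongrightarrow> 0"
    using gt by (intro tendsto_neg_powr filterlim_real_sequentially) simp
  then have "(\<lambda>k. C\<^sub>\<alpha> / m * (C\<^sub>\<beta> powr \<alpha> * 4 powr (\<alpha> * \<beta>)) * real k powr (1 - \<alpha> * \<beta>)) \<longlonglongrightarrow> 0"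
    by (rule tendsto_mult_right_zero)
  then have "measure lborel G \<le> 0"
    using bound by (intro LIMSEQ_le_const) (auto intro!: exI[of _ 1])
  moreover have "measure lborel G > 0"
  proof -
    obtain r where "0 < r" "ball x\<^sub>0 r \<subseteq> G"
      using \<open>open G\<close> ne by (auto simp: open_contains_ball G_def)
    moreover have "emeasure lborel G < \<infinity>"
    proof -
      have "emeasure lborel G \<le> emeasure lborel (cbox 0 (1::real^'d))"
        using cube by (intro emeasure_mono) (auto simp: G_def)
      then show ?thesis
        using emeasure_bounded_finite[OF bounded_cbox] by (rule le_less_trans)
    qed
    ultimately have "measure lborel (ball x\<^sub>0 r) \<le> measure lborel G"
      using G_borel by (intro measure_mono_fmeasurable fmeasurableI) auto
    moreover have "0 < measure lborel (ball x\<^sub>0 r)"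
      using \<open>0 < r\<close> by simp
    ultimately show ?thesis by linarith
  qed
  ultimately show False by simp
qed

text \<open>
On the line, a component of \<open>{\<eta> \<noteq> 1/2}\<close> is an interval whose end points have value \<open>1/2\<close>. If its length is \<open>2 * s\<close>,
every point other than the midpoint is closer than \<open>s\<close> to an end point, so the whole interval up to
its midpoint is subject to the margin condition at level \<open>C\<^sub>\<beta> * s powr \<beta>\<close>. As \<open>\<alpha> * \<beta> = 1\<close>, both sides of
that condition are linear in \<open>s\<close>, and dividing by \<open>s\<close> compares the constants.
\<close>

lemma margin_dimension_one:
  fixes \<eta> :: "real^('d::finite) \<Rightarrow> real"
  assumes d: "CARD('d) = 1"
    and \<eta>: "hoelder_smooth \<beta> C\<^sub>\<beta> \<eta>" and pos: "0 < \<beta>" "0 < C\<^sub>\<beta>" "0 < m"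
    and cube: "\<And>x. \<eta> x \<noteq> 1/2 \<Longrightarrow> x \<in> cbox 0 1" and ne: "\<eta> x\<^sub>0 \<noteq> 1/2"
    and margin: "\<And>t. 0 < t \<Longrightarrow> m * measure lborel {x. 0 < \<bar>\<eta> x - 1/2\<bar> \<and> \<bar>\<eta> x - 1/2\<bar> < t} < C\<^sub>\<alpha> * t powr \<alpha>"
    and ab: "\<alpha> * \<beta> = 1"
  shows "m * unit_ball_vol 1 < C\<^sub>\<alpha> * C\<^sub>\<beta> powr \<alpha>"
proof -
  let ?A = "\<lambda>t. {x. 0 < \<bar>\<eta> x - 1/2\<bar> \<and> \<bar>\<eta> x - 1/2\<bar> < t}"
  obtain i :: 'd where i: "UNIV = {i}"
    using d card_1_singletonE by blast
  define e :: "real^'d" where "e = axis i 1"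
  have coord: "y = (y $ i) *\<^sub>R e" for y
    unfolding e_def vec_eq_iff using i by (auto simp: axis_def)
  have norm_e: "norm (u *\<^sub>R e - v *\<^sub>R e) = \<bar>u - v\<bar>" for u v
    by (simp add: scaleR_diff_left[symmetric] e_def norm_axis_1)
  have cont: "continuous_on UNIV \<eta>"
    using \<eta> pos(1) by (rule hoelder_smooth_imp_continuous)
  have [measurable]: "\<eta> \<in> borel_measurable borel"
    using cont by (rule borel_measurable_continuous_onI)
  define T where "T = {u. \<eta> (u *\<^sub>R e) = 1/2}"
  have "closed T"
    unfolding T_def by (intro closed_Collect_eq continuous_on_const continuous_on_compose2[OF cont] continuous_intros) auto
  define t0 where "t0 = x\<^sub>0 $ i"
  have t0: "t0 \<notin> T"
    using ne coord[of x\<^sub>0] by (simp add: T_def t0_def)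
  have unit: "0 \<le> u \<and> u \<le> 1" if "u \<notin> T" for u
    using cube[of "u *\<^sub>R e"] that by (auto simp: T_def mem_box_cart e_def axis_def dest!: spec[of _ i])
  define a where "a = Sup (T \<inter> {..t0})"
  define b where "b = Inf (T \<inter> {t0..})"
  have "- 1 \<in> T" "2 \<in> T"
    using unit[of "-1"] unit[of 2] by auto
  then have ne1: "T \<inter> {..t0} \<noteq> {}" and ne2: "T \<inter> {t0..} \<noteq> {}"
    using unit[OF t0] by auto
  have "a \<in> T \<inter> {..t0}"
    unfolding a_def using \<open>closed T\<close> ne1 by (intro closed_contains_Sup) auto
  then have a: "a \<in> T" "a < t0"
    using t0 by (auto simp: less_le)
  have "b \<in> T \<inter> {t0..}"
    unfolding b_def using \<open>closed T\<close> ne2 by (intro closed_contains_Inf) auto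
  then have b: "b \<in> T" "t0 < b"
    using t0 by (auto simp: less_le)
  have between: "u \<notin> T" if "a < u" "u < b" for u
  proof
    assume "u \<in> T"
    show False
    proof (cases "u \<le> t0")
      case True
      then have "u \<le> a"
        unfolding a_def using \<open>u \<in> T\<close> by (intro cSup_upper) auto
      then show False using that by simp
    next
      case False
      then have "b \<le> u"
        unfolding b_def using \<open>u \<in> T\<close> by (intro cInf_lower) auto
      then show False using that by simp
    qed
  qed
  \<comment> \<open>In dimension one the interval between the end points is the ball around its midpoint \<open>z\<close>.\<close>
  define s where "s = (b - a) / 2"
  define z where "z = ((a + b) / 2) *\<^sub>R e"
  have "0 < s" using a b by (simp add: s_def)
  have sub: "ball z s - {z} \<subseteq> ?A (C\<^sub>\<beta> * s powr \<beta>)"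
  proof
    fix y assume y: "y \<in> ball z s - {z}"
    define u where "u = y $ i"
    have yu: "y = u *\<^sub>R e" using coord[of y] by (simp add: u_def)
    have u: "\<bar>(a + b) / 2 - u\<bar> < s" "u \<noteq> (a + b) / 2"
      using y norm_e[of "(a + b) / 2" u] by (auto simp: yu z_def dist_norm)
    have u_lt: "a < u" "u < b"
      using u(1) by (auto simp: s_def abs_less_iff field_simps)
    obtain w where w: "w \<in> T" "\<bar>u - w\<bar> < s"
    proof (cases "u < (a + b) / 2")
      case True
      have "\<bar>u - a\<bar> < s"
        using True a b u_lt by (simp add: s_def abs_less_iff field_simps)
      then show ?thesis using that a by blast
    next
      case False
      have "\<bar>u - b\<bar> < s"
        using u(2) False a b u_lt by (simp add: s_def abs_less_iff field_simps)
      then show ?thesis using that b by blast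
    qed
    have "\<bar>\<eta> (u *\<^sub>R e) - \<eta> (w *\<^sub>R e)\<bar> \<le> C\<^sub>\<beta> * \<bar>u - w\<bar> powr \<beta>"
      using \<eta> norm_e[of u w] unfolding hoelder_smooth_def by metis
    also have "\<dots> < C\<^sub>\<beta> * s powr \<beta>"
      using w pos by (intro mult_strict_left_mono powr_less_mono2) auto
    finally have "\<bar>\<eta> y - 1/2\<bar> < C\<^sub>\<beta> * s powr \<beta>"
      using w by (simp add: yu T_def)
    moreover have "u \<notin> T"
      using u_lt by (rule between)
    ultimately show "y \<in> ?A (C\<^sub>\<beta> * s powr \<beta>)"
      by (simp add: yu T_def)
  qed
  have "emeasure lborel (?A (C\<^sub>\<beta> * s powr \<beta>)) \<le> emeasure lborel (cbox 0 (1::real^'d))"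
    using cube by (intro emeasure_mono) auto
  also have "\<dots> < \<infinity>"
    by (rule emeasure_bounded_finite[OF bounded_cbox])
  finally have fin: "emeasure lborel (?A (C\<^sub>\<beta> * s powr \<beta>)) < \<infinity>" .
  have "unit_ball_vol 1 * s = measure lborel (ball z s)"
    using d \<open>0 < s\<close> by (simp add: content_ball)
  also have "\<dots> = measure lborel (ball z s - {z})"
    by (rule measure_Diff_null_set[symmetric]) (auto intro: finite_imp_null_set_lborel)
  also have "\<dots> \<le> measure lborel (?A (C\<^sub>\<beta> * s powr \<beta>))"
    using fin sub by (intro measure_mono_fmeasurable fmeasurableI) auto
  finally have "m * (unit_ball_vol 1 * s) \<le> m * measure lborel (?A (C\<^sub>\<beta> * s powr \<beta>))"
    using pos by (intro mult_left_mono) auto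
  also have "\<dots> < C\<^sub>\<alpha> * (C\<^sub>\<beta> * s powr \<beta>) powr \<alpha>"
    using \<open>0 < s\<close> pos by (intro margin) auto
  also have "(C\<^sub>\<beta> * s powr \<beta>) powr \<alpha> = C\<^sub>\<beta> powr \<alpha> * s"
    using \<open>0 < s\<close> pos ab by (simp add: powr_mult powr_powr mult.commute)
  finally show ?thesis
    using \<open>0 < s\<close> by (simp add: mult.assoc[symmetric])
qed

text \<open>
Everything that the lower bound takes from the informative pair. Uniqueness of the regression function
makes the open set \<open>{\<eta> \<noteq> 1/2}\<close> nonempty for the Hoelder version \<open>\<eta>\<close>, and since \<open>\<eta> = 1/2\<close> off the support,
that set lies in \<open>\<Omega>\<close>.
\<close>

lemma informative_class_geometry:
  fixes P\<^sub>0 Q\<^sub>0 :: "('d::finite) law"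
  defines "\<Omega> \<equiv> measure_support (marginal Q\<^sub>0)"
  assumes pos: "0 < \<beta>" "0 < C\<^sub>\<beta>" "0 < \<mu>\<^sub>m" "0 \<le> \<alpha>" "0 < C\<^sub>\<alpha>"
    and PQ: "(P\<^sub>0, Q\<^sub>0) \<in> transfer_class \<alpha> C\<^sub>\<alpha> \<beta> C\<^sub>\<beta> \<gamma> C\<^sub>\<gamma> \<mu>\<^sub>m \<mu>\<^sub>M c\<^sub>\<mu> r\<^sub>\<mu>"
    and inf: "measure (marginal Q\<^sub>0) {x. regression_fun Q\<^sub>0 x \<noteq> 1/2} > 0"
  shows "\<Omega> \<subseteq> cbox 0 1" and "\<mu>\<^sub>m * measure lborel \<Omega> < 1" and "1 < \<mu>\<^sub>M * measure lborel \<Omega>"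
    and "regular_set c\<^sub>\<mu> r\<^sub>\<mu> \<Omega>" and "\<exists>x \<rho>. 0 < \<rho> \<and> ball x \<rho> \<subseteq> \<Omega>"
    and "\<alpha> * \<beta> \<le> 1"
    and "CARD('d) = 1 \<Longrightarrow> \<alpha> * \<beta> = 1 \<Longrightarrow> \<mu>\<^sub>m * unit_ball_vol 1 < C\<^sub>\<alpha> * C\<^sub>\<beta> powr \<alpha>"
proof -
  let ?\<nu> = "marginal Q\<^sub>0"
  obtain \<eta> p where Q: "law_on_cube Q\<^sub>0" and reg: "is_regression_fun Q\<^sub>0 \<eta>" and margin: "margin \<alpha> C\<^sub>\<alpha> ?\<nu> \<eta>"
    and hoelder: "hoelder_smooth \<beta> C\<^sub>\<beta> \<eta>" and regular: "regular_set c\<^sub>\<mu> r\<^sub>\<mu> \<Omega>"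
    and p_meas [measurable]: "p \<in> borel_measurable borel" and p0: "\<And>x. 0 \<le> p x"
    and dens: "?\<nu> = density lborel (\<lambda>x. ennreal (p x))" and between: "\<And>x. x \<in> \<Omega> \<Longrightarrow> \<mu>\<^sub>m < p x \<and> p x < \<mu>\<^sub>M"
    using PQ unfolding transfer_class_def density_between_def \<Omega>_def by blast
  show "regular_set c\<^sub>\<mu> r\<^sub>\<mu> \<Omega>" by (rule regular)
  interpret Q: prob_space Q\<^sub>0
    using Q by (simp add: law_on_cube_def)
  have sets_Q [measurable_cong]: "sets Q\<^sub>0 = sets obs_space"
    using Q by (simp add: law_on_cube_def)
  interpret \<nu>: prob_space ?\<nu>
    unfolding marginal_def by (rule Q.prob_space_distr) measurable
  have sets_\<nu>: "sets ?\<nu> = sets borel"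
    by (simp add: marginal_def)
  have "AE x in ?\<nu>. \<forall>i. 0 \<le> x $ i \<and> x $ i \<le> 1"
    using Q unfolding marginal_def law_on_cube_def by (subst AE_distr_iff) auto
  then have "AE x in ?\<nu>. x \<in> cbox 0 1"
    by (simp add: mem_box_cart)
  then show \<Omega>_cube: "\<Omega> \<subseteq> cbox 0 1"
    unfolding \<Omega>_def by (intro measure_support_subset_closed[OF closed_cbox sets_\<nu>])
  have [measurable]: "\<Omega> \<in> sets borel"
    unfolding \<Omega>_def by (rule borel_closed) (rule closed_measure_support)
  have \<Omega>_fin: "emeasure lborel A \<noteq> \<infinity>" if "A \<subseteq> \<Omega>" for A
  proof -
    have "emeasure lborel A \<le> emeasure lborel (cbox 0 (1::real^'d))"
      using that \<Omega>_cube by (intro emeasure_mono) auto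
    also have "\<dots> < \<infinity>"
      by (rule emeasure_bounded_finite[OF bounded_cbox])
    finally show ?thesis by simp
  qed
  have "emeasure ?\<nu> (- \<Omega>) = 0"
    unfolding \<Omega>_def by (rule emeasure_outside_measure_support) (rule sets_\<nu>)
  then have \<Omega>1: "measure ?\<nu> \<Omega> = 1"
    using \<nu>.prob_compl[of \<Omega>] sets_eq_imp_space_eq[OF sets_\<nu>]
    by (simp add: sets_\<nu> measure_def Compl_eq_Diff_UNIV)
  have cont: "continuous_on UNIV \<eta>"
    using hoelder pos(1) by (rule hoelder_smooth_imp_continuous)
  have [measurable]: "\<eta> \<in> borel_measurable borel"
    using cont by (rule borel_measurable_continuous_onI)
  have off: "\<eta> x = 1/2" if "x \<notin> \<Omega>" for x
    using reg that by (simp add: is_regression_fun_def \<Omega>_def)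
  obtain x\<^sub>0 where x0: "\<eta> x\<^sub>0 \<noteq> 1/2"
  proof (rule ccontr)
    assume "\<not> thesis"
    then have half: "\<eta> x = 1/2" for x
      using that by blast
    have reg': "is_regression_fun Q\<^sub>0 (regression_fun Q\<^sub>0)"
      using reg by (rule is_regression_fun_regression_fun)
    then have [measurable]: "regression_fun Q\<^sub>0 \<in> borel_measurable borel"
      by (simp add: is_regression_fun_def)
    have "AE x in ?\<nu>. regression_fun Q\<^sub>0 x = 1/2"
      using regression_fun_unique_AE[OF Q reg' reg] by (simp add: half)
    moreover have "{x. regression_fun Q\<^sub>0 x \<noteq> 1/2} \<in> sets ?\<nu>"
      unfolding sets_\<nu> by measurable
    ultimately have "emeasure ?\<nu> {x. regression_fun Q\<^sub>0 x \<noteq> 1/2} = 0"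
      using sets_eq_imp_space_eq[OF sets_\<nu>] by (subst (asm) AE_iff_measurable) auto
    then show False
      using inf by (simp add: measure_def)
  qed
  have "open {x. \<eta> x \<noteq> 1/2}"
    using cont by (intro open_Collect_neq continuous_on_const)
  then obtain \<rho> where \<rho>: "0 < \<rho>" "ball x\<^sub>0 \<rho> \<subseteq> {x. \<eta> x \<noteq> 1/2}"
    using x0 by (auto simp: open_contains_ball)
  then have "ball x\<^sub>0 \<rho> \<subseteq> \<Omega>"
    using off by blast
  then show "\<exists>x \<rho>. 0 < \<rho> \<and> ball x \<rho> \<subseteq> \<Omega>"
    using \<rho>(1) by blast
  note bounds = measure_density_bounds_strict[OF \<nu>.prob_space_axioms[unfolded dens] p_meas p0, folded dens]
  have "emeasure lborel \<Omega> \<noteq> 0"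
  proof
    assume "emeasure lborel \<Omega> = 0"
    then have "emeasure lborel (ball x\<^sub>0 \<rho>) = 0"
      using emeasure_mono[OF \<open>ball x\<^sub>0 \<rho> \<subseteq> \<Omega>\<close>, of lborel] by simp
    then have "measure lborel (ball x\<^sub>0 \<rho>) = 0"
      by (simp add: measure_def)
    then show False
      using \<rho>(1) by simp
  qed
  then show "\<mu>\<^sub>m * measure lborel \<Omega> < 1" and "1 < \<mu>\<^sub>M * measure lborel \<Omega>"
    using bounds[of \<Omega> \<mu>\<^sub>m \<mu>\<^sub>M] between \<Omega>_fin[of \<Omega>] \<Omega>1 by auto
  have mg: "\<mu>\<^sub>m * measure lborel {x. 0 < \<bar>\<eta> x - 1/2\<bar> \<and> \<bar>\<eta> x - 1/2\<bar> < t} < C\<^sub>\<alpha> * t powr \<alpha>" (is "_ * measure _ ?A < _")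
    if "0 < t" for t
  proof (cases "emeasure lborel ?A = 0")
    case True
    then show ?thesis
      using pos that by (simp add: measure_def)
  next
    case False
    have "?A \<subseteq> \<Omega>" using off by force
    then have "\<mu>\<^sub>m * measure lborel ?A < measure ?\<nu> ?A"
      using between False \<Omega>_fin by (intro bounds(1)) auto
    also have "\<dots> \<le> C\<^sub>\<alpha> * t powr \<alpha>"
      using margin that by (simp add: margin_def)
    finally show ?thesis .
  qed
  have cube: "x \<in> cbox 0 1" if "\<eta> x \<noteq> 1/2" for x
    using off that \<Omega>_cube by blast
  show "\<alpha> * \<beta> \<le> 1"
    by (rule margin_imp_alpha_beta_le_1[OF hoelder pos(1-4) cube x0 mg])
  show "\<mu>\<^sub>m * unit_ball_vol 1 < C\<^sub>\<alpha> * C\<^sub>\<beta> powr \<alpha>" if "CARD('d) = 1" "\<alpha> * \<beta> = 1"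
    by (rule margin_dimension_one[OF that(1) hoelder pos(1-3) cube x0 mg that(2)])
qed

section \<open>Marginals and packings\<close>

text \<open>
A density with two values: \<open>a\<close> on a small ball and \<open>b\<close> on the rest of \<open>\<Omega>\<close>. Total mass 1 determines \<open>b\<close>,
which tends to \<open>1 / measure lborel \<Omega>\<close> as the ball shrinks, and this limit lies strictly between \<open>m\<close> and
\<open>M\<close>. Hence \<open>a\<close> may be any number above \<open>m\<close> and up to that limit, in particular one below \<open>A\<close>. Regularity of
\<open>\<Omega>\<close> shows that each of its points lies in the support.
\<close>

lemma exists_marginal_with_flat_patch:
  fixes \<Omega> :: "(real^'d::finite) set"
  assumes \<Omega>: "closed \<Omega>" "\<Omega> \<subseteq> cbox 0 1" and reg: "0 < c" "0 < r\<^sub>0" "regular_set c r\<^sub>0 \<Omega>"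
    and patch: "0 < \<rho>" "ball x\<^sub>0 \<rho> \<subseteq> \<Omega>"
    and m: "0 < m" "m * measure lborel \<Omega> < 1" and M: "1 < M * measure lborel \<Omega>" and A: "m < A"
  obtains a \<rho>' \<nu> where "m < a" "a < M" "a \<le> A" "0 < \<rho>'" "\<rho>' \<le> \<rho>"
    "prob_space \<nu>" "sets \<nu> = sets borel" "measure_support \<nu> = \<Omega>" "density_between m M \<Omega> \<nu>"
    "\<forall>E\<in>sets borel. E \<subseteq> ball x\<^sub>0 \<rho>' \<longrightarrow> measure \<nu> E = a * measure lborel E"
proof -
  define \<omega> where "\<omega> = measure lborel \<Omega>"
  define v where "v = unit_ball_vol (real CARD('d))"
  have [measurable]: "\<Omega> \<in> sets borel" using \<Omega>(1) by (rule borel_closed)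
  have "0 < \<omega>"
    using M measure_nonneg[of lborel \<Omega>] by (auto simp: \<omega>_def less_le)
  have \<Omega>_fin: "emeasure lborel \<Omega> < \<infinity>"
    using \<Omega>(2) by (intro emeasure_bounded_finite bounded_subset[OF bounded_cbox])
  then have e\<omega>: "emeasure lborel \<Omega> = ennreal \<omega>"
    by (simp add: \<omega>_def emeasure_eq_ennreal_measure less_top)
  have v: "0 < v" by (simp add: v_def)
  define a where "a = min A (1 / \<omega>)"
  have b0: "m < 1 / \<omega>" "1 / \<omega> < M"
    using m M \<open>0 < \<omega>\<close> by (auto simp: field_simps \<omega>_def)
  have a: "m < a" "a \<le> 1 / \<omega>" "a \<le> A" "a < M"
    using A b0 by (auto simp: a_def)
  \<comment> \<open>A patch of volume below \<open>\<epsilon>\<close> keeps the value \<open>b\<close> on the rest of \<open>\<Omega>\<close> below \<open>M\<close>.\<close>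
  define \<epsilon> where "\<epsilon> = (M - 1 / \<omega>) * \<omega> / (M - a)"
  have "0 < \<epsilon>" "\<epsilon> \<le> \<omega>"
    using a b0 \<open>0 < \<omega>\<close> by (auto simp: \<epsilon>_def field_simps)
  define \<rho>' where "\<rho>' = min \<rho> (min 1 (\<epsilon> / (2 * v)))"
  have \<rho>': "0 < \<rho>'" "\<rho>' \<le> \<rho>" "\<rho>' \<le> 1" "\<rho>' \<le> \<epsilon> / (2 * v)"
    using patch \<open>0 < \<epsilon>\<close> v by (auto simp: \<rho>'_def)
  have [measurable]: "ball x\<^sub>0 \<rho>' \<in> sets borel" by simp
  define V where "V = measure lborel (ball x\<^sub>0 \<rho>')"
  have "V = v * \<rho>' ^ CARD('d)"
    using \<rho>' by (simp add: V_def content_ball v_def)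
  also have "\<dots> \<le> v * \<rho>' ^ 1"
    using \<rho>' v by (intro mult_left_mono power_decreasing) (auto simp: Suc_le_eq)
  also have "\<dots> < \<epsilon>"
    using \<rho>'(4) v \<open>0 < \<epsilon>\<close> by (simp add: field_simps)
  finally have V: "V < \<epsilon>" .
  have V0: "0 \<le> V" by (simp add: V_def)
  have eV: "emeasure lborel (ball x\<^sub>0 \<rho>') = ennreal V"
    using emeasure_bounded_finite[OF bounded_ball, of x\<^sub>0 \<rho>'] by (simp add: V_def emeasure_eq_ennreal_measure less_top)
  define b where "b = (1 - a * V) / (\<omega> - V)"
  have pos: "0 < \<omega> - V" using V \<open>\<epsilon> \<le> \<omega>\<close> by simp
  have "1 / \<omega> \<le> b"
  proof -
    have "a * V \<le> V / \<omega>"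
      using a(2) V0 mult_right_mono[of a "1 / \<omega>" V] by simp
    then show ?thesis
      using pos \<open>0 < \<omega>\<close> by (simp add: b_def field_simps)
  qed
  moreover have "b < M"
  proof -
    have "V * (M - a) < (M - 1 / \<omega>) * \<omega>"
      using V a by (simp add: \<epsilon>_def field_simps)
    then have "1 - a * V < M * (\<omega> - V)"
      using \<open>0 < \<omega>\<close> by (simp add: algebra_simps)
    then show ?thesis
      using pos by (simp add: b_def divide_less_eq)
  qed
  ultimately have b: "m < b" "b < M" using b0 by auto
  define p where "p x = (if x \<in> ball x\<^sub>0 \<rho>' then a else if x \<in> \<Omega> then b else 0)" for x
  have sub: "ball x\<^sub>0 \<rho>' \<subseteq> \<Omega>"
    using \<rho>'(2) patch(2) by (meson subset_ball order_trans)
  have p0: "0 \<le> p x" for x using a b m by (simp add: p_def)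
  have p_between: "m < p x \<and> p x < M" if "x \<in> \<Omega>" for x using that a b by (simp add: p_def)
  have [measurable]: "p \<in> borel_measurable borel"
    unfolding p_def[abs_def] by (intro measurable_If_set measurable_const) auto
  define \<nu> where "\<nu> = density lborel (\<lambda>x. ennreal (p x))"
  have e\<nu>: "emeasure \<nu> E = (\<integral>\<^sup>+x. ennreal (p x) * indicator E x \<partial>lborel)" if "E \<in> sets borel" for E
    unfolding \<nu>_def using that by (subst emeasure_density) auto
  have sets_\<nu>: "sets \<nu> = sets borel" by (simp add: \<nu>_def)
  have patch_meas: "emeasure \<nu> E = ennreal a * emeasure lborel E" if [measurable]: "E \<in> sets borel" and "E \<subseteq> ball x\<^sub>0 \<rho>'" for E
  proof -
    have "emeasure \<nu> E = (\<integral>\<^sup>+x. ennreal a * indicator E x \<partial>lborel)"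
      unfolding e\<nu>[OF that(1)] using that(2) by (intro nn_integral_cong) (auto simp: p_def indicator_def)
    then show ?thesis by (simp add: nn_integral_cmult)
  qed
  have "emeasure \<nu> UNIV = 1"
  proof -
    have "emeasure \<nu> UNIV = (\<integral>\<^sup>+x. ennreal a * indicator (ball x\<^sub>0 \<rho>') x + ennreal b * indicator (\<Omega> - ball x\<^sub>0 \<rho>') x \<partial>lborel)"
      using sub by (subst e\<nu>) (auto intro!: nn_integral_cong simp: p_def indicator_def)
    also have "\<dots> = ennreal a * ennreal V + ennreal b * emeasure lborel (\<Omega> - ball x\<^sub>0 \<rho>')"
      by (subst nn_integral_add, measurable, subst (1 2) nn_integral_cmult, measurable, simp add: eV)
    also have "emeasure lborel (\<Omega> - ball x\<^sub>0 \<rho>') = ennreal (\<omega> - V)"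
      using sub V0 by (subst emeasure_Diff) (auto simp: eV e\<omega> ennreal_minus)
    also have "ennreal a * ennreal V + ennreal b * ennreal (\<omega> - V) = ennreal (a * V + b * (\<omega> - V))"
      using a b m V0 pos by (simp add: ennreal_mult ennreal_plus)
    also have "a * V + b * (\<omega> - V) = 1"
      using pos by (simp add: b_def)
    finally show ?thesis by simp
  qed
  then have prob: "prob_space \<nu>"
    by (intro prob_spaceI) (simp add: \<nu>_def)
  have supp: "measure_support \<nu> = \<Omega>"
  proof (intro set_eqI iffI)
    fix x assume x: "x \<in> measure_support \<nu>"
    have "emeasure \<nu> (- \<Omega>) = (\<integral>\<^sup>+x. 0 \<partial>(lborel :: (real^'d) measure))"
      by (subst e\<nu>, simp, rule nn_integral_cong) (use sub in \<open>auto simp: p_def indicator_def\<close>)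
    then show "x \<in> \<Omega>"
      using x \<Omega>(1) by (auto simp: measure_support_def open_Compl dest!: spec[of _ "- \<Omega>"])
  next
    fix x assume x: "x \<in> \<Omega>"
    show "x \<in> measure_support \<nu>"
      unfolding measure_support_def
    proof safe
      fix U assume U: "open U" "x \<in> U"
      then obtain e where e: "0 < e" "ball x e \<subseteq> U" by (auto simp: open_contains_ball)
      define r where "r = min e r\<^sub>0"
      have r: "0 < r" "r \<le> r\<^sub>0" "ball x r \<subseteq> U"
        using e reg(2) subset_ball[of r e x] by (auto simp: r_def)
      let ?E = "\<Omega> \<inter> ball x r"
      have "0 < c * measure lborel (ball x r)"
        using reg(1) r by simp
      also have "\<dots> \<le> measure lborel ?E"
        using reg(3) x r by (simp add: regular_set_def)
      finally have "emeasure lborel ?E \<noteq> 0"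
        by (auto simp: measure_def)
      then have "0 < ennreal m * emeasure lborel ?E"
        using m(1) by (simp add: ennreal_zero_less_mult_iff zero_less_iff_neq_zero)
      also have "\<dots> = (\<integral>\<^sup>+x. ennreal m * indicator ?E x \<partial>lborel)"
        by (rule nn_integral_cmult_indicator[symmetric]) simp
      also have "\<dots> \<le> (\<integral>\<^sup>+x. ennreal (p x) * indicator U x \<partial>lborel)"
        using r(3) p_between by (intro nn_integral_mono) (auto simp: indicator_def less_imp_le intro!: ennreal_leI)
      also have "\<dots> = emeasure \<nu> U"
        using U(1) by (simp add: e\<nu>)
      finally show "0 < emeasure \<nu> U" .
    qed
  qed
  have dens: "density_between m M \<Omega> \<nu>"
    unfolding density_between_def \<nu>_def using p0 p_between by (intro exI[of _ p]) auto
  have flat: "\<forall>E\<in>sets borel. E \<subseteq> ball x\<^sub>0 \<rho>' \<longrightarrow> measure \<nu> E = a * measure lborel E"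
    using patch_meas a m by (simp add: measure_def enn2real_mult)
  show thesis
    by (rule that[OF a(1,4,3) \<rho>'(1,2) prob sets_\<nu> supp dens flat])
qed

text \<open>
Take a cubic grid of mesh \<open>L * r\<close> with \<open>N\<close> points along each axis; distinct grid points differ by at least
one mesh width in some coordinate.
\<close>

lemma exists_packing_in_ball:
  fixes x\<^sub>0 :: "real^'d::finite"
  assumes r: "0 < r" and L: "1 \<le> L" and fits: "real CARD('d) * L * r * real N \<le> \<rho>" and M: "M \<le> N ^ CARD('d)"
  obtains S where "finite S" "card S = M" "pairwise (\<lambda>c c'. L * r \<le> dist c c') S"
    "\<forall>c\<in>S. ball c r \<subseteq> ball x\<^sub>0 \<rho>"
proof -
  define K :: "('d \<Rightarrow> nat) set" where "K = (UNIV \<rightarrow>\<^sub>E {..<N})"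
  define f :: "('d \<Rightarrow> nat) \<Rightarrow> real^'d" where "f k = x\<^sub>0 + (\<chi> i. L * r * real (k i))" for k
  have "finite K" "card K = N ^ CARD('d)"
    by (auto simp: K_def card_PiE finite_PiE)
  have Lr: "0 < L * r" using r L by simp
  have sep: "L * r \<le> dist (f k) (f l)" if "k \<noteq> l" for k l
  proof -
    obtain i where i: "k i \<noteq> l i" using \<open>k \<noteq> l\<close> by auto
    have "L * r * 1 \<le> L * r * \<bar>real (k i) - real (l i)\<bar>"
      using i Lr by (intro mult_left_mono) linarith+
    also have "\<dots> = \<bar>(f k - f l) $ i\<bar>"
      using r L by (simp add: f_def abs_mult right_diff_distrib[symmetric])
    also have "\<dots> \<le> dist (f k) (f l)"
      unfolding dist_norm by (rule component_le_norm_cart)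
    finally show ?thesis by simp
  qed
  have inj: "inj_on f K"
    using sep Lr by (intro inj_onI) (metis dist_self not_less)
  obtain T where T: "T \<subseteq> f ` K" "card T = M" "finite T"
    using obtain_subset_with_card_n[of M "f ` K"] M \<open>card K = _\<close> card_image[OF inj] by metis
  have inside: "ball (f k) r \<subseteq> ball x\<^sub>0 \<rho>" if "k \<in> K" for k
  proof
    fix y assume y: "y \<in> ball (f k) r"
    have k: "real (k i) \<le> real N - 1" for i
    proof -
      have "k i < N" using that by (auto simp: K_def PiE_iff)
      then show ?thesis by linarith
    qed
    have "dist x\<^sub>0 (f k) = norm (\<chi> i. L * r * real (k i))"
      by (simp add: f_def dist_norm)
    also have "\<dots> \<le> (\<Sum>i\<in>UNIV. \<bar>L * r * real (k i)\<bar>)"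
      using norm_le_l1_cart[of "\<chi> i. L * r * real (k i)"] by simp
    also have "\<dots> \<le> (\<Sum>i\<in>(UNIV::'d set). L * r * (real N - 1))"
      using r L k by (intro sum_mono) (simp add: abs_mult)
    also have "\<dots> = real CARD('d) * L * r * real N - real CARD('d) * (L * r)"
      by (simp add: algebra_simps)
    also have "\<dots> \<le> \<rho> - r"
    proof -
      have "1 * (1 * r) \<le> real CARD('d) * (L * r)"
        using r L by (intro mult_mono) (auto simp: Suc_le_eq)
      then show ?thesis using fits by simp
    qed
    finally have "dist x\<^sub>0 (f k) \<le> \<rho> - r" .
    then show "y \<in> ball x\<^sub>0 \<rho>"
      using y dist_triangle[of x\<^sub>0 y "f k"] by simp
  qed
  show thesis
  proof (rule that)
    show "finite T" "card T = M"
      using T by auto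
    show "pairwise (\<lambda>c c'. L * r \<le> dist c c') T"
    proof (rule pairwiseI)
      fix c c' assume c: "c \<in> T" "c' \<in> T" "c \<noteq> c'"
      then obtain k l where "c = f k" "c' = f l"
        using T(1) by blast
      then show "L * r \<le> dist c c'"
        using c(3) by (auto intro: sep)
    qed
    show "\<forall>c\<in>T. ball c r \<subseteq> ball x\<^sub>0 \<rho>"
      using T(1) inside by blast
  qed
qed

section \<open>The family of perturbed pairs\<close>

text \<open>
On each ball \<open>\<eta>P - 1/2\<close> and \<open>\<eta>Q - 1/2\<close> have the same sign, and the former is \<open>C\<^sub>\<gamma>\<close> times the \<open>\<gamma>\<close>-th power of the
latter in absolute value, so the relative signal condition holds with equality.
\<close>

lemma perturbed_pair_in_class:
  fixes \<nu> :: "(real^'d::finite) measure"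
  assumes pos: "0 \<le> \<alpha>" "0 < C\<^sub>\<alpha>" "0 < \<beta>" "\<beta> \<le> 1" "0 < C\<^sub>\<beta>" "0 < \<gamma>" "0 < C\<^sub>\<gamma>" and ab: "\<alpha> * \<beta> \<le> 1"
    and \<nu>: "prob_space \<nu>" and sets_\<nu>: "sets \<nu> = sets borel"
    and supp: "measure_support \<nu> \<subseteq> cbox 0 1" "regular_set c\<^sub>\<mu> r\<^sub>\<mu> (measure_support \<nu>)"
      "density_between \<mu>\<^sub>m \<mu>\<^sub>M (measure_support \<nu>) \<nu>"
    and S: "finite S" and r: "0 < r"
    and sep: "pairwise (\<lambda>c c'. (2 + 2 powr (1/\<beta>)) * r \<le> dist c c') S"
    and sub: "\<And>c. c \<in> S \<Longrightarrow> ball c r \<subseteq> measure_support \<nu>"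
    and dens: "\<And>c E. c \<in> S \<Longrightarrow> E \<subseteq> ball c r \<Longrightarrow> E \<in> sets borel \<Longrightarrow> measure \<nu> E = a * measure lborel E" and a: "0 \<le> a"
    and few: "real (card S) * (a * unit_ball_vol (real CARD('d)) * real CARD('d) * r ^ CARD('d)) \<le>
      C\<^sub>\<alpha> * C\<^sub>\<beta> powr \<alpha> * r powr (\<alpha> * \<beta>)"
    and small: "C\<^sub>\<beta> * r powr \<beta> \<le> 1/2" "C\<^sub>\<gamma> * (C\<^sub>\<beta> * r powr \<beta>) powr \<gamma> \<le> 1/2"
  shows "(labelled_law \<nu> (signed_bumps S (\<lambda>z. C\<^sub>\<gamma> * bump C\<^sub>\<beta> \<beta> r z powr \<gamma>) \<sigma>),
          labelled_law \<nu> (signed_bumps S (bump C\<^sub>\<beta> \<beta> r) \<sigma>))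
    \<in> transfer_class \<alpha> C\<^sub>\<alpha> \<beta> C\<^sub>\<beta> \<gamma> C\<^sub>\<gamma> \<mu>\<^sub>m \<mu>\<^sub>M c\<^sub>\<mu> r\<^sub>\<mu>"
proof -
  let ?\<phi> = "bump C\<^sub>\<beta> \<beta> r :: real^'d \<Rightarrow> real"
  let ?\<psi> = "\<lambda>z. C\<^sub>\<gamma> * ?\<phi> z powr \<gamma>"
  let ?\<eta>P = "signed_bumps S ?\<psi> \<sigma>" and ?\<eta>Q = "signed_bumps S ?\<phi> \<sigma>"
  have sep2: "pairwise (\<lambda>c c'. 2 * r \<le> dist c c') S"
    using r sep by (rule separated_balls_disjoint)
  have \<phi>0: "?\<phi> z = 0" if "r \<le> norm z" for z using that by (rule bump_outside)
  have \<psi>0: "?\<psi> z = 0" if "r \<le> norm z" for z using \<phi>0[OF that] by simp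
  have \<phi>_nn: "0 \<le> ?\<phi> z" for z using pos by (simp add: bump_nonneg)
  have \<phi>_le: "?\<phi> z \<le> C\<^sub>\<beta> * r powr \<beta>" for z using pos r by (intro bump_le) auto
  have \<phi>_half: "?\<phi> z \<le> 1/2" for z using \<phi>_le[of z] small by linarith
  have \<psi>_nn: "0 \<le> ?\<psi> z" for z using pos by simp
  have "?\<psi> z \<le> C\<^sub>\<gamma> * (C\<^sub>\<beta> * r powr \<beta>) powr \<gamma>" for z
    using \<phi>_le[of z] \<phi>_nn[of z] pos by (intro mult_left_mono powr_mono2) auto
  then have \<psi>_half: "?\<psi> z \<le> 1/2" for z
    using small(2) order_trans by blast
  have [measurable]: "?\<psi> \<in> borel_measurable borel" by measurable
  have mP: "?\<eta>P \<in> borel_measurable borel" and mQ: "?\<eta>Q \<in> borel_measurable borel"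
    by measurable
  have bP: "0 \<le> ?\<eta>P x" "?\<eta>P x \<le> 1" for x
    using signed_bumps_bounds[of S r ?\<psi>, OF S sep2 \<psi>0 \<psi>_nn \<psi>_half] by auto
  have bQ: "0 \<le> ?\<eta>Q x" "?\<eta>Q x \<le> 1" for x
    using signed_bumps_bounds[of S r ?\<phi>, OF S sep2 \<phi>0 \<phi>_nn \<phi>_half] by auto
  have out: "x \<notin> ball c r" if "x \<notin> measure_support \<nu>" "c \<in> S" for x c
    using that sub by blast
  have offP: "?\<eta>P x = 1/2" if "x \<notin> measure_support \<nu>" for x
    by (rule signed_bumps_outside[of r]) (use \<psi>0 out that in auto)
  have offQ: "?\<eta>Q x = 1/2" if "x \<notin> measure_support \<nu>" for x
    by (rule signed_bumps_outside[of r]) (use \<phi>0 out that in auto)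
  have cube: "AE x in \<nu>. \<forall>i. 0 \<le> x $ i \<and> x $ i \<le> 1"
    using sets_\<nu> supp(1) by (rule AE_unit_cube_of_support)
  have margP: "marginal (labelled_law \<nu> ?\<eta>P) = \<nu>"
    by (rule marginal_labelled_law[OF sets_\<nu> mP bP])
  have margQ: "marginal (labelled_law \<nu> ?\<eta>Q) = \<nu>"
    by (rule marginal_labelled_law[OF sets_\<nu> mQ bQ])
  have signal: "relative_signal \<gamma> C\<^sub>\<gamma> (measure_support \<nu> \<union> measure_support \<nu>) ?\<eta>P ?\<eta>Q"
    unfolding relative_signal_def
  proof
    fix x
    show "0 \<le> (?\<eta>P x - 1/2) * (?\<eta>Q x - 1/2) \<and> C\<^sub>\<gamma> * \<bar>?\<eta>Q x - 1/2\<bar> powr \<gamma> \<le> \<bar>?\<eta>P x - 1/2\<bar>"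
    proof (cases "\<exists>c\<in>S. x \<in> ball c r")
      case True
      then obtain c where c: "c \<in> S" "x \<in> ball c r" by blast
      have "?\<eta>Q x = (if c \<in> \<sigma> then 1/2 + ?\<phi> (x - c) else 1/2 - ?\<phi> (x - c))"
        using signed_bumps_in_ball(1)[of S r ?\<phi>, OF S sep2 \<phi>0 c] by simp
      moreover have "?\<eta>P x = (if c \<in> \<sigma> then 1/2 + ?\<psi> (x - c) else 1/2 - ?\<psi> (x - c))"
        using signed_bumps_in_ball(1)[of S r ?\<psi>, OF S sep2 \<psi>0 c] by simp
      ultimately show ?thesis
        using \<phi>_nn[of "x - c"] \<psi>_nn[of "x - c"] by auto
    next
      case False
      have half: "?\<eta>P x = 1/2" "?\<eta>Q x = 1/2"
        by (rule signed_bumps_outside[of r]; use \<psi>0 \<phi>0 False in auto)+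
      show ?thesis
        unfolding half by simp
    qed
  qed
  have regP: "is_regression_fun (labelled_law \<nu> ?\<eta>P) ?\<eta>P"
    using offP by (intro is_regression_fun_labelled_law[OF \<nu> sets_\<nu> mP bP])
  have regQ: "is_regression_fun (labelled_law \<nu> ?\<eta>Q) ?\<eta>Q"
    using offQ by (intro is_regression_fun_labelled_law[OF \<nu> sets_\<nu> mQ bQ])
  have "margin \<alpha> C\<^sub>\<alpha> \<nu> ?\<eta>Q"
    by (rule margin_signed_bumps[OF \<nu> sets_\<nu> pos(5) pos(1) pos(3) ab r S sep2 dens a few pos(2)])
  moreover have "hoelder_smooth \<beta> C\<^sub>\<beta> ?\<eta>Q"
    using pos r S sep by (intro hoelder_smooth_signed_bumps) auto
  moreover have "law_on_cube (labelled_law \<nu> ?\<eta>P)" "law_on_cube (labelled_law \<nu> ?\<eta>Q)"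
    using law_on_cube_labelled_law[OF \<nu> sets_\<nu> cube] mP bP mQ bQ by auto
  ultimately show ?thesis
    unfolding transfer_class_def using regP regQ signal supp by (auto simp: margP margQ)
qed

text \<open>
On the concentric ball of half the radius the bump is at least \<open>C * (r/2) powr \<beta>\<close>.
\<close>

lemma bump_integral_ge:
  fixes \<nu> :: "(real^'d::finite) measure"
  assumes "prob_space \<nu>" and sets_\<nu> [measurable_cong]: "sets \<nu> = sets borel"
    and dens: "measure \<nu> (ball c (r/2)) = a * measure lborel (ball c (r/2))" and "0 \<le> C" "0 \<le> \<beta>" "0 < r" "0 \<le> a"
  shows "ennreal (C * (r/2) powr \<beta> * (a * unit_ball_vol (real CARD('d)) * (r/2) ^ CARD('d)))
    \<le> (\<integral>\<^sup>+x. ennreal (bump C \<beta> r (x - c)) \<partial>\<nu>)"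
proof -
  interpret prob_space \<nu> by fact
  have [measurable]: "ball c (r/2) \<in> sets \<nu>" by (simp add: sets_\<nu>)
  have "ennreal (C * (r/2) powr \<beta> * (a * unit_ball_vol (real CARD('d)) * (r/2) ^ CARD('d)))
      = ennreal (C * (r/2) powr \<beta>) * emeasure \<nu> (ball c (r/2))"
    using assms by (simp add: emeasure_eq_measure content_ball ennreal_mult[symmetric] mult.assoc)
  also have "\<dots> = (\<integral>\<^sup>+x. ennreal (C * (r/2) powr \<beta>) * indicator (ball c (r/2)) x \<partial>\<nu>)"
    by (simp add: nn_integral_cmult)
  also have "\<dots> \<le> (\<integral>\<^sup>+x. ennreal (bump C \<beta> r (x - c)) \<partial>\<nu>)"
  proof (rule nn_integral_mono)
    fix x
    show "ennreal (C * (r/2) powr \<beta>) * indicator (ball c (r/2)) x \<le> ennreal (bump C \<beta> r (x - c))"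
    proof (cases "x \<in> ball c (r/2)")
      case True
      then have "norm (x - c) \<le> r/2"
        by (simp add: dist_norm norm_minus_commute)
      then have "C * (r/2) powr \<beta> \<le> bump C \<beta> r (x - c)"
        unfolding bump_def using assms by (intro mult_left_mono powr_mono2 max.coboundedI2) auto
      then show ?thesis using True by (simp add: ennreal_leI)
    qed simp
  qed
  finally show ?thesis .
qed

text \<open>
The bound at a fixed scale. The two conditions on the sample sizes keep each of the two sample affinities
above \<open>3/4\<close> by Bernoulli's inequality, so that their product exceeds \<open>1/2\<close>.
\<close>

lemma bump_family_risk_lower_bound:
  fixes \<nu> :: "(real^'d::finite) measure" and f :: "'d data \<Rightarrow> real^'d \<Rightarrow> bool"
  defines "v \<equiv> unit_ball_vol (real CARD('d))"
  assumes pos: "0 \<le> \<alpha>" "0 < C\<^sub>\<alpha>" "0 < \<beta>" "\<beta> \<le> 1" "0 < C\<^sub>\<beta>" "0 < \<gamma>" "0 < C\<^sub>\<gamma>" and ab: "\<alpha> * \<beta> \<le> 1"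
    and \<nu>: "prob_space \<nu>" and sets_\<nu>: "sets \<nu> = sets borel"
    and supp: "measure_support \<nu> \<subseteq> cbox 0 1" "regular_set c\<^sub>\<mu> r\<^sub>\<mu> (measure_support \<nu>)"
      "density_between \<mu>\<^sub>m \<mu>\<^sub>M (measure_support \<nu>) \<nu>"
    and S: "finite S" "S \<noteq> {}" and r: "0 < r"
    and sep: "pairwise (\<lambda>c c'. (2 + 2 powr (1/\<beta>)) * r \<le> dist c c') S"
    and sub: "\<And>c. c \<in> S \<Longrightarrow> ball c r \<subseteq> measure_support \<nu>"
    and dens: "\<And>c E. c \<in> S \<Longrightarrow> E \<subseteq> ball c r \<Longrightarrow> E \<in> sets borel \<Longrightarrow> measure \<nu> E = a * measure lborel E" and a: "0 < a"
    and few: "real (card S) * (a * v * real CARD('d) * r ^ CARD('d)) \<le> C\<^sub>\<alpha> * C\<^sub>\<beta> powr \<alpha> * r powr (\<alpha> * \<beta>)"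
    and small: "C\<^sub>\<beta> * r powr \<beta> \<le> 1/2" "C\<^sub>\<gamma> * (C\<^sub>\<beta> * r powr \<beta>) powr \<gamma> \<le> 1/2"
    and nP: "real n\<^sub>P * (4 * (C\<^sub>\<gamma> * (C\<^sub>\<beta> * r powr \<beta>) powr \<gamma>)\<^sup>2 * (a * v * r ^ CARD('d))) \<le> 1/4"
    and nQ: "real n\<^sub>Q * (4 * (C\<^sub>\<beta> * r powr \<beta>)\<^sup>2 * (a * v * r ^ CARD('d))) \<le> 1/4"
    and f: "f \<in> classifiers n\<^sub>P n\<^sub>Q"
  shows "\<exists>(P, Q)\<in>transfer_class \<alpha> C\<^sub>\<alpha> \<beta> C\<^sub>\<beta> \<gamma> C\<^sub>\<gamma> \<mu>\<^sub>m \<mu>\<^sub>M c\<^sub>\<mu> r\<^sub>\<mu>.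
    real (card S) * (C\<^sub>\<beta> * (r/2) powr \<beta> * (a * v * (r/2) ^ CARD('d))) \<le> 8 * expected_excess_risk n\<^sub>P n\<^sub>Q P Q f"
proof -
  interpret prob_space \<nu> by fact
  let ?d = "CARD('d)"
  let ?\<phi> = "bump C\<^sub>\<beta> \<beta> r :: real^'d \<Rightarrow> real"
  let ?\<psi> = "\<lambda>z. C\<^sub>\<gamma> * ?\<phi> z powr \<gamma>"
  define h where "h = C\<^sub>\<beta> * r powr \<beta>"
  define g where "g = C\<^sub>\<gamma> * h powr \<gamma>"
  define V where "V = a * v * r ^ ?d"
  have hg: "0 \<le> h" "h \<le> 1/2" "0 \<le> g" "g \<le> 1/2"
    using pos small by (auto simp: h_def g_def)
  have V: "measure \<nu> (ball c r) = V" if "c \<in> S" for c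
    using dens[OF that, of "ball c r"] r by (simp add: content_ball V_def v_def)
  have V01: "0 \<le> V" "V \<le> 1"
    using S(2) V by (metis measure_nonneg ex_in_conv, metis prob_le_1 ex_in_conv)
  have bern: "4 * y\<^sup>2 * V \<le> 1 \<and> 3/4 \<le> (1 - 4 * y\<^sup>2 * V) ^ n"
    if "0 \<le> y" "y \<le> 1/2" "real n * (4 * y\<^sup>2 * V) \<le> 1/4" for y n
  proof -
    have "y\<^sup>2 \<le> (1/2)\<^sup>2" using that by (intro power_mono) auto
    then have "4 * y\<^sup>2 * V \<le> 1 * 1"
      using V01 by (intro mult_mono) (auto simp: power2_eq_square)
    moreover have "1 + real n * (- (4 * y\<^sup>2 * V)) \<le> (1 + - (4 * y\<^sup>2 * V)) ^ n"
      using calculation by (intro Bernoulli_inequality) simp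
    ultimately show ?thesis using that(3) by simp
  qed
  have bP: "4 * g\<^sup>2 * V \<le> 1" "3/4 \<le> (1 - 4 * g\<^sup>2 * V) ^ n\<^sub>P"
    using bern[OF hg(3,4), of n\<^sub>P] nP by (auto simp: g_def h_def V_def)
  have bQ: "4 * h\<^sup>2 * V \<le> 1" "3/4 \<le> (1 - 4 * h\<^sup>2 * V) ^ n\<^sub>Q"
    using bern[OF hg(1,2), of n\<^sub>Q] nQ by (auto simp: h_def V_def)
  have "(3/4) * (3/4) \<le> (1 - 4 * g\<^sup>2 * V) ^ n\<^sub>P * (1 - 4 * h\<^sup>2 * V) ^ n\<^sub>Q"
    using bP bQ by (intro mult_mono) auto
  then have aff: "1/2 \<le> (1 - 4 * g\<^sup>2 * V) ^ n\<^sub>P * (1 - 4 * h\<^sup>2 * V) ^ n\<^sub>Q"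
    by simp
  have sep2: "pairwise (\<lambda>c c'. 2 * r \<le> dist c c') S"
    using r sep by (rule separated_balls_disjoint)
  have cube: "AE x in \<nu>. \<forall>i. 0 \<le> x $ i \<and> x $ i \<le> 1"
    using sets_\<nu> supp(1) by (rule AE_unit_cube_of_support)
  have \<phi>_nn: "0 \<le> ?\<phi> z" for z using pos by (simp add: bump_nonneg)
  have \<phi>_le: "?\<phi> z \<le> h" for z using pos r unfolding h_def by (intro bump_le) auto
  have \<psi>_le: "?\<psi> z \<le> g" for z
    using \<phi>_le[of z] \<phi>_nn[of z] pos unfolding g_def by (intro mult_left_mono powr_mono2) auto
  have "\<exists>\<sigma>\<subseteq>S. (\<Sum>c\<in>S. \<integral>\<^sup>+x. ennreal (?\<phi> (x - c)) \<partial>\<nu>) \<le>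
     8 * ennreal (expected_excess_risk n\<^sub>P n\<^sub>Q (labelled_law \<nu> (signed_bumps S ?\<psi> \<sigma>)) (labelled_law \<nu> (signed_bumps S ?\<phi> \<sigma>)) f)"
    by (rule assouad_excess_risk[OF \<nu> sets_\<nu> cube S(1) sep2, where V = V and h = h and g = g])
       (use V sub \<phi>_nn \<phi>_le \<psi>_le hg bP bQ aff f pos in \<open>auto simp: bump_outside\<close>)
  then obtain \<sigma> where \<sigma>: "(\<Sum>c\<in>S. \<integral>\<^sup>+x. ennreal (?\<phi> (x - c)) \<partial>\<nu>) \<le>
     8 * ennreal (expected_excess_risk n\<^sub>P n\<^sub>Q (labelled_law \<nu> (signed_bumps S ?\<psi> \<sigma>)) (labelled_law \<nu> (signed_bumps S ?\<phi> \<sigma>)) f)"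
    by blast
  let ?q = "C\<^sub>\<beta> * (r/2) powr \<beta> * (a * v * (r/2) ^ ?d)"
  have q: "0 < ?q"
    using pos a r by (simp add: v_def)
  have card: "0 < card S" using S by (simp add: card_gt_0_iff)
  have "ennreal (real (card S) * ?q) = (\<Sum>c\<in>S. ennreal ?q)"
    using q by (simp add: ennreal_mult ennreal_of_nat_eq_real_of_nat)
  also have "\<dots> \<le> (\<Sum>c\<in>S. \<integral>\<^sup>+x. ennreal (?\<phi> (x - c)) \<partial>\<nu>)"
  proof (rule sum_mono)
    fix c assume c: "c \<in> S"
    have "ball c (r/2) \<subseteq> ball c r" using r by (intro subset_ball) simp
    then show "ennreal ?q \<le> (\<integral>\<^sup>+x. ennreal (?\<phi> (x - c)) \<partial>\<nu>)"
      unfolding v_def using dens[OF c] pos r a by (intro bump_integral_ge[OF \<nu> sets_\<nu>]) auto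
  qed
  also note \<sigma>
  finally have "ennreal (real (card S) * ?q) \<le> ennreal (8 * expected_excess_risk n\<^sub>P n\<^sub>Q (labelled_law \<nu> (signed_bumps S ?\<psi> \<sigma>)) (labelled_law \<nu> (signed_bumps S ?\<phi> \<sigma>)) f)"
    by (simp add: ennreal_mult')
  moreover have "0 < real (card S) * ?q" using q card by simp
  ultimately have "real (card S) * ?q \<le> 8 * expected_excess_risk n\<^sub>P n\<^sub>Q (labelled_law \<nu> (signed_bumps S ?\<psi> \<sigma>)) (labelled_law \<nu> (signed_bumps S ?\<phi> \<sigma>)) f"
    by (simp add: ennreal_le_iff2)
  moreover have "(labelled_law \<nu> (signed_bumps S ?\<psi> \<sigma>), labelled_law \<nu> (signed_bumps S ?\<phi> \<sigma>))
      \<in> transfer_class \<alpha> C\<^sub>\<alpha> \<beta> C\<^sub>\<beta> \<gamma> C\<^sub>\<gamma> \<mu>\<^sub>m \<mu>\<^sub>M c\<^sub>\<mu> r\<^sub>\<mu>"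
    by (rule perturbed_pair_in_class[OF pos ab \<nu> sets_\<nu> supp S(1) r sep sub dens less_imp_le[OF a] few[unfolded v_def] small])
  ultimately show ?thesis by blast
qed

section \<open>Choice of the scale\<close>

lemma nat_floor_bounds:
  fixes y :: real assumes "1 \<le> y"
  shows "y / 2 \<le> real (nat \<lfloor>y\<rfloor>)" and "real (nat \<lfloor>y\<rfloor>) \<le> y"
proof -
  have "1 \<le> \<lfloor>y\<rfloor>"
    using assms by simp
  then have f: "1 \<le> real_of_int \<lfloor>y\<rfloor>" "real (nat \<lfloor>y\<rfloor>) = real_of_int \<lfloor>y\<rfloor>"
    by simp_all
  show "y / 2 \<le> real (nat \<lfloor>y\<rfloor>)"
    using f real_of_int_floor_gt_diff_one[of y] by linarith
  show "real (nat \<lfloor>y\<rfloor>) \<le> y"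
    using f of_int_floor_le[of y] by linarith
qed

text \<open>
With \<open>e = \<alpha> * \<beta>\<close>, the margin condition allows \<open>K * r powr (e - d)\<close> bumps and the packing has room for a
multiple of \<open>r powr (- d)\<close>; the smaller of the two integer parts has the order of \<open>r powr (e - d)\<close>. The
bound \<open>r powr (d - e) \<le> K\<close> says that the margin condition allows at least one bump.
\<close>

lemma exists_bump_centres:
  fixes x\<^sub>0 :: "real^'d::finite"
  assumes r: "0 < r" "r \<le> 1" and L: "1 \<le> L" and fits: "real CARD('d) * L * r \<le> \<rho>"
    and e: "0 \<le> e" and K: "0 < K" "r powr (real CARD('d) - e) \<le> K"
  obtains S where "finite S" "S \<noteq> {}" "pairwise (\<lambda>c c'. L * r \<le> dist c c') S"
    "\<forall>c\<in>S. ball c r \<subseteq> ball x\<^sub>0 \<rho>"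
    "real (card S) \<le> K * r powr (e - real CARD('d))"
    "min (K / 2) ((\<rho> / (2 * real CARD('d) * L)) ^ CARD('d)) * r powr (e - real CARD('d)) \<le> real (card S)"
proof -
  let ?d = "real CARD('d)"
  define R where "R = r powr (e - ?d)"
  have R: "0 < R" using r by (simp add: R_def)
  have KR: "1 \<le> K * R"
    using K r by (simp add: R_def powr_diff field_simps)
  define D where "D = ?d * L * r"
  have D: "0 < D" "D \<le> \<rho>" using r L fits by (auto simp: D_def)
  define N where "N = nat \<lfloor>\<rho> / D\<rfloor>"
  have "1 \<le> \<rho> / D" using D by simp
  note N = nat_floor_bounds[OF this, folded N_def]
  define M where "M = min (nat \<lfloor>K * R\<rfloor>) (N ^ CARD('d))"
  have fitsN: "?d * L * r * real N \<le> \<rho>"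
    using N(2) D(1) unfolding D_def[symmetric] by (simp add: pos_le_divide_eq mult.commute)
  obtain S :: "(real^'d) set" where S: "finite S" "card S = M" "pairwise (\<lambda>c c'. L * r \<le> dist c c') S"
      "\<forall>c\<in>S. ball c r \<subseteq> ball x\<^sub>0 \<rho>"
    by (rule exists_packing_in_ball[OF r(1) L fitsN, of M x\<^sub>0]) (simp_all add: M_def)
  have "R \<le> (1 / r) ^ CARD('d)"
  proof -
    have "R \<le> r powr (- ?d)"
      unfolding R_def using r e by (intro powr_mono') auto
    also have "\<dots> = (1 / r) ^ CARD('d)"
      using r by (simp add: powr_minus powr_realpow power_one_over inverse_eq_divide)
    finally show ?thesis .
  qed
  then have "(\<rho> / (2 * ?d * L)) ^ CARD('d) * R \<le> (\<rho> / (2 * ?d * L)) ^ CARD('d) * (1 / r) ^ CARD('d)"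
    using D L by (intro mult_left_mono) auto
  also have "\<dots> = (\<rho> / D / 2) ^ CARD('d)"
    by (simp add: power_mult_distrib[symmetric] D_def mult_ac)
  also have "\<dots> \<le> real N ^ CARD('d)"
    using N(1) D by (intro power_mono) auto
  finally have low2: "(\<rho> / (2 * ?d * L)) ^ CARD('d) * R \<le> real (N ^ CARD('d))" by simp
  have low1: "K / 2 * R \<le> real (nat \<lfloor>K * R\<rfloor>)"
    using nat_floor_bounds(1)[OF KR] by simp
  let ?\<kappa> = "min (K / 2) ((\<rho> / (2 * ?d * L)) ^ CARD('d))"
  have "?\<kappa> * R \<le> K / 2 * R" "?\<kappa> * R \<le> (\<rho> / (2 * ?d * L)) ^ CARD('d) * R"
    using R by (intro mult_right_mono; simp)+
  then have low: "?\<kappa> * R \<le> real M"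
    using low1 low2 by (simp add: M_def min_def)
  have "0 < ?\<kappa> * R"
    using R K D L by simp
  then have "0 < M" using low by linarith
  then have "S \<noteq> {}" using S(2) by auto
  moreover have "real M \<le> K * R"
  proof -
    have "real M \<le> real (nat \<lfloor>K * R\<rfloor>)" by (simp add: M_def)
    also have "\<dots> \<le> K * R" by (rule nat_floor_bounds(2)[OF KR])
    finally show ?thesis .
  qed
  ultimately show thesis
    using that[of S] S low unfolding R_def by simp
qed

text \<open>
The scale \<open>r\<close> balances both samples: \<open>T\<close> dominates \<open>n\<^sub>Q\<close>, and \<open>T powr ((2 * \<gamma> * \<beta> + d) / (2 * \<beta> + d))\<close> dominates
\<open>n\<^sub>P\<close>, which is the reason for the exponent of \<open>n\<^sub>P\<close> in \<open>T\<close>.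
\<close>

lemma critical_scale:
  fixes n\<^sub>P n\<^sub>Q :: nat
  assumes d: "1 \<le> (d::real)" and pos: "0 < \<beta>" "0 < \<gamma>" and s: "0 < s" and n: "n\<^sub>P \<noteq> 0 \<or> n\<^sub>Q \<noteq> 0"
  defines "T \<equiv> real n\<^sub>P powr ((2 * \<beta> + d) / (2 * \<gamma> * \<beta> + d)) + real n\<^sub>Q"
  defines "r \<equiv> s * T powr (- 1 / (2 * \<beta> + d))"
  shows "0 < r" and "r \<le> s" and "real n\<^sub>Q * r powr (2 * \<beta> + d) \<le> s powr (2 * \<beta> + d)"
    and "real n\<^sub>P * r powr (2 * \<gamma> * \<beta> + d) \<le> s powr (2 * \<gamma> * \<beta> + d)"
    and "r powr b = s powr b * T powr (- (b / (2 * \<beta> + d)))"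
proof -
  let ?q = "2 * \<beta> + d" and ?p = "2 * \<gamma> * \<beta> + d"
  have q: "0 < ?q" and p: "0 < ?p"
    using d pos by (auto intro: add_pos_pos)
  have T1: "1 \<le> T"
  proof (cases "n\<^sub>Q = 0")
    case True
    then have "1 \<le> real n\<^sub>P powr (?q / ?p)"
      using n p q by (intro ge_one_powr_ge_zero) auto
    then show ?thesis by (simp add: T_def)
  next
    case False
    then have "1 \<le> real n\<^sub>Q" by simp
    then show ?thesis by (simp add: T_def add_increasing)
  qed
  show "0 < r" using s T1 by (simp add: r_def)
  have "T powr (- 1 / ?q) \<le> T powr 0"
    using T1 q by (intro powr_mono) auto
  then show "r \<le> s" using s T1 by (simp add: r_def)
  show pw: "r powr b = s powr b * T powr (- (b / ?q))" for b
    using s T1 by (simp add: r_def powr_mult powr_powr)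
  have "real n\<^sub>Q * T powr (- 1) \<le> 1"
    using T1 by (simp add: powr_minus T_def field_simps)
  then show "real n\<^sub>Q * r powr ?q \<le> s powr ?q"
    using mult_left_mono[of "real n\<^sub>Q * T powr (- 1)" 1 "s powr ?q"] q
    by (simp only: pw[of ?q] mult.left_commute mult_1_right) simp
  have "real n\<^sub>P = (real n\<^sub>P powr (?q / ?p)) powr (?p / ?q)"
    using p q by (cases "n\<^sub>P = 0") (simp_all add: powr_powr)
  also have "\<dots> \<le> T powr (?p / ?q)"
    using p q by (intro powr_mono2) (auto simp: T_def)
  finally have "real n\<^sub>P * T powr (- (?p / ?q)) \<le> 1"
    using T1 by (simp add: powr_minus field_simps)
  then show "real n\<^sub>P * r powr ?p \<le> s powr ?p"
    using mult_left_mono[of "real n\<^sub>P * T powr (- (?p / ?q))" 1 "s powr ?p"]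
    by (simp only: pw[of ?p] mult.left_commute mult_1_right) simp
qed

lemma eventually_powr_le:
  fixes e s :: real
  assumes "0 < e" "0 < s"
  shows "\<forall>\<^sub>F r in at_right 0. r powr s \<le> e"
proof -
  have "r powr s \<le> e" if "0 < r" "r < e powr (1 / s)" for r
    using powr_mono2[of s r "e powr (1 / s)"] that assms by (simp add: powr_powr)
  then show ?thesis
    using assms unfolding eventually_at_right_field by (intro exI[of _ "e powr (1 / s)"]) auto
qed

theorem theorem3p2:
  fixes \<alpha> C\<^sub>\<alpha> \<beta> C\<^sub>\<beta> \<gamma> C\<^sub>\<gamma> \<mu>\<^sub>m \<mu>\<^sub>M c\<^sub>\<mu> r\<^sub>\<mu> :: real
    and \<C> :: "(('d::finite) law \<times> 'd law) set"
  assumes "\<alpha> \<ge> 0" and "C\<^sub>\<alpha> > 0"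
    and "0 < \<beta>" and "\<beta> \<le> 1" and "C\<^sub>\<beta> > 0"
    and "\<gamma> > 0" and "C\<^sub>\<gamma> > 0"
    and "0 < \<mu>\<^sub>m" and "\<mu>\<^sub>m < \<mu>\<^sub>M"
    and "c\<^sub>\<mu> > 0" and "r\<^sub>\<mu> > 0"
    and "\<alpha> * \<beta> \<le> real CARD('d)"
    and "\<C> = transfer_class \<alpha> C\<^sub>\<alpha> \<beta> C\<^sub>\<beta> \<gamma> C\<^sub>\<gamma> \<mu>\<^sub>m \<mu>\<^sub>M c\<^sub>\<mu> r\<^sub>\<mu>"
    and "informative \<C>"
  shows "\<exists>c>0. \<forall>n\<^sub>P n\<^sub>Q :: nat. n\<^sub>P \<noteq> 0 \<or> n\<^sub>Q \<noteq> 0 \<longrightarrow>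
    (INF f\<in>classifiers n\<^sub>P n\<^sub>Q. SUP (P, Q)\<in>\<C>. ereal (expected_excess_risk n\<^sub>P n\<^sub>Q P Q f)) \<ge>
    ereal (c * (real n\<^sub>P powr ((2 * \<beta> + real CARD('d)) / (2 * \<gamma> * \<beta> + real CARD('d))) + real n\<^sub>Q)
                 powr (- (\<beta> * (1 + \<alpha>) / (2 * \<beta> + real CARD('d)))))"
proof -
  note pos = assms(1-7)
  let ?d = "real CARD('d)"
  define v where "v = unit_ball_vol ?d"
  have v: "0 < v" by (simp add: v_def)
  have d: "1 \<le> ?d" by (simp add: Suc_le_eq)
  obtain P\<^sub>0 Q\<^sub>0 :: "'d law" where PQ: "(P\<^sub>0, Q\<^sub>0) \<in> transfer_class \<alpha> C\<^sub>\<alpha> \<beta> C\<^sub>\<beta> \<gamma> C\<^sub>\<gamma> \<mu>\<^sub>m \<mu>\<^sub>M c\<^sub>\<mu> r\<^sub>\<mu>"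
      "measure (marginal Q\<^sub>0) {x. regression_fun Q\<^sub>0 x \<noteq> 1/2} > 0"
    using assms(14) unfolding assms(13) informative_def by blast
  define \<Omega> where "\<Omega> = measure_support (marginal Q\<^sub>0)"
  note geom = informative_class_geometry[OF assms(3,5,8,1,2) PQ, folded \<Omega>_def]
  have ab: "\<alpha> * \<beta> \<le> 1" by (rule geom(6))
  obtain x\<^sub>0 \<rho>\<^sub>0 where patch: "0 < \<rho>\<^sub>0" "ball x\<^sub>0 \<rho>\<^sub>0 \<subseteq> \<Omega>" using geom(5) by blast
  define K\<^sub>0 where "K\<^sub>0 = C\<^sub>\<alpha> * C\<^sub>\<beta> powr \<alpha>"
  have K0: "0 < K\<^sub>0" using pos by (simp add: K\<^sub>0_def)
  \<comment> \<open>If \<open>\<alpha> * \<beta> = d\<close>, the number of bumps does not grow as \<open>r\<close> tends to 0, and the density on the patch has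
    to be small enough for one bump to satisfy the margin condition.\<close>
  define A where "A = (if \<alpha> * \<beta> = ?d then K\<^sub>0 / (v * ?d) else \<mu>\<^sub>M)"
  have \<mu>A: "\<mu>\<^sub>m < A"
  proof (cases "\<alpha> * \<beta> = ?d")
    case True
    then have d1: "?d = 1" using ab d by linarith
    then have "\<mu>\<^sub>m * unit_ball_vol 1 < K\<^sub>0"
      unfolding K\<^sub>0_def using True by (intro geom(7)) simp_all
    then show ?thesis
      using True v unfolding A_def v_def d1 by (simp add: pos_less_divide_eq)
  qed (simp add: A_def assms(9))
  have "closed \<Omega>" unfolding \<Omega>_def by (rule closed_measure_support)
  obtain a \<rho> \<nu> where a: "\<mu>\<^sub>m < a" "a < \<mu>\<^sub>M" "a \<le> A" and \<rho>: "0 < \<rho>" "\<rho> \<le> \<rho>\<^sub>0"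
    and \<nu>: "prob_space \<nu>" "sets \<nu> = sets borel" and supp: "measure_support \<nu> = \<Omega>" "density_between \<mu>\<^sub>m \<mu>\<^sub>M \<Omega> \<nu>"
    and flat: "\<forall>E\<in>sets borel. E \<subseteq> ball x\<^sub>0 \<rho> \<longrightarrow> measure \<nu> E = a * measure lborel E"
    by (rule exists_marginal_with_flat_patch[OF \<open>closed \<Omega>\<close> geom(1) assms(10,11) geom(4) patch assms(8) geom(2,3) \<mu>A])
  have a0: "0 < a" using a assms(8) by linarith
  \<comment> \<open>The margin condition allows \<open>K * r powr (\<alpha> * \<beta> - d)\<close> bumps.\<close>
  define K where "K = K\<^sub>0 / (a * v * ?d)"
  have K: "0 < K" using K0 a0 v d by (simp add: K_def)
  \<comment> \<open>The separation, in units of \<open>r\<close>, that preserves the Hoelder constant.\<close>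
  define L where "L = 2 + 2 powr (1 / \<beta>)"
  have L: "1 \<le> L" by (simp add: L_def add_increasing2)
  \<comment> \<open>The scale has to be small enough for the regression functions to stay in \<open>[0, 1]\<close>, for the packing to fit, for
    at least one bump to be allowed, and for the samples at the critical scale to be uninformative about each sign.\<close>
  define good where "good r \<longleftrightarrow> r powr \<beta> \<le> 1 / (2 * C\<^sub>\<beta>) \<and> r powr (\<beta> * \<gamma>) \<le> 1 / (2 * C\<^sub>\<gamma> * C\<^sub>\<beta> powr \<gamma>) \<and>
     r powr 1 \<le> \<rho> / (?d * L) \<and> r powr 1 \<le> 1 \<and> r powr (?d - \<alpha> * \<beta>) \<le> K \<and>
     r powr (2 * \<beta> + ?d) \<le> 1 / (16 * C\<^sub>\<beta>\<^sup>2 * a * v) \<and>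
     r powr (2 * \<gamma> * \<beta> + ?d) \<le> 1 / (16 * C\<^sub>\<gamma>\<^sup>2 * C\<^sub>\<beta> powr (2 * \<gamma>) * a * v)" for r
  have evK: "\<forall>\<^sub>F r in at_right 0. r powr (?d - \<alpha> * \<beta>) \<le> K"
  proof (cases "\<alpha> * \<beta> = ?d")
    case True
    then have "a * v * ?d \<le> K\<^sub>0"
      using a(3) v d by (simp add: A_def pos_le_divide_eq mult.assoc)
    then have "1 \<le> K"
      using a0 v d by (simp add: K_def)
    moreover have "r powr (?d - \<alpha> * \<beta>) \<le> 1" for r
      using True by simp
    ultimately show ?thesis
      by (intro always_eventually) (meson order_trans)
  next
    case False
    then show ?thesis
      using assms(12) K by (intro eventually_powr_le) auto
  qed
  have "\<forall>\<^sub>F r in at_right 0. good r"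
    unfolding good_def
    by (intro eventually_conj; (rule evK | rule eventually_powr_le))
       (use pos \<rho>(1) d L a0 v in \<open>auto intro!: divide_pos_pos mult_pos_pos add_pos_pos\<close>)
  then obtain r\<^sub>1 where r1: "0 < r\<^sub>1" "\<And>r. 0 < r \<Longrightarrow> r < r\<^sub>1 \<Longrightarrow> good r"
    by (auto simp: eventually_at_right_field)
  define s where "s = r\<^sub>1 / 2"
  have s: "0 < s" "s < r\<^sub>1" using r1(1) by (auto simp: s_def)
  have good_s: "good s" using s by (rule r1(2))
  define \<kappa> where "\<kappa> = min (K / 2) ((\<rho> / (2 * ?d * L)) ^ CARD('d))"
  have \<kappa>: "0 < \<kappa>" using K \<rho>(1) d L by (simp add: \<kappa>_def)
  define b where "b = \<beta> * (1 + \<alpha>)"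
  define q where "q = C\<^sub>\<beta> * (1/2) powr \<beta> * (a * v * (1/2) ^ CARD('d))"
  have q: "0 < q" using pos a0 v by (simp add: q_def)
  define c where "c = \<kappa> * q * s powr b / 8"
  have c: "0 < c" using \<kappa> q s by (simp add: c_def)
  have main: "\<exists>(P, Q)\<in>\<C>. c * (real n\<^sub>P powr ((2 * \<beta> + ?d) / (2 * \<gamma> * \<beta> + ?d)) + real n\<^sub>Q) powr (- (b / (2 * \<beta> + ?d)))
      \<le> expected_excess_risk n\<^sub>P n\<^sub>Q P Q f"
    if n: "n\<^sub>P \<noteq> 0 \<or> n\<^sub>Q \<noteq> 0" and f: "f \<in> classifiers n\<^sub>P n\<^sub>Q" for n\<^sub>P n\<^sub>Q and f :: "'d data \<Rightarrow> real^'d \<Rightarrow> bool"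
  proof -
    define T where "T = real n\<^sub>P powr ((2 * \<beta> + ?d) / (2 * \<gamma> * \<beta> + ?d)) + real n\<^sub>Q"
    define r where "r = s * T powr (- 1 / (2 * \<beta> + ?d))"
    note scale = critical_scale[OF d assms(3,6) s(1) n, folded T_def, folded r_def]
    have r: "0 < r" by (rule scale(1))
    have "good r" using scale(1,2) s(2) by (intro r1(2)) auto
    then have small: "C\<^sub>\<beta> * r powr \<beta> \<le> 1/2" "C\<^sub>\<gamma> * (C\<^sub>\<beta> * r powr \<beta>) powr \<gamma> \<le> 1/2"
      and fits: "r \<le> 1" "?d * L * r \<le> \<rho>" and rK: "r powr (?d - \<alpha> * \<beta>) \<le> K"
      using r pos d L unfolding good_def by (auto simp: field_simps powr_mult powr_powr)
    obtain S :: "(real^'d) set" where S: "finite S" "S \<noteq> {}" "pairwise (\<lambda>c c'. L * r \<le> dist c c') S"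
      and balls: "\<forall>c\<in>S. ball c r \<subseteq> ball x\<^sub>0 \<rho>"
      and upper: "real (card S) \<le> K * r powr (\<alpha> * \<beta> - ?d)" and lower: "\<kappa> * r powr (\<alpha> * \<beta> - ?d) \<le> real (card S)"
      unfolding \<kappa>_def by (rule exists_bump_centres[OF r fits(1) L fits(2) _ K rK, of x\<^sub>0]) (use pos in simp_all)
    have rd: "r ^ CARD('d) = r powr ?d" using r by (simp add: powr_realpow)
    have few: "real (card S) * (a * v * ?d * r ^ CARD('d)) \<le> C\<^sub>\<alpha> * C\<^sub>\<beta> powr \<alpha> * r powr (\<alpha> * \<beta>)"
    proof -
      have "real (card S) * (a * v * ?d * r ^ CARD('d)) \<le> K * r powr (\<alpha> * \<beta> - ?d) * (a * v * ?d * r ^ CARD('d))"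
        using upper a0 v d r by (intro mult_right_mono) auto
      also have "\<dots> = K\<^sub>0 * r powr (\<alpha> * \<beta>)"
        using a0 v d r by (simp add: K_def rd powr_diff)
      finally show ?thesis by (simp add: K\<^sub>0_def)
    qed
    have nQ: "real n\<^sub>Q * (4 * (C\<^sub>\<beta> * r powr \<beta>)\<^sup>2 * (a * v * r ^ CARD('d))) \<le> 1/4"
    proof -
      have "(r powr \<beta>)\<^sup>2 = r powr (2 * \<beta>)"
        by (simp add: power2_eq_square powr_add[symmetric])
      then have "real n\<^sub>Q * (4 * (C\<^sub>\<beta> * r powr \<beta>)\<^sup>2 * (a * v * r ^ CARD('d))) = 4 * C\<^sub>\<beta>\<^sup>2 * a * v * (real n\<^sub>Q * r powr (2 * \<beta> + ?d))"
        by (simp add: rd powr_add power_mult_distrib)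
      also have "\<dots> \<le> 4 * C\<^sub>\<beta>\<^sup>2 * a * v * (1 / (16 * C\<^sub>\<beta>\<^sup>2 * a * v))"
        using scale(3) good_s a0 v unfolding good_def by (intro mult_left_mono) auto
      also have "\<dots> = 1/4" using a0 v pos by simp
      finally show ?thesis .
    qed
    have nP: "real n\<^sub>P * (4 * (C\<^sub>\<gamma> * (C\<^sub>\<beta> * r powr \<beta>) powr \<gamma>)\<^sup>2 * (a * v * r ^ CARD('d))) \<le> 1/4"
    proof -
      have "((C\<^sub>\<beta> * r powr \<beta>) powr \<gamma>)\<^sup>2 = C\<^sub>\<beta> powr (2 * \<gamma>) * r powr (2 * \<gamma> * \<beta>)"
        using r pos by (simp add: powr_mult powr_powr power2_eq_square powr_add[symmetric] algebra_simps)
      then have "real n\<^sub>P * (4 * (C\<^sub>\<gamma> * (C\<^sub>\<beta> * r powr \<beta>) powr \<gamma>)\<^sup>2 * (a * v * r ^ CARD('d))) =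
          4 * C\<^sub>\<gamma>\<^sup>2 * C\<^sub>\<beta> powr (2 * \<gamma>) * a * v * (real n\<^sub>P * r powr (2 * \<gamma> * \<beta> + ?d))"
        by (simp add: rd powr_add power_mult_distrib)
      also have "\<dots> \<le> 4 * C\<^sub>\<gamma>\<^sup>2 * C\<^sub>\<beta> powr (2 * \<gamma>) * a * v * (1 / (16 * C\<^sub>\<gamma>\<^sup>2 * C\<^sub>\<beta> powr (2 * \<gamma>) * a * v))"
        using scale(4) good_s a0 v unfolding good_def by (intro mult_left_mono) auto
      also have "\<dots> = 1/4" using a0 v pos by simp
      finally show ?thesis .
    qed
    have "\<exists>(P, Q)\<in>transfer_class \<alpha> C\<^sub>\<alpha> \<beta> C\<^sub>\<beta> \<gamma> C\<^sub>\<gamma> \<mu>\<^sub>m \<mu>\<^sub>M c\<^sub>\<mu> r\<^sub>\<mu>.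
      real (card S) * (C\<^sub>\<beta> * (r/2) powr \<beta> * (a * v * (r/2) ^ CARD('d))) \<le> 8 * expected_excess_risk n\<^sub>P n\<^sub>Q P Q f"
      unfolding v_def
    proof (rule bump_family_risk_lower_bound[OF pos ab \<nu> _ _ _ S(1,2) r])
      show "measure_support \<nu> \<subseteq> cbox 0 1" "regular_set c\<^sub>\<mu> r\<^sub>\<mu> (measure_support \<nu>)"
          "density_between \<mu>\<^sub>m \<mu>\<^sub>M (measure_support \<nu>) \<nu>"
        using geom(1,4) supp by auto
      show "pairwise (\<lambda>c c'. (2 + 2 powr (1/\<beta>)) * r \<le> dist c c') S"
        using S(3) by (simp add: L_def)
      show "ball c r \<subseteq> measure_support \<nu>" if "c \<in> S" for c
        using bspec[OF balls that] subset_ball[OF \<rho>(2), of x\<^sub>0] patch(2) supp(1) by blast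
      show "measure \<nu> E = a * measure lborel E" if "c \<in> S" "E \<subseteq> ball c r" "E \<in> sets borel" for c E
        using bspec[OF flat that(3)] bspec[OF balls that(1)] that(2) by blast
    qed (use a0 few small nP nQ f in \<open>auto simp: v_def\<close>)
    then obtain P Q where PQ: "(P, Q) \<in> \<C>"
      "real (card S) * (C\<^sub>\<beta> * (r/2) powr \<beta> * (a * v * (r/2) ^ CARD('d))) \<le> 8 * expected_excess_risk n\<^sub>P n\<^sub>Q P Q f"
      using assms(13) by blast
    have eq: "C\<^sub>\<beta> * (r/2) powr \<beta> * (a * v * (r/2) ^ CARD('d)) = q * r powr (\<beta> + ?d)"
      using r by (simp add: q_def powr_divide power_divide rd powr_add)
    have "\<kappa> * q * r powr b = \<kappa> * r powr (\<alpha> * \<beta> - ?d) * (q * r powr (\<beta> + ?d))"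
      using r by (simp add: b_def powr_add[symmetric] algebra_simps)
    also have "\<dots> \<le> real (card S) * (q * r powr (\<beta> + ?d))"
      using lower q by (intro mult_right_mono) auto
    also have "\<dots> \<le> 8 * expected_excess_risk n\<^sub>P n\<^sub>Q P Q f"
      using PQ(2) unfolding eq .
    finally have "c * T powr (- (b / (2 * \<beta> + ?d))) \<le> expected_excess_risk n\<^sub>P n\<^sub>Q P Q f"
      by (simp add: scale(5)[of b] c_def)
    then show ?thesis using PQ(1) unfolding T_def by blast
  qed
  show ?thesis
  proof (intro exI[of _ c] conjI c allI impI INF_greatest)
    fix n\<^sub>P n\<^sub>Q :: nat and f :: "'d data \<Rightarrow> real^'d \<Rightarrow> bool"
    assume n: "n\<^sub>P \<noteq> 0 \<or> n\<^sub>Q \<noteq> 0" and f: "f \<in> classifiers n\<^sub>P n\<^sub>Q"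
    obtain P Q where "(P, Q) \<in> \<C>" "c * (real n\<^sub>P powr ((2 * \<beta> + ?d) / (2 * \<gamma> * \<beta> + ?d)) + real n\<^sub>Q)
        powr (- (b / (2 * \<beta> + ?d))) \<le> expected_excess_risk n\<^sub>P n\<^sub>Q P Q f"
      using main[OF n f] by blast
    then show "ereal (c * (real n\<^sub>P powr ((2 * \<beta> + ?d) / (2 * \<gamma> * \<beta> + ?d)) + real n\<^sub>Q) powr (- (\<beta> * (1 + \<alpha>) / (2 * \<beta> + ?d))))
        \<le> (SUP (P, Q)\<in>\<C>. ereal (expected_excess_risk n\<^sub>P n\<^sub>Q P Q f))"
      by (intro SUP_upper2[of "(P, Q)"]) (auto simp: b_def)
  qed
qed

end
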